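(* Let $\mathcal{D}\subset\mathbb{R}^n$ be open and connected, and let $F:\mathcal{D}\to\mathbb{R}^m$ be a smooth map satisfying the minimal graph system (i.e. the graph of $F$ is a minimal submanifold of $\mathbb{R}^n\times\mathbb{R}^m$). For $x\in\mathcal{D}$ let $\mathcal{S}(x)=\sum_{i=1}^{r}\frac{\lambda_i^2}{1+\lambda_i^2}$, where $r=\operatorname{rank}\mathrm{d}F|_x$ and $\lambda_1,\ldots,\lambda_r>0$ are the nonzero singular values of $\mathrm{d}F|_x$. Suppose $\mathcal{S}\leq 1$ on $\mathcal{D}$. Then either $\mathcal{S}<1$ everywhere on $\mathcal{D}$, or $\mathcal{S}\equiv 1$ on $\mathcal{D}$. Furthermore, if $\mathcal{S}\equiv 1$ on $\mathcal{D}$, then one of the following two possibilities occurs: (1) $\operatorname{rank}\mathrm{d}F|_{x_0}\geq 3$ at some $x_0\in\mathcal{D}$; in this case $F$ is an affine function. (2) $\operatorname{rank}\mathrm{d}F\equiv 2$ on $\mathcal{D}$; in this case the image of $F$ is contained in a $2$-dimensional affine subspace of $\mathbb{R}^m$.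
   Context: Minimal graph system: $F$ satisfies the minimal graph system if its graph $\{(x,F(x)):x\in\mathcal{D}\}\subset\mathbb{R}^n\times\mathbb{R}^m$ has vanishing mean curvature vector. An empty sum is $0$ (so $\mathcal{S}=0$ where $\mathrm{d}F=0$). *)

theory Defs
  imports "HOL-Analysis.Analysis" "HOL-Library.Multiset"
begin

primrec times_differentiable_on ::
    "nat \<Rightarrow> ('a::real_normed_vector \<Rightarrow> 'b::real_normed_vector) \<Rightarrow> 'a set \<Rightarrow> bool" where
  "times_differentiable_on 0 f S \<longleftrightarrow> continuous_on S f"
| "times_differentiable_on (Suc k) f S \<longleftrightarrow>
     (\<forall>x\<in>S. f differentiable (at x)) \<and>
     (\<forall>v. times_differentiable_on k (\<lambda>x. frechet_derivative f (at x) v) S)"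

text \<open>Only meant for open \<open>S\<close>: the derivatives are two-sided, not taken within \<open>S\<close>.\<close>

definition smooth_on :: "'a::real_normed_vector set \<Rightarrow> ('a \<Rightarrow> 'b::real_normed_vector) \<Rightarrow> bool" where
  "smooth_on S f \<longleftrightarrow> (\<forall>k. times_differentiable_on k f S)"


definition partial_deriv :: "'n \<Rightarrow> (real^'n \<Rightarrow> 'b::real_normed_vector) \<Rightarrow> real^'n \<Rightarrow> 'b" where
  "partial_deriv i X x = frechet_derivative X (at x) (axis i 1)"

definition induced_metric :: "(real^'n \<Rightarrow> 'b::euclidean_space) \<Rightarrow> real^'n \<Rightarrow> real^'n^'n" where
  "induced_metric X x = (\<chi> i j. partial_deriv i X x \<bullet> partial_deriv j X x)"

definition tangent_space :: "(real^'n \<Rightarrow> 'b::euclidean_space) \<Rightarrow> real^'n \<Rightarrow> 'b set" where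
  "tangent_space X x = range (frechet_derivative X (at x))"

definition normal_component :: "'b::euclidean_space set \<Rightarrow> 'b \<Rightarrow> 'b" where
  "normal_component T w = (THE z. (\<forall>t\<in>T. orthogonal z t) \<and> w - z \<in> T)"

lemma normal_component_ex1:
  fixes T :: "'b::euclidean_space set"
  assumes "subspace T"
  shows "\<exists>!z. (\<forall>t\<in>T. orthogonal z t) \<and> w - z \<in> T"
proof -
  obtain y z where yz: "y \<in> span T" "\<And>t. t \<in> span T \<Longrightarrow> orthogonal z t" "w = y + z"
    using orthogonal_subspace_decomp_exists by blast
  have sp: "span T = T"
    using assms by (simp add: span_eq_iff)
  show ?thesis
  proof (rule ex1I[of _ z])
    show "(\<forall>t\<in>T. orthogonal z t) \<and> w - z \<in> T"
      using yz sp by auto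
  next
    fix z' assume z': "(\<forall>t\<in>T. orthogonal z' t) \<and> w - z' \<in> T"
    have "(w - z') - (w - z) \<in> T"
      using subspace_diff[OF assms, of "w - z'" "w - z"] z' yz sp by simp
    then have "z - z' \<in> T" by simp
    then have "orthogonal (z - z') (z - z')"
      using z' yz(2) sp by (simp add: orthogonal_def inner_diff_left)
    then show "z' = z" by (simp add: orthogonal_def)
  qed
qed

definition second_fundamental_form ::
    "(real^'n \<Rightarrow> 'b::euclidean_space) \<Rightarrow> real^'n \<Rightarrow> 'n \<Rightarrow> 'n \<Rightarrow> 'b" where
  "second_fundamental_form X x i j =
     normal_component (tangent_space X x) (partial_deriv i (partial_deriv j X) x)"

text \<open>The trace of the second fundamental form with respect to the induced metric,
  without the factor \<open>1/n\<close> that some authors include.\<close>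

definition mean_curvature_vector ::
    "(real^'n \<Rightarrow> 'b::euclidean_space) \<Rightarrow> real^'n \<Rightarrow> 'b" where
  "mean_curvature_vector X x =
     (\<Sum>i\<in>UNIV. \<Sum>j\<in>UNIV.
        (matrix_inv (induced_metric X x) $ i $ j) *\<^sub>R second_fundamental_form X x i j)"

definition minimal_graph_on :: "(real^'n) set \<Rightarrow> (real^'n \<Rightarrow> real^'m) \<Rightarrow> bool" where
  "minimal_graph_on D F \<longleftrightarrow> (\<forall>x\<in>D. mean_curvature_vector (\<lambda>y. (y, F y)) x = 0)"


definition gram_eigenspace :: "real^'n^'m \<Rightarrow> real \<Rightarrow> (real^'n) set" where
  "gram_eigenspace A \<mu> = {v. (transpose A ** A) *v v = \<mu> *\<^sub>R v}"

text \<open>Each singular value occurs with its multiplicity, so the multiset has \<open>rank A\<close> elements.\<close>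

definition nonzero_singular_values :: "real^'n^'m \<Rightarrow> real multiset" where
  "nonzero_singular_values A =
     (\<Sum>\<sigma> | \<sigma> > 0 \<and> gram_eigenspace A (\<sigma>\<^sup>2) \<noteq> {0}.
        replicate_mset (dim (gram_eigenspace A (\<sigma>\<^sup>2))) \<sigma>)"

text \<open>The index set of the sum above is finite, so that the sum is not the default
  value for infinite sums.\<close>

lemma finite_nonzero_singular_values:
  fixes A :: "real^'n^'m"
  shows "finite {\<sigma>. \<sigma> > 0 \<and> gram_eigenspace A (\<sigma>\<^sup>2) \<noteq> {0}}" (is "finite ?S")
proof -
  have zero: "0 \<in> gram_eigenspace A \<mu>" for \<mu>
    by (simp add: gram_eigenspace_def)
  define e where "e \<sigma> = (SOME v. v \<in> gram_eigenspace A (\<sigma>\<^sup>2) \<and> v \<noteq> 0)" for \<sigma>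
  have e: "e \<sigma> \<in> gram_eigenspace A (\<sigma>\<^sup>2) \<and> e \<sigma> \<noteq> 0" if "\<sigma> \<in> ?S" for \<sigma>
  proof -
    have "\<exists>v. v \<in> gram_eigenspace A (\<sigma>\<^sup>2) \<and> v \<noteq> 0"
      using that zero[of "\<sigma>\<^sup>2"] by blast
    then show ?thesis unfolding e_def by (rule someI_ex)
  qed
  have orth: "orthogonal (e \<sigma>) (e \<tau>)" if "\<sigma> \<in> ?S" "\<tau> \<in> ?S" "\<sigma> \<noteq> \<tau>" for \<sigma> \<tau>
  proof -
    have 1: "(transpose A ** A) *v e \<sigma> = \<sigma>\<^sup>2 *\<^sub>R e \<sigma>"
      and 2: "(transpose A ** A) *v e \<tau> = \<tau>\<^sup>2 *\<^sub>R e \<tau>"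
      using e[OF that(1)] e[OF that(2)] by (simp_all add: gram_eigenspace_def)
    have "((transpose A ** A) *v e \<sigma>) \<bullet> e \<tau> = e \<sigma> \<bullet> ((transpose A ** A) *v e \<tau>)"
    proof -
      have "((transpose A ** A) *v e \<sigma>) \<bullet> e \<tau> = (A *v e \<sigma>) \<bullet> (A *v e \<tau>)"
        by (metis dot_lmul_matrix matrix_vector_mul_assoc transpose_matrix_vector)
      moreover have "e \<sigma> \<bullet> ((transpose A ** A) *v e \<tau>) = (A *v e \<sigma>) \<bullet> (A *v e \<tau>)"
        by (metis dot_lmul_matrix inner_commute matrix_vector_mul_assoc transpose_matrix_vector)
      ultimately show ?thesis by simp
    qed
    then have "\<sigma>\<^sup>2 * (e \<sigma> \<bullet> e \<tau>) = \<tau>\<^sup>2 * (e \<sigma> \<bullet> e \<tau>)"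
      unfolding 1 2 by simp
    moreover have "\<sigma>\<^sup>2 \<noteq> \<tau>\<^sup>2"
      using that by (simp add: power2_eq_iff)
    ultimately show ?thesis by (simp add: orthogonal_def)
  qed
  have "inj_on e ?S"
  proof (rule inj_onI, rule ccontr)
    fix \<sigma> \<tau> assume st: "\<sigma> \<in> ?S" "\<tau> \<in> ?S" "e \<sigma> = e \<tau>" "\<sigma> \<noteq> \<tau>"
    then have "orthogonal (e \<sigma>) (e \<sigma>)" using orth[OF st(1,2,4)] by simp
    then show False using e[OF st(1)] by (simp add: orthogonal_def)
  qed
  moreover have "pairwise orthogonal (e ` ?S)"
    by (intro pairwiseI) (use orth in fast)
  ultimately show ?thesis
    by (intro finite_imageD[of e] pairwise_orthogonal_imp_finite)
qed

definition singular_sum :: "(real^'n \<Rightarrow> real^'m) \<Rightarrow> real^'n \<Rightarrow> real" where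
  "singular_sum F x =
     (\<Sum>\<sigma>\<in>#nonzero_singular_values (jacobian F (at x)). \<sigma>\<^sup>2 / (1 + \<sigma>\<^sup>2))"

definition affine_map_on :: "'a::real_vector set \<Rightarrow> ('a \<Rightarrow> 'b::real_vector) \<Rightarrow> bool" where
  "affine_map_on D F \<longleftrightarrow> (\<exists>L b. linear L \<and> (\<forall>x\<in>D. F x = L x + b))"

end

theory Submission
  imports Defs
begin

text \<open>Write \<open>g = I + dF\<^sup>T dF\<close>, so that the singular sum is \<open>S = n - tr g\<inverse>\<close>, and minimality of the graph
  amounts to \<open>\<Sum> g\<^sup>i\<^sup>j F\<^sub>i\<^sub>j = 0\<close>. At a point choose a singular frame \<open>dF a\<^sub>i = \<kappa>\<^sub>i b\<^sub>i\<close> and put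
  \<open>w\<^sub>i = 1 / (1 + \<kappa>\<^sub>i\<^sup>2)\<close>, \<open>s\<^sub>i = 1 - w\<^sub>i\<close>. Up to positive weights, \<open>\<Sum> w\<^sub>k \<partial>\<^sub>k\<partial>\<^sub>k S\<close> is then the sum of
  \<open>(1 - s\<^sub>l - s\<^sub>i) (b\<^sub>l \<bullet> F\<^sub>i\<^sub>k)\<^sup>2\<close> over all \<open>i, k, l\<close>, plus squares of the components of \<open>F\<^sub>i\<^sub>k\<close> normal
  to the image of \<open>dF\<close>. For \<open>S \<le> 1\<close> only the diagonal terms \<open>l = i\<close> can be negative, and they are
  controlled by the gradient of \<open>S\<close>. Hence \<open>\<Sum> w\<^sub>k \<partial>\<^sub>k\<partial>\<^sub>k S \<ge> - C \<bar>\<nabla>S\<bar>\<close> locally, and the strong maximum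
  principle yields the dichotomy. If \<open>S \<equiv> 1\<close>, the off-diagonal and the normal terms vanish. At points of rank at least \<open>3\<close>
  all off-diagonal coefficients are positive, which with minimality forces \<open>D\<^sup>2F = 0\<close>. If the rank
  is \<open>2\<close> throughout, \<open>D\<^sup>2F\<close> takes values in the image of \<open>dF\<close>, which is therefore constant by a
  Gronwall argument.\<close>

section \<open>Directional derivatives\<close>

text \<open>Singular values and singular vectors may fail to be differentiable where singular values
  collide or vanish, so no moving frame is ever differentiated. Derivatives are taken in a constant
  orthonormal basis \<open>a\<close>, in which the entries of the inverse metric are differentiable
  and whose choice does not affect their trace; \<open>a\<close> is matched with the singular frame
  only at the single point under study.

  The obstacle is the diagonal coefficient \<open>1 - 2 s\<^sub>i\<close>, negative for the at most
  one index with \<open>s\<^sub>i > 1/2\<close>. The diagonal part is then nonnegative only where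
  the gradient of \<open>S\<close> vanishes. Otherwise the loss is at most linear in the gradient,
  with a factor bounded by the second derivatives of \<open>F\<close>, and such a first-order term
  is what Hopf's comparison argument tolerates.

  For rank \<open>2\<close> and \<open>S = 1\<close> the two nonzero \<open>s\<^sub>i\<close> add up
  to \<open>1\<close>, so the off-diagonal coefficient of this pair is \<open>0\<close> and no
  longer forces its components of \<open>D\<^sup>2F\<close> to vanish. What is used there is only
  that \<open>D\<^sup>2F\<close> is tangent to the image of \<open>dF\<close>; hence a plane instead
  of affinity.\<close>

definition dderiv :: "'a::real_normed_vector \<Rightarrow> ('a \<Rightarrow> 'b::real_normed_vector) \<Rightarrow> 'a \<Rightarrow> 'b" where
  "dderiv v f x = frechet_derivative f (at x) v"

lemma partial_deriv_eq_dderiv: "partial_deriv i f = dderiv (axis i 1) f"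
  by (rule ext) (simp add: partial_deriv_def dderiv_def)

lemma smooth_on_differentiable: "smooth_on S f \<Longrightarrow> x \<in> S \<Longrightarrow> f differentiable (at x)"
  unfolding smooth_on_def by (metis times_differentiable_on.simps(2))

lemma smooth_on_dderiv: "smooth_on S f \<Longrightarrow> smooth_on S (dderiv v f)"
  unfolding smooth_on_def dderiv_def[abs_def] by (metis times_differentiable_on.simps(2))

lemma smooth_on_continuous: "smooth_on S f \<Longrightarrow> continuous_on S f"
  unfolding smooth_on_def by (metis times_differentiable_on.simps(1))

lemma has_derivative_dderiv:
  "f differentiable (at x) \<Longrightarrow> (f has_derivative (\<lambda>v. dderiv v f x)) (at x)"
  unfolding dderiv_def by (simp add: frechet_derivative_works)

lemma dderiv_unique: "(f has_derivative f') (at x) \<Longrightarrow> dderiv v f x = f' v"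
  using frechet_derivative_at unfolding dderiv_def by metis

lemma linear_dderiv: "f differentiable (at x) \<Longrightarrow> linear (\<lambda>v. dderiv v f x)"
  unfolding dderiv_def by (simp add: linear_frechet_derivative)

lemma dderiv_cong_open:
  assumes "open S" "x \<in> S" "\<And>y. y \<in> S \<Longrightarrow> f y = g y" "f differentiable (at x)"
  shows "dderiv v f x = dderiv v g x"
  using frechet_derivative_transform_within_open[OF assms(4,1,2,3)] unfolding dderiv_def by simp

lemma dderiv_inner_const:
  assumes "f differentiable (at x)"
  shows "dderiv v (\<lambda>x. f x \<bullet> c) x = dderiv v f x \<bullet> c"
  by (rule dderiv_unique) (rule has_derivative_inner_left[OF has_derivative_dderiv[OF assms]])

lemma has_derivative_line:
  assumes "f differentiable (at (x + t *\<^sub>R v))"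
  shows "((\<lambda>t. f (x + t *\<^sub>R v)) has_vector_derivative dderiv v f (x + t *\<^sub>R v)) (at t)"
proof -
  have 1: "((\<lambda>t. x + t *\<^sub>R v) has_derivative (\<lambda>h. h *\<^sub>R v)) (at t)"
    by (auto intro!: derivative_eq_intros)
  have "((\<lambda>t. f (x + t *\<^sub>R v)) has_derivative (\<lambda>h. dderiv (h *\<^sub>R v) f (x + t *\<^sub>R v))) (at t)"
    using has_derivative_compose[OF 1 has_derivative_dderiv[OF assms]] .
  then show ?thesis
    unfolding has_vector_derivative_def linear_scale[OF linear_dderiv[OF assms]] .
qed

lemma open_line_eventually:
  fixes x :: "'a::real_normed_vector"
  assumes "open S" "x \<in> S"
  shows "\<forall>\<^sub>F t in nhds (0::real). x + t *\<^sub>R v \<in> S"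
proof -
  have "((\<lambda>t. x + t *\<^sub>R v) \<longlongrightarrow> x + 0 *\<^sub>R v) (nhds (0::real))"
    by (intro tendsto_intros filterlim_ident)
  then show ?thesis using topological_tendstoD[OF _ assms(1)] assms(2) by fastforce
qed

section \<open>Symmetry of second derivatives\<close>

text \<open>The left-hand side of the equation is symmetric in \<open>u\<close> and \<open>v\<close>; this is the source of the
  symmetry of second derivatives.\<close>

lemma second_difference_mean_value:
  fixes f :: "'a::real_normed_vector \<Rightarrow> real"
  assumes sub: "\<And>s t. 0 \<le> s \<Longrightarrow> s \<le> h \<Longrightarrow> 0 \<le> t \<Longrightarrow> t \<le> h \<Longrightarrow> x + s *\<^sub>R u + t *\<^sub>R v \<in> S"
    and "0 < h"
    and f1: "\<And>y. y \<in> S \<Longrightarrow> f differentiable (at y)"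
    and f2: "\<And>y. y \<in> S \<Longrightarrow> dderiv u f differentiable (at y)"
  shows "\<exists>s t. 0 \<le> s \<and> s \<le> h \<and> 0 \<le> t \<and> t \<le> h \<and>
    f (x + h *\<^sub>R u + h *\<^sub>R v) - f (x + h *\<^sub>R u) - (f (x + h *\<^sub>R v) - f x) =
      h * h * dderiv v (dderiv u f) (x + s *\<^sub>R u + t *\<^sub>R v)"
proof -
  \<comment> \<open>The second difference is \<open>\<phi> h - \<phi> 0\<close>. The mean value
    theorem in the direction \<open>u\<close> leaves a first difference of \<open>dderiv u f\<close>
    in the direction \<open>v\<close>, to which it applies once more.\<close>
  define \<phi> where "\<phi> s = f (x + s *\<^sub>R u + h *\<^sub>R v) - f (x + s *\<^sub>R u)" for s
  have d1: "(\<phi> has_real_derivative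
      dderiv u f (x + s *\<^sub>R u + h *\<^sub>R v) - dderiv u f (x + s *\<^sub>R u)) (at s)"
    if "0 \<le> s" "s \<le> h" for s
  proof -
    have "x + h *\<^sub>R v + s *\<^sub>R u \<in> S" "x + s *\<^sub>R u \<in> S"
      using sub[of s h] sub[of s 0] that \<open>0 < h\<close> by (simp_all add: algebra_simps)
    from this[THEN f1, THEN has_derivative_line] show ?thesis
      unfolding \<phi>_def has_real_derivative_iff_has_vector_derivative
      by (auto intro!: derivative_eq_intros simp: algebra_simps)
  qed
  obtain s where s: "0 < s" "s < h" "\<phi> h - \<phi> 0 =
      (h - 0) * (dderiv u f (x + s *\<^sub>R u + h *\<^sub>R v) - dderiv u f (x + s *\<^sub>R u))"
    using MVT2[OF \<open>0 < h\<close> d1] by blast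
  have d2: "((\<lambda>t. dderiv u f (x + s *\<^sub>R u + t *\<^sub>R v)) has_real_derivative
      dderiv v (dderiv u f) (x + s *\<^sub>R u + t *\<^sub>R v)) (at t)" if "0 \<le> t" "t \<le> h" for t
    unfolding has_real_derivative_iff_has_vector_derivative
    by (rule has_derivative_line, rule f2) (use sub that s in auto)
  obtain t where t: "0 < t" "t < h"
    "dderiv u f (x + s *\<^sub>R u + h *\<^sub>R v) - dderiv u f (x + s *\<^sub>R u + 0 *\<^sub>R v) =
      (h - 0) * dderiv v (dderiv u f) (x + s *\<^sub>R u + t *\<^sub>R v)"
    using MVT2[OF \<open>0 < h\<close> d2] by blast
  show ?thesis
    by (rule exI[of _ s], rule exI[of _ t]) (use s t in \<open>simp add: \<phi>_def\<close>)
qed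

text \<open>One and the same second difference over a small parallelogram is \<open>h * h\<close>
  times either mixed derivative, each taken at some nearby point. Continuity of both at
  \<open>x\<close> makes them agree there.\<close>

lemma dderiv_commute_real:
  fixes f :: "'a::real_normed_vector \<Rightarrow> real"
  assumes S: "open S" "x \<in> S" and f: "smooth_on S f"
  shows "dderiv u (dderiv v f) x = dderiv v (dderiv u f) x"
proof -
  define P where "P = dderiv u (dderiv v f)"
  define R where "R = dderiv v (dderiv u f)"
  have cont: "isCont P x" "isCont R x"
    unfolding P_def R_def
    using smooth_on_continuous[OF smooth_on_dderiv[OF smooth_on_dderiv[OF f]]]
    by (simp_all add: continuous_on_eq_continuous_at S)
  have "\<bar>P x - R x\<bar> < e" if "e > 0" for e
  proof -
    obtain d1 where d1: "d1 > 0" "\<And>y. dist y x < d1 \<Longrightarrow> dist (P y) (P x) < e / 2"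
      using cont(1) \<open>e > 0\<close> unfolding continuous_at_eps_delta by (metis half_gt_zero)
    obtain d2 where d2: "d2 > 0" "\<And>y. dist y x < d2 \<Longrightarrow> dist (R y) (R x) < e / 2"
      using cont(2) \<open>e > 0\<close> unfolding continuous_at_eps_delta by (metis half_gt_zero)
    obtain d3 where d3: "d3 > 0" "ball x d3 \<subseteq> S"
      using S open_contains_ball by blast
    define d where "d = min d1 (min d2 d3)"
    \<comment> \<open>For \<open>s, t \<le> h\<close> the displacement is at most
      \<open>h * (norm u + norm v) \<le> d / 2\<close>; the summand \<open>1\<close> keeps the
      denominator positive for \<open>u = v = 0\<close>.\<close>
    define h where "h = d / (2 * (norm u + norm v + 1))"
    have d: "d > 0" using d1 d2 d3 d_def by simp
    have N: "norm u + norm v + 1 > 0"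
      by (smt (verit) norm_ge_zero)
    have h: "h > 0" using d N by (simp add: h_def)
    have close: "dist (x + s *\<^sub>R u + t *\<^sub>R v) x < d"
      if "0 \<le> s" "s \<le> h" "0 \<le> t" "t \<le> h" for s t
    proof -
      have "dist (x + s *\<^sub>R u + t *\<^sub>R v) x = norm (s *\<^sub>R u + t *\<^sub>R v)"
        by (simp add: dist_norm algebra_simps)
      also have "\<dots> \<le> s * norm u + t * norm v"
        using norm_triangle_ineq[of "s *\<^sub>R u" "t *\<^sub>R v"] that by simp
      also have "\<dots> \<le> h * norm u + h * norm v"
        using that by (intro add_mono mult_right_mono) auto
      also have "\<dots> \<le> h * (norm u + norm v + 1)"
        using h by (simp add: algebra_simps)
      also have "\<dots> = d / 2"
        using N by (simp add: h_def field_simps)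
      also have "\<dots> < d" using d by simp
      finally show ?thesis .
    qed
    then have sub: "x + s *\<^sub>R u + t *\<^sub>R v \<in> S"
      if "0 \<le> s" "s \<le> h" "0 \<le> t" "t \<le> h" for s t
      using d3(2) that unfolding d_def by (auto simp: dist_commute subset_eq)
    then have sub': "x + s *\<^sub>R v + t *\<^sub>R u \<in> S"
      if "0 \<le> s" "s \<le> h" "0 \<le> t" "t \<le> h" for s t
      using sub[of t s] that by (simp add: algebra_simps)
    note dif = smooth_on_differentiable[OF f] smooth_on_differentiable[OF smooth_on_dderiv[OF f]]
    obtain s t where 1: "0 \<le> s" "s \<le> h" "0 \<le> t" "t \<le> h"
      "f (x + h *\<^sub>R u + h *\<^sub>R v) - f (x + h *\<^sub>R u) - (f (x + h *\<^sub>R v) - f x) =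
        h * h * R (x + s *\<^sub>R u + t *\<^sub>R v)"
      using second_difference_mean_value[OF sub h dif] unfolding R_def by auto
    obtain s' t' where 2: "0 \<le> s'" "s' \<le> h" "0 \<le> t'" "t' \<le> h"
      "f (x + h *\<^sub>R v + h *\<^sub>R u) - f (x + h *\<^sub>R v) - (f (x + h *\<^sub>R u) - f x) =
        h * h * P (x + s' *\<^sub>R v + t' *\<^sub>R u)"
      using second_difference_mean_value[OF sub' h dif] unfolding P_def by auto
    have sw: "x + h *\<^sub>R v + h *\<^sub>R u = x + h *\<^sub>R u + h *\<^sub>R v"
      "x + s' *\<^sub>R v + t' *\<^sub>R u = x + t' *\<^sub>R u + s' *\<^sub>R v" by simp_all
    have "h * h * P (x + t' *\<^sub>R u + s' *\<^sub>R v) = h * h * R (x + s *\<^sub>R u + t *\<^sub>R v)"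
      using 1(5) 2(5) unfolding sw by linarith
    then have eq: "P (x + t' *\<^sub>R u + s' *\<^sub>R v) = R (x + s *\<^sub>R u + t *\<^sub>R v)"
      using h by simp
    have "dist (P (x + t' *\<^sub>R u + s' *\<^sub>R v)) (P x) < e / 2"
      by (rule d1(2)) (use close[OF 2(3,4,1,2)] d_def in linarith)
    moreover have "dist (R (x + s *\<^sub>R u + t *\<^sub>R v)) (R x) < e / 2"
      by (rule d2(2)) (use close[OF 1(1-4)] d_def in linarith)
    ultimately show ?thesis
      unfolding eq dist_real_def by linarith
  qed
  then have "\<bar>P x - R x\<bar> = 0"
    by (metis abs_ge_zero less_irrefl order_le_less)
  then show ?thesis by (simp add: P_def R_def)
qed

lemma times_differentiable_on_inner_const:
  assumes "open S"
  shows "times_differentiable_on k f S \<Longrightarrow> times_differentiable_on k (\<lambda>x. f x \<bullet> c) S"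
proof (induction k arbitrary: f)
  case 0
  then show ?case by (auto intro!: continuous_intros)
next
  case (Suc k)
  have "times_differentiable_on k (\<lambda>x. frechet_derivative (\<lambda>x. f x \<bullet> c) (at x) v) S" for v
  proof -
    \<comment> \<open>The formula for the derivative of \<open>f x \<bullet> c\<close> holds only on
      \<open>S\<close>, where \<open>f\<close> is differentiable, so higher derivatives have to be
      compared on the open set \<open>S\<close> alone.\<close>
    have cong: "times_differentiable_on k h S \<longleftrightarrow> times_differentiable_on k h' S"
      if "\<And>y. y \<in> S \<Longrightarrow> h y = h' y" for h h' :: "'a \<Rightarrow> real"
      using that
    proof (induction k arbitrary: h h')
      case 0
      then show ?case by (auto intro!: continuous_on_cong)
    next
      case (Suc k)
      have "(h has_derivative A) (at x) \<longleftrightarrow> (h' has_derivative A) (at x)" if "x \<in> S" for x A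
        using has_derivative_transform_within_open[OF _ assms that] Suc.prems by metis
      then have "frechet_derivative h (at x) = frechet_derivative h' (at x)"
        "h differentiable (at x) \<longleftrightarrow> h' differentiable (at x)" if "x \<in> S" for x
        using that by (simp_all add: frechet_derivative_def differentiable_def)
      then show ?case using Suc.IH[of "\<lambda>x. frechet_derivative h (at x) v" "\<lambda>x. frechet_derivative h' (at x) v" for v]
        by auto
    qed
    have "frechet_derivative (\<lambda>x. f x \<bullet> c) (at x) v = frechet_derivative f (at x) v \<bullet> c"
      if "x \<in> S" for x
      using dderiv_inner_const[of f x v c] Suc.prems that unfolding dderiv_def by simp
    then have "times_differentiable_on k (\<lambda>x. frechet_derivative (\<lambda>x. f x \<bullet> c) (at x) v) S \<longleftrightarrow>
      times_differentiable_on k (\<lambda>x. frechet_derivative f (at x) v \<bullet> c) S"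
      by (rule cong)
    then show ?thesis using Suc.IH[of "\<lambda>x. frechet_derivative f (at x) v"] Suc.prems by simp
  qed
  then show ?case using Suc.prems by simp
qed

text \<open>Testing against every vector \<open>c\<close> reduces this to real-valued functions, for
  which the mean value theorem is available.\<close>

lemma dderiv_commute:
  fixes f :: "'a::real_normed_vector \<Rightarrow> 'b::real_inner"
  assumes S: "open S" "x \<in> S" and f: "smooth_on S f"
  shows "dderiv u (dderiv v f) x = dderiv v (dderiv u f) x"
proof -
  have "dderiv u (dderiv v f) x \<bullet> c = dderiv v (dderiv u f) x \<bullet> c" for c
  proof -
    have sm: "smooth_on S (\<lambda>x. f x \<bullet> c)"
      using times_differentiable_on_inner_const[OF S(1)] f unfolding smooth_on_def by blast
    have "dderiv p (dderiv q (\<lambda>x. f x \<bullet> c)) x = dderiv p (dderiv q f) x \<bullet> c" for p q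
    proof -
      have "dderiv p (dderiv q (\<lambda>x. f x \<bullet> c)) x = dderiv p (\<lambda>x. dderiv q f x \<bullet> c) x"
        using smooth_on_differentiable[OF f] smooth_on_differentiable[OF smooth_on_dderiv[OF sm]] S
        by (intro dderiv_cong_open[OF S] dderiv_inner_const) auto
      also have "\<dots> = dderiv p (dderiv q f) x \<bullet> c"
        using smooth_on_differentiable[OF smooth_on_dderiv[OF f]] S by (intro dderiv_inner_const) auto
      finally show ?thesis .
    qed
    then show ?thesis using dderiv_commute_real[OF S sm] by simp
  qed
  then show ?thesis
    using vector_eq_rdot by blast
qed

section \<open>Singular value decomposition\<close>

text \<open>A maximiser \<open>v\<close> of the Rayleigh quotient on the unit sphere of
  \<open>V\<close> is an eigenvector: the form \<open>q\<close> is nonnegative on \<open>V\<close>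
  and vanishes at \<open>v\<close>, and moving \<open>v\<close> along the residual \<open>u\<close>
  would make it negative unless \<open>u = 0\<close>.\<close>

lemma self_adjoint_eigenvector:
  fixes f :: "'a::euclidean_space \<Rightarrow> 'a"
  assumes lin: "linear f" and adj: "\<And>x y. f x \<bullet> y = x \<bullet> f y"
    and V: "subspace V" "f ` V \<subseteq> V" "V \<noteq> {0}"
  shows "\<exists>v\<in>V. \<exists>c. norm v = 1 \<and> f v = c *\<^sub>R v"
proof -
  obtain x where x: "x \<in> V" "x \<noteq> 0"
    using V subspace_0 by blast
  have "compact (V \<inter> sphere 0 1)"
    using closed_subspace[OF V(1)] by (simp add: closed_Int_compact)
  moreover have "(1 / norm x) *\<^sub>R x \<in> V \<inter> sphere 0 1"
    using x V(1) by (simp add: subspace_scale)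
  moreover have "continuous_on (V \<inter> sphere 0 1) (\<lambda>x. f x \<bullet> x)"
    using lin by (intro continuous_intros linear_continuous_on linear_conv_bounded_linear[THEN iffD1])
  ultimately obtain v where v: "v \<in> V" "norm v = 1"
    and sup: "\<And>y. y \<in> V \<Longrightarrow> norm y = 1 \<Longrightarrow> f y \<bullet> y \<le> f v \<bullet> v"
    using continuous_attains_sup[of "V \<inter> sphere 0 1" "\<lambda>x. f x \<bullet> x"] that
    by (metis (no_types, lifting) IntE IntI empty_iff mem_sphere_0)
  define m where "m = f v \<bullet> v"
  define q where "q y = m * (y \<bullet> y) - f y \<bullet> y" for y
  have q: "q y \<ge> 0" if "y \<in> V" for y
  proof (cases "y = 0")
    case True
    then show ?thesis by (simp add: q_def linear_0[OF lin])
  next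
    case False
    have "f ((1 / norm y) *\<^sub>R y) \<bullet> ((1 / norm y) *\<^sub>R y) \<le> m"
      unfolding m_def by (rule sup) (use False that V(1) in \<open>auto simp: subspace_scale\<close>)
    then have "f y \<bullet> y / (norm y)\<^sup>2 \<le> m"
      by (simp add: linear_scale[OF lin] power2_eq_square)
    then show ?thesis
      using False by (simp add: q_def field_simps power2_norm_eq_inner[symmetric])
  qed
  define u where "u = m *\<^sub>R v - f v"
  have uV: "u \<in> V"
    using v V by (auto simp: u_def intro!: subspace_diff subspace_scale)
  have vv: "v \<bullet> v = 1" using v by (simp add: power2_norm_eq_inner[symmetric])
  have expand: "q (v + t *\<^sub>R u) = 2 * t * (u \<bullet> u) + t * t * q u" for t
  proof -
    have "f u \<bullet> v = f v \<bullet> u" using adj[of u v] by (simp add: inner_commute)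
    then have "q (v + t *\<^sub>R u) = q v + 2 * t * ((m *\<^sub>R v - f v) \<bullet> u) + t * t * q u"
      by (simp add: q_def linear_add[OF lin] linear_scale[OF lin] algebra_simps inner_commute)
    moreover have "q v = 0" by (simp add: q_def m_def vv)
    ultimately show ?thesis by (simp add: u_def)
  qed
  have "u \<bullet> u = 0"
  proof (rule ccontr)
    assume nz: "u \<bullet> u \<noteq> 0"
    define c where "c = u \<bullet> u"
    have c: "c > 0" using nz by (simp add: c_def)
    \<comment> \<open>At \<open>t = - c / r\<close> the expansion equals
      \<open>- (c * c) * (r + 1) / (r * r)\<close>; adding \<open>1\<close> to \<open>q u\<close>
      keeps \<open>r\<close> positive when \<open>q u = 0\<close>.\<close>
    define r where "r = q u + 1"
    have r: "r > 0" "q u = r - 1" using q[OF uV] by (simp_all add: r_def)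
    have "0 \<le> q (v + (- c / r) *\<^sub>R u)"
      using uV v V(1) by (intro q subspace_add subspace_scale)
    also have "\<dots> = - (c * c) * (r + 1) / (r * r)"
      unfolding expand c_def[symmetric] r(2) using r(1) by (simp add: field_simps)
    also have "\<dots> < 0"
      using c r by (intro divide_neg_pos mult_neg_pos) auto
    finally show False by simp
  qed
  then have "f v = m *\<^sub>R v" by (simp add: u_def)
  then show ?thesis using v by blast
qed

text \<open>Induction on the dimension: by self-adjointness the orthogonal complement, within
  \<open>V\<close>, of an eigenvector is again invariant under \<open>f\<close>.\<close>

lemma self_adjoint_eigenvectors_span:
  fixes f :: "'a::euclidean_space \<Rightarrow> 'a"
  assumes lin: "linear f" and adj: "\<And>x y. f x \<bullet> y = x \<bullet> f y"
  shows "subspace V \<Longrightarrow> f ` V \<subseteq> V \<Longrightarrow>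
    \<exists>B\<subseteq>V. pairwise orthogonal B \<and> (\<forall>b\<in>B. norm b = 1 \<and> (\<exists>c. f b = c *\<^sub>R b)) \<and> span B = V"
proof (induction "dim V" arbitrary: V rule: less_induct)
  case less
  show ?case
  proof (cases "V = {0}")
    case True
    then show ?thesis by (intro exI[of _ "{}"]) auto
  next
    case False
    then obtain v c where v: "v \<in> V" "norm v = 1" "f v = c *\<^sub>R v"
      using self_adjoint_eigenvector[OF lin adj less.prems] by blast
    have vv: "v \<bullet> v = 1" using v by (simp add: power2_norm_eq_inner[symmetric])
    define W where "W = {x \<in> V. x \<bullet> v = 0}"
    have W: "subspace W"
      using less.prems(1) unfolding W_def subspace_def by (auto simp: inner_add_left)
    have "v \<notin> W" using vv by (simp add: W_def)
    moreover have "W \<subseteq> V" by (auto simp: W_def)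
    ultimately have "W \<subset> V" using v(1) by blast
    then have "dim W < dim V"
      using dim_psubset[of W V] W less.prems(1) by (metis span_eq_iff)
    moreover have "f ` W \<subseteq> W"
      using less.prems(2) adj[of _ v] v(3) by (auto simp: W_def)
    ultimately obtain B where B: "B \<subseteq> W" "pairwise orthogonal B"
      "\<forall>b\<in>B. norm b = 1 \<and> (\<exists>c. f b = c *\<^sub>R b)" "span B = W"
      using less.hyps[OF _ W] by blast
    have "span (insert v B) = V"
    proof
      show "span (insert v B) \<subseteq> V"
        using B(1) v(1) less.prems(1) by (intro span_minimal) (auto simp: W_def)
      show "V \<subseteq> span (insert v B)"
      proof
        fix x assume x: "x \<in> V"
        have "x - (x \<bullet> v) *\<^sub>R v \<in> W"
          using x v less.prems(1) by (auto simp: W_def inner_diff_left vv intro!: subspace_diff subspace_scale)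
        then have "x - (x \<bullet> v) *\<^sub>R v \<in> span (insert v B)"
          using B(4) span_mono[of B "insert v B"] by auto
        then show "x \<in> span (insert v B)"
          by (metis insertI1 span_add_eq2 span_base span_scale diff_add_cancel)
      qed
    qed
    moreover have "pairwise orthogonal (insert v B)"
      using B(1,2) by (auto simp: pairwise_insert orthogonal_def W_def inner_commute)
    ultimately show ?thesis
      using B v by (intro exI[of _ "insert v B"]) (auto simp: W_def)
  qed
qed

definition orthonormal :: "('n \<Rightarrow> 'a::real_inner) \<Rightarrow> bool" where
  "orthonormal a \<longleftrightarrow> (\<forall>i j. a i \<bullet> a j = (if i = j then 1 else 0))"

lemma orthonormal_inner: "orthonormal a \<Longrightarrow> a i \<bullet> a j = (if i = j then 1 else 0)"
  by (simp add: orthonormal_def)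

lemma orthonormal_norm: "orthonormal a \<Longrightarrow> norm (a i) = 1"
  by (simp add: orthonormal_def norm_eq_sqrt_inner)

lemma orthonormal_inj: "orthonormal a \<Longrightarrow> inj a"
  unfolding orthonormal_def inj_def by (metis zero_neq_one)

lemma orthonormal_independent:
  assumes "orthonormal a"
  shows "independent (a ` I)"
proof (rule pairwise_orthogonal_independent)
  show "pairwise orthogonal (a ` I)"
    using orthonormal_inner[OF assms] by (auto simp: pairwise_def orthogonal_def)
  show "0 \<notin> a ` I"
    using orthonormal_norm[OF assms] by (metis imageE norm_zero zero_neq_one)
qed

lemma orthonormal_expansion:
  fixes a :: "'n::finite \<Rightarrow> real^'n"
  assumes "orthonormal a"
  shows "x = (\<Sum>i\<in>UNIV. (x \<bullet> a i) *\<^sub>R a i)"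
proof -
  define y where "y = x - (\<Sum>i\<in>UNIV. (x \<bullet> a i) *\<^sub>R a i)"
  have "card (range a) = CARD('n)"
    using orthonormal_inj[OF assms] by (simp add: card_image)
  then have "span (range a) = UNIV"
    using card_ge_dim_independent[OF _ orthonormal_independent[OF assms], of UNIV UNIV] by auto
  moreover have "y \<bullet> a j = 0" for j
    by (simp add: y_def inner_diff_left inner_sum_left orthonormal_inner[OF assms] if_distrib
        cong: if_cong)
  then have "orthogonal y z" if "z \<in> span (range a)" for z
    using orthogonal_to_span[OF that] by (auto simp: orthogonal_def)
  ultimately have "orthogonal y y" by simp
  then have "y = 0" by (simp add: orthogonal_self)
  then show ?thesis unfolding y_def by simp
qed

lemma orthonormal_parseval:
  fixes a :: "'n::finite \<Rightarrow> real^'n"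
  assumes "orthonormal a"
  shows "x \<bullet> y = (\<Sum>i\<in>UNIV. (x \<bullet> a i) * (y \<bullet> a i))"
  by (subst orthonormal_expansion[OF assms, of x]) (simp add: inner_sum_left inner_commute[of "a _" y])

lemma orthonormal_axis: "orthonormal (\<lambda>i. axis i 1 :: real^'n)"
  by (simp add: orthonormal_def inner_axis_axis)

lemma inner_matrix_vector_transpose:
  fixes A :: "real^'n^'m"
  shows "(A *v x) \<bullet> y = x \<bullet> (transpose A *v y)"
  by (metis dot_lmul_matrix inner_commute transpose_matrix_vector)

lemma symmetric_matrix_eigenbasis:
  fixes M :: "real^'n^'n"
  assumes "transpose M = M"
  shows "\<exists>a \<mu>. orthonormal a \<and> (\<forall>i::'n. M *v a i = \<mu> i *\<^sub>R a i)"
proof -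
  obtain B where B: "pairwise orthogonal B"
    "\<And>b. b \<in> B \<Longrightarrow> norm b = 1 \<and> (\<exists>c. M *v b = c *\<^sub>R b)" "span B = UNIV"
    using self_adjoint_eigenvectors_span[of "(*v) M" UNIV] inner_matrix_vector_transpose[of M] assms
    by auto
  have "independent B"
    using B(1) B(2)[of 0] by (intro pairwise_orthogonal_independent) auto
  then have "finite B" "card B = CARD('n)"
    using B(3) dim_eq_card_independent[of B] dim_span[of B] by (auto simp: independent_bound)
  then obtain a where a: "bij_betw a (UNIV::'n set) B"
    using finite_same_card_bij[of "UNIV::'n set" B] by auto
  have mem: "a i \<in> B" for i using a by (auto simp: bij_betw_def)
  have "a i \<bullet> a j = (if i = j then 1 else 0)" for i j
  proof (cases "i = j")
    case True
    then show ?thesis using B(2)[OF mem[of i]] by (simp add: power2_norm_eq_inner[symmetric])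
  next
    case False
    then have "a i \<noteq> a j" using a by (auto simp: bij_betw_def inj_def)
    then show ?thesis using False B(1) mem by (auto simp: pairwise_def orthogonal_def)
  qed
  moreover have "\<exists>\<mu>. \<forall>i. M *v a i = \<mu> i *\<^sub>R a i"
    using B(2)[OF mem] by metis
  ultimately show ?thesis unfolding orthonormal_def by blast
qed

text \<open>A singular value decomposition in which the left singular vectors belonging to the
  singular value \<open>0\<close> are replaced by the zero vector, so that both families have the
  same index type.\<close>

definition singular_frame :: "real^'n^'m \<Rightarrow> ('n \<Rightarrow> real^'n) \<Rightarrow> ('n \<Rightarrow> real) \<Rightarrow> ('n \<Rightarrow> real^'m) \<Rightarrow> bool" where
  "singular_frame A a \<kappa> b \<longleftrightarrow> orthonormal a \<and> (\<forall>i. 0 \<le> \<kappa> i) \<and> (\<forall>i. A *v a i = \<kappa> i *\<^sub>R b i) \<and>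
     (\<forall>i j. b i \<bullet> b j = (if i = j \<and> 0 < \<kappa> i then 1 else 0))"

text \<open>An orthonormal eigenbasis of the Gram matrix is mapped by \<open>A\<close> to an
  orthogonal family whose squared lengths are the eigenvalues; it remains to normalise the nonzero
  images.\<close>

lemma singular_frame_exists:
  fixes A :: "real^'n^'m"
  shows "\<exists>a \<kappa> b. singular_frame A a \<kappa> b"
proof -
  have "transpose (transpose A ** A) = transpose A ** A"
    by (simp add: matrix_transpose_mul)
  then obtain a \<mu> where a: "orthonormal a" and ev: "\<And>i::'n. (transpose A ** A) *v a i = \<mu> i *\<^sub>R a i"
    using symmetric_matrix_eigenbasis by metis
  have AA: "(A *v a i) \<bullet> (A *v a j) = (if i = j then \<mu> i else 0)" for i j
  proof -
    have "(A *v a i) \<bullet> (A *v a j) = a i \<bullet> ((transpose A ** A) *v a j)"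
      by (simp add: inner_matrix_vector_transpose matrix_vector_mul_assoc)
    then show ?thesis using orthonormal_inner[OF a] by (simp add: ev)
  qed
  have \<mu>: "\<mu> i \<ge> 0" for i using AA[of i i] inner_ge_zero[of "A *v a i"] by simp
  define \<kappa> where "\<kappa> i = sqrt (\<mu> i)" for i
  \<comment> \<open>As \<open>1 / 0 = 0\<close>, this is the zero vector when
    \<open>\<kappa> i = 0\<close>, as the frame requires.\<close>
  define b where "b i = (1 / \<kappa> i) *\<^sub>R (A *v a i)" for i
  have "A *v a i = \<kappa> i *\<^sub>R b i" for i
    using AA[of i i] by (cases "\<mu> i = 0") (auto simp: b_def \<kappa>_def)
  moreover have "b i \<bullet> b j = (if i = j \<and> 0 < \<kappa> i then 1 else 0)" for i j
    using AA[of i j] \<mu>[of i] by (auto simp: b_def \<kappa>_def field_simps)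
  ultimately show ?thesis using a \<mu> unfolding singular_frame_def by (metis \<kappa>_def real_sqrt_ge_zero)
qed

lemma singular_frame_gram:
  assumes "singular_frame A a \<kappa> b"
  shows "(transpose A ** A) *v v = (\<Sum>i\<in>UNIV. ((\<kappa> i)\<^sup>2 * (v \<bullet> a i)) *\<^sub>R a i)"
proof -
  note f = assms[unfolded singular_frame_def]
  have "((transpose A ** A) *v v) \<bullet> a i = (\<kappa> i)\<^sup>2 * (v \<bullet> a i)" for i
  proof -
    have "((transpose A ** A) *v v) \<bullet> a i = (A *v v) \<bullet> (A *v a i)"
      by (metis inner_commute inner_matrix_vector_transpose matrix_vector_mul_assoc)
    also have "A *v v = (\<Sum>j\<in>UNIV. ((v \<bullet> a j) * \<kappa> j) *\<^sub>R b j)"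
      by (subst orthonormal_expansion[of a v]) (use f in
        \<open>simp_all add: linear_sum[OF matrix_vector_mul_linear] matrix_vector_mult_scaleR\<close>)
    also have "\<dots> \<bullet> (A *v a i) = (\<Sum>j\<in>UNIV. (v \<bullet> a j) * \<kappa> j * \<kappa> i * (b j \<bullet> b i))"
      using f by (simp add: inner_sum_left sum_distrib_left mult_ac)
    also have "\<dots> = (v \<bullet> a i) * \<kappa> i * \<kappa> i * (b i \<bullet> b i)"
      using f by (subst sum.remove[of _ i]) (auto intro!: sum.neutral)
    also have "\<dots> = (\<kappa> i)\<^sup>2 * (v \<bullet> a i)"
      using f by (auto simp: power2_eq_square order_le_less)
    finally show ?thesis .
  qed
  then show ?thesis
    using orthonormal_expansion[of a "(transpose A ** A) *v v"] f by simp
qed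

text \<open>Translates the multiplicities in \<open>nonzero_singular_values\<close> into index
  counts. Since \<open>\<kappa>\<close> is nonnegative and \<open>\<sigma>\<close> positive, equal
  squares mean equal values, so the vectors \<open>a i\<close> with
  \<open>\<kappa> i = \<sigma>\<close> span the eigenspace.\<close>

lemma dim_gram_eigenspace:
  fixes A :: "real^'n^'m"
  assumes fr: "singular_frame A a \<kappa> b" and "\<sigma> > 0"
  shows "dim (gram_eigenspace A (\<sigma>\<^sup>2)) = card {i. \<kappa> i = \<sigma>}"
proof -
  note f = fr[unfolded singular_frame_def]
  have ort: "orthonormal a" using f by blast
  have "gram_eigenspace A (\<sigma>\<^sup>2) = span (a ` {i. \<kappa> i = \<sigma>})"
  proof
    show "gram_eigenspace A (\<sigma>\<^sup>2) \<subseteq> span (a ` {i. \<kappa> i = \<sigma>})"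
    proof
      fix v assume "v \<in> gram_eigenspace A (\<sigma>\<^sup>2)"
      then have "(\<Sum>i\<in>UNIV. ((\<kappa> i)\<^sup>2 * (v \<bullet> a i)) *\<^sub>R a i) = \<sigma>\<^sup>2 *\<^sub>R v"
        using singular_frame_gram[OF fr] by (simp add: gram_eigenspace_def)
      from arg_cong[OF this, of "\<lambda>x. x \<bullet> a j" for j]
      have "(\<kappa> j)\<^sup>2 * (v \<bullet> a j) = \<sigma>\<^sup>2 * (v \<bullet> a j)" for j
        by (simp add: inner_sum_left orthonormal_inner[OF ort] if_distrib cong: if_cong)
      then have z: "v \<bullet> a j = 0" if "\<kappa> j \<noteq> \<sigma>" for j
        using that f \<open>\<sigma> > 0\<close> by (metis less_eq_real_def mult_cancel_right power2_eq_imp_eq)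
      have "v = (\<Sum>i\<in>UNIV. (v \<bullet> a i) *\<^sub>R a i)" by (rule orthonormal_expansion[OF ort])
      also have "\<dots> \<in> span (a ` {i. \<kappa> i = \<sigma>})"
      proof (rule span_sum)
        fix i show "(v \<bullet> a i) *\<^sub>R a i \<in> span (a ` {i. \<kappa> i = \<sigma>})"
          using z[of i] by (cases "\<kappa> i = \<sigma>") (auto intro: span_scale span_base simp: span_zero)
      qed
      finally show "v \<in> span (a ` {i. \<kappa> i = \<sigma>})" .
    qed
    have "subspace (gram_eigenspace A (\<sigma>\<^sup>2))"
      unfolding subspace_def gram_eigenspace_def
      by (auto simp: matrix_vector_right_distrib matrix_vector_mult_scaleR scaleR_right_distrib)
    moreover have "a i \<in> gram_eigenspace A (\<sigma>\<^sup>2)" if "\<kappa> i = \<sigma>" for i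
      using that by (simp add: gram_eigenspace_def singular_frame_gram[OF fr]
          orthonormal_inner[OF ort] if_distrib[of "\<lambda>x. _ * x"] if_distrib[of "\<lambda>x. x *\<^sub>R _"] cong: if_cong)
    ultimately show "span (a ` {i. \<kappa> i = \<sigma>}) \<subseteq> gram_eigenspace A (\<sigma>\<^sup>2)"
      by (intro span_minimal) auto
  qed
  then show ?thesis
    using orthonormal_independent[OF ort] orthonormal_inj[OF ort]
    by (simp add: dim_eq_card_independent card_image inj_on_subset)
qed

lemma sum_mset_replicate:
  fixes h :: "'a \<Rightarrow> real"
  assumes "finite T"
  shows "(\<Sum>\<sigma>\<in>#(\<Sum>s\<in>T. replicate_mset (k s) s). h \<sigma>) = (\<Sum>s\<in>T. real (k s) * h s)"
  using assms by (induction T rule: finite_induct) auto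

text \<open>Grouping the indices by the value of \<open>\<kappa>\<close> produces exactly the
  multiplicities of the multiset.\<close>

lemma sum_nonzero_singular_values:
  fixes A :: "real^'n^'m" and h :: "real \<Rightarrow> real"
  assumes fr: "singular_frame A a \<kappa> b"
  shows "(\<Sum>\<sigma>\<in>#nonzero_singular_values A. h \<sigma>) = (\<Sum>i | 0 < \<kappa> i. h (\<kappa> i))"
proof -
  define T where "T = {\<sigma>. \<sigma> > 0 \<and> gram_eigenspace A (\<sigma>\<^sup>2) \<noteq> {0}}"
  have fin: "finite T" unfolding T_def by (rule finite_nonzero_singular_values)
  have T: "T = \<kappa> ` {i. 0 < \<kappa> i}"
  proof -
    have "gram_eigenspace A (\<sigma>\<^sup>2) \<noteq> {0} \<longleftrightarrow> {i. \<kappa> i = \<sigma>} \<noteq> {}" if "\<sigma> > 0" for \<sigma>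
    proof -
      have "0 \<in> gram_eigenspace A (\<sigma>\<^sup>2)" by (simp add: gram_eigenspace_def)
      then have "gram_eigenspace A (\<sigma>\<^sup>2) \<noteq> {0} \<longleftrightarrow> dim (gram_eigenspace A (\<sigma>\<^sup>2)) \<noteq> 0"
        by auto
      then show ?thesis by (simp add: dim_gram_eigenspace[OF fr that])
    qed
    then show ?thesis by (auto simp: T_def)
  qed
  have "(\<Sum>\<sigma>\<in>#nonzero_singular_values A. h \<sigma>) =
      (\<Sum>\<sigma>\<in>T. real (dim (gram_eigenspace A (\<sigma>\<^sup>2))) * h \<sigma>)"
    unfolding nonzero_singular_values_def T_def[symmetric] by (rule sum_mset_replicate[OF fin])
  also have "\<dots> = (\<Sum>\<sigma>\<in>T. \<Sum>i | i \<in> {i. 0 < \<kappa> i} \<and> \<kappa> i = \<sigma>. h (\<kappa> i))"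
    by (rule sum.cong) (auto simp: T_def dim_gram_eigenspace[OF fr] intro!: arg_cong[where f = card])
  also have "\<dots> = (\<Sum>i | 0 < \<kappa> i. h (\<kappa> i))"
    unfolding T by (rule sum.image_gen[symmetric]) simp
  finally show ?thesis .
qed

lemma singular_sum_frame:
  assumes fr: "singular_frame (jacobian F (at x)) a \<kappa> b"
  shows "singular_sum F x = (\<Sum>i\<in>UNIV. (\<kappa> i)\<^sup>2 / (1 + (\<kappa> i)\<^sup>2))"
proof -
  have "singular_sum F x = (\<Sum>i | 0 < \<kappa> i. (\<kappa> i)\<^sup>2 / (1 + (\<kappa> i)\<^sup>2))"
    unfolding singular_sum_def by (rule sum_nonzero_singular_values[OF fr])
  also have "\<dots> = (\<Sum>i\<in>UNIV. (\<kappa> i)\<^sup>2 / (1 + (\<kappa> i)\<^sup>2))"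
    using fr unfolding singular_frame_def
    by (intro sum.mono_neutral_left) (auto simp: order_le_less)
  finally show ?thesis .
qed

lemma range_singular_frame:
  fixes A :: "real^'n^'m"
  assumes fr: "singular_frame A a \<kappa> b"
  shows "range ((*v) A) = span (b ` {i. 0 < \<kappa> i})"
proof
  note f = fr[unfolded singular_frame_def]
  show "range ((*v) A) \<subseteq> span (b ` {i. 0 < \<kappa> i})"
  proof
    fix y assume "y \<in> range ((*v) A)"
    then obtain v where y: "y = A *v v" by blast
    have "A *v v = (\<Sum>j\<in>UNIV. (v \<bullet> a j) *\<^sub>R \<kappa> j *\<^sub>R b j)"
      by (subst orthonormal_expansion[of a v]) (use f in
        \<open>simp_all add: linear_sum[OF matrix_vector_mul_linear] matrix_vector_mult_scaleR\<close>)
    also have "\<dots> \<in> span (b ` {i. 0 < \<kappa> i})"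
    proof (rule span_sum)
      fix i show "(v \<bullet> a i) *\<^sub>R \<kappa> i *\<^sub>R b i \<in> span (b ` {i. 0 < \<kappa> i})"
      proof (cases "\<kappa> i = 0")
        case False
        then have "0 < \<kappa> i" using f by (metis order_le_less)
        then have "b i \<in> span (b ` {i. 0 < \<kappa> i})" by (intro span_base) auto
        then show ?thesis by (intro span_scale)
      qed (simp add: span_zero)
    qed
    finally show "y \<in> span (b ` {i. 0 < \<kappa> i})" using y by simp
  qed
  have "b i = A *v ((1 / \<kappa> i) *\<^sub>R a i)" if "0 < \<kappa> i" for i
    using f that by (simp add: matrix_vector_mult_scaleR)
  then have "b ` {i. 0 < \<kappa> i} \<subseteq> range ((*v) A)" by auto
  then show "span (b ` {i. 0 < \<kappa> i}) \<subseteq> range ((*v) A)"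
    by (intro span_minimal linear_subspace_image) auto
qed

lemma rank_singular_frame:
  fixes A :: "real^'n^'m"
  assumes fr: "singular_frame A a \<kappa> b"
  shows "rank A = card {i. 0 < \<kappa> i}"
proof -
  note f = fr[unfolded singular_frame_def]
  have "pairwise orthogonal (b ` {i. 0 < \<kappa> i})" "0 \<notin> b ` {i. 0 < \<kappa> i}"
    using f by (auto simp: pairwise_def orthogonal_def) (metis inner_zero_left zero_neq_one)
  then have "independent (b ` {i. 0 < \<kappa> i})" by (rule pairwise_orthogonal_independent)
  moreover have "inj_on b {i. 0 < \<kappa> i}"
    using f by (metis (mono_tags, lifting) inj_onI mem_Collect_eq zero_neq_one)
  ultimately show ?thesis
    by (simp add: rank_dim_range range_singular_frame[OF fr] dim_eq_card_independent card_image)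
qed

section \<open>The induced metric and the minimal graph equation\<close>

lemma matrix_inv_left_right:
  fixes A :: "real^'n^'n"
  assumes "invertible A"
  shows "A ** matrix_inv A = mat 1" "matrix_inv A ** A = mat 1"
  using someI_ex[OF assms[unfolded invertible_def]] unfolding matrix_inv_def by auto

lemma matrix_inv_eqI:
  fixes A B :: "real^'n^'n"
  assumes "A ** B = mat 1"
  shows "matrix_inv A = B"
proof -
  have "invertible A"
    using assms matrix_left_right_inverse unfolding invertible_def by blast
  then have "matrix_inv A = matrix_inv A ** (A ** B)" by (simp add: assms)
  also have "\<dots> = B"
    using matrix_inv_left_right(2)[OF \<open>invertible A\<close>] by (simp add: matrix_mul_assoc)
  finally show ?thesis .
qed

text \<open>Exhibits the entries of the inverse as quotients of polynomials in the entries of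
  \<open>A\<close>, which is how their differentiability is obtained.\<close>

lemma matrix_inv_nth_cramer:
  fixes A :: "real^'n^'n"
  assumes "invertible A"
  shows "matrix_inv A $ i $ j = det (\<chi> r s. if s = i then axis j 1 $ r else A $ r $ s) / det A"
proof -
  have "det A \<noteq> 0" using assms invertible_det_nz by blast
  moreover have "A *v (matrix_inv A *v axis j 1) = axis j 1"
    by (simp add: matrix_vector_mul_assoc matrix_inv_left_right[OF assms])
  ultimately have "matrix_inv A *v axis j 1 =
      (\<chi> k. det (\<chi> r s. if s = k then axis j 1 $ r else A $ r $ s) / det A)"
    using cramer by blast
  then have "(matrix_inv A *v axis j 1) $ i = det (\<chi> r s. if s = i then axis j 1 $ r else A $ r $ s) / det A"
    by simp
  then show ?thesis by (simp add: matrix_vector_mul_component inner_axis)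
qed

lemma differentiable_finite_prod:
  fixes f :: "'i \<Rightarrow> 'a::real_normed_vector \<Rightarrow> real"
  assumes "finite I" "\<And>i. i \<in> I \<Longrightarrow> f i differentiable (at x)"
  shows "(\<lambda>x. \<Prod>i\<in>I. f i x) differentiable (at x)"
  using assms by (induction I rule: finite_induct) auto

lemma differentiable_det:
  fixes M :: "'a::real_normed_vector \<Rightarrow> real^'n^'n"
  assumes "\<And>i j. (\<lambda>x. M x $ i $ j) differentiable (at x)"
  shows "(\<lambda>x. det (M x)) differentiable (at x)"
  unfolding det_def
  by (intro differentiable_sum ballI differentiable_mult differentiable_const differentiable_finite_prod assms)
    (auto simp: finite_permutations)

text \<open>Cramer's rule gives existence of the derivative; its value, minus inverse times
  \<open>M'\<close> times inverse, comes from differentiating the product of the inverse with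
  \<open>M\<close>, which is constantly the identity.\<close>

lemma has_derivative_matrix_inv_nth:
  fixes M :: "'a::real_normed_vector \<Rightarrow> real^'n^'n"
  assumes inv: "\<And>y. invertible (M y)"
    and M': "\<And>i j. ((\<lambda>y. M y $ i $ j) has_derivative M' i j) (at x)"
  shows "((\<lambda>y. matrix_inv (M y) $ i $ j) has_derivative
    (\<lambda>h. - (\<Sum>k\<in>UNIV. \<Sum>l\<in>UNIV. matrix_inv (M x) $ i $ k * M' k l h * matrix_inv (M x) $ l $ j))) (at x)"
proof -
  have dif: "(\<lambda>y. M y $ i $ j) differentiable (at x)" for i j
    using M' unfolding differentiable_def by blast
  have "(\<lambda>y. matrix_inv (M y) $ i $ j) differentiable (at x)" for i j
    unfolding matrix_inv_nth_cramer[OF inv] using inv invertible_det_nz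
  proof (intro differentiable_divide differentiable_det dif)
    fix r s
    show "(\<lambda>y. (\<chi> r s. if s = i then axis j 1 $ r else M y $ r $ s) $ r $ s) differentiable (at x)"
      by (cases "s = i") (simp_all add: dif)
  qed auto
  then obtain X' where X': "\<And>i j. ((\<lambda>y. matrix_inv (M y) $ i $ j) has_derivative X' i j) (at x)"
    unfolding differentiable_def by metis
  have "X' i j h = - (\<Sum>k\<in>UNIV. \<Sum>l\<in>UNIV. matrix_inv (M x) $ i $ k * M' k l h * matrix_inv (M x) $ l $ j)" for h
  proof -
    define X where "X = matrix_inv (M x)"
    define A B where "A = (\<chi> i j. X' i j h)" and "B = (\<chi> i j. M' i j h)"
    have "A ** M x + X ** B = 0"
    proof -
      have "(A ** M x + X ** B) $ i $ j = 0" for i j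
      proof -
        have "((\<lambda>y. (matrix_inv (M y) ** M y) $ i $ j) has_derivative
            (\<lambda>h. \<Sum>k\<in>UNIV. X $ i $ k * M' k j h + X' i k h * M x $ k $ j)) (at x)"
          unfolding matrix_matrix_mult_def vec_lambda_beta X_def
          by (intro has_derivative_sum has_derivative_mult X' M')
        moreover have "((\<lambda>y. (matrix_inv (M y) ** M y) $ i $ j) has_derivative (\<lambda>h. 0)) (at x)"
          by (simp add: matrix_inv_left_right[OF inv])
        ultimately have "(\<Sum>k\<in>UNIV. X $ i $ k * M' k j h + X' i k h * M x $ k $ j) = 0"
          by (rule fun_cong[OF has_derivative_unique])
        then show ?thesis
          by (simp add: matrix_matrix_mult_def A_def B_def sum.distrib)
      qed
      then show ?thesis by (simp add: vec_eq_iff)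
    qed
    then have AM: "A ** M x = - (X ** B)"
      by (metis eq_neg_iff_add_eq_0)
    have "A = A ** M x ** X"
      by (simp add: X_def matrix_mul_assoc[symmetric] matrix_inv_left_right[OF inv])
    then have "A = - (X ** B ** X)"
      unfolding AM by (simp add: vec_eq_iff matrix_matrix_mult_def sum_negf)
    then have "A $ i $ j = - ((X ** B ** X) $ i $ j)" by simp
    also have "(X ** B ** X) $ i $ j = (\<Sum>k\<in>UNIV. \<Sum>l\<in>UNIV. X $ i $ k * M' k l h * X $ l $ j)"
      unfolding matrix_matrix_mult_def vec_lambda_beta sum_distrib_right B_def
      by (subst sum.swap) (rule refl)
    finally show ?thesis by (simp add: A_def X_def)
  qed
  then have "X' i j =
      (\<lambda>h. - (\<Sum>k\<in>UNIV. \<Sum>l\<in>UNIV. matrix_inv (M x) $ i $ k * M' k l h * matrix_inv (M x) $ l $ j))"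
    by (rule ext)
  with X'[of i j] show ?thesis by (simp only:)
qed

section \<open>The metric of the graph in a constant orthonormal basis\<close>

definition frame_metric :: "(real^'n \<Rightarrow> real^'m) \<Rightarrow> ('n \<Rightarrow> real^'n) \<Rightarrow> real^'n \<Rightarrow> real^'n^'n" where
  "frame_metric F a x = (\<chi> i j. (if i = j then 1 else 0) + dderiv (a i) F x \<bullet> dderiv (a j) F x)"

text \<open>The quadratic form is \<open>v \<bullet> v\<close> plus the squared length of a
  combination of the vectors \<open>dderiv (a i) F x\<close>, hence positive definite. This is true
  at every point of the space, as \<open>has_derivative_matrix_inv_nth\<close> demands.\<close>

lemma frame_metric_invertible: "invertible (frame_metric F a x)"
proof -
  have "v = 0" if "frame_metric F a x *v v = 0" for v
  proof -
    have "v \<bullet> (frame_metric F a x *v v) =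
        (\<Sum>i\<in>UNIV. \<Sum>j\<in>UNIV. v $ i * ((if i = j then 1 else 0) * v $ j)) +
        (\<Sum>i\<in>UNIV. \<Sum>j\<in>UNIV. (v $ i *\<^sub>R dderiv (a i) F x) \<bullet> (v $ j *\<^sub>R dderiv (a j) F x))"
      by (simp add: inner_vec_def matrix_vector_mult_def frame_metric_def sum_distrib_left
          sum.distrib[symmetric] algebra_simps)
    also have "\<dots> = v \<bullet> v + (\<Sum>i\<in>UNIV. v $ i *\<^sub>R dderiv (a i) F x) \<bullet> (\<Sum>i\<in>UNIV. v $ i *\<^sub>R dderiv (a i) F x)"
    proof -
      have "(\<Sum>i\<in>UNIV. \<Sum>j\<in>UNIV. v $ i * ((if i = j then 1 else 0) * v $ j)) = v \<bullet> v"
        by (simp add: inner_vec_def if_distrib[of "\<lambda>x. x * _"] if_distrib[of "\<lambda>x. _ * x"] cong: if_cong)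
      moreover have "(\<Sum>i\<in>UNIV. \<Sum>j\<in>UNIV. (v $ i *\<^sub>R dderiv (a i) F x) \<bullet> (v $ j *\<^sub>R dderiv (a j) F x)) =
          (\<Sum>i\<in>UNIV. v $ i *\<^sub>R dderiv (a i) F x) \<bullet> (\<Sum>i\<in>UNIV. v $ i *\<^sub>R dderiv (a i) F x)"
        by (subst inner_sum_left, subst inner_sum_right) (rule refl)
      ultimately show ?thesis by simp
    qed
    finally have "v \<bullet> (frame_metric F a x *v v) \<ge> v \<bullet> v"
      using inner_ge_zero[of "\<Sum>i\<in>UNIV. v $ i *\<^sub>R dderiv (a i) F x"] by linarith
    then show ?thesis using that inner_ge_zero[of v] by simp
  qed
  then show ?thesis
    unfolding invertible_left_inverse matrix_left_invertible_ker by blast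
qed

definition frame_inverse :: "(real^'n \<Rightarrow> real^'m) \<Rightarrow> ('n \<Rightarrow> real^'n) \<Rightarrow> real^'n \<Rightarrow> real^'n^'n" where
  "frame_inverse F a x = matrix_inv (frame_metric F a x)"

text \<open>The matrix of inner products of \<open>a\<close> with \<open>c\<close> is orthogonal and
  conjugates one metric into the other, so it also conjugates the inverses.\<close>

lemma frame_inverse_change:
  fixes F :: "real^'n \<Rightarrow> real^'m"
  assumes dF: "F differentiable (at x)" and a: "orthonormal a" and c: "orthonormal c"
  shows "frame_inverse F a x = (\<chi> i k. a i \<bullet> c k) ** frame_inverse F c x ** transpose (\<chi> i k. a i \<bullet> c k)"
    (is "_ = ?U ** _ ** _")
proof -
  have U: "?U ** transpose ?U = mat 1"
    by (simp add: vec_eq_iff matrix_matrix_mult_def transpose_def mat_def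
        orthonormal_parseval[OF c, symmetric] orthonormal_inner[OF a])
  then have U': "transpose ?U ** ?U = mat 1"
    using matrix_left_right_inverse by blast
  have "dderiv (a i) F x = (\<Sum>k\<in>UNIV. (a i \<bullet> c k) *\<^sub>R dderiv (c k) F x)" for i
    by (subst orthonormal_expansion[OF c, of "a i"])
      (simp add: linear_sum[OF linear_dderiv[OF dF]] linear_scale[OF linear_dderiv[OF dF]])
  then have P: "frame_metric F a x = ?U ** frame_metric F c x ** transpose ?U"
  proof -
    assume D: "\<And>i. dderiv (a i) F x = (\<Sum>k\<in>UNIV. (a i \<bullet> c k) *\<^sub>R dderiv (c k) F x)"
    have "frame_metric F a x $ i $ j = (?U ** frame_metric F c x ** transpose ?U) $ i $ j" for i j
    proof -
      have "(?U ** frame_metric F c x ** transpose ?U) $ i $ j =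
        (\<Sum>l\<in>UNIV. \<Sum>k\<in>UNIV. (a i \<bullet> c k) * (if k = l then 1 else 0) * (a j \<bullet> c l)) +
        (\<Sum>l\<in>UNIV. \<Sum>k\<in>UNIV. (a i \<bullet> c k) * (dderiv (c k) F x \<bullet> dderiv (c l) F x) * (a j \<bullet> c l))"
        by (simp add: matrix_matrix_mult_def transpose_def frame_metric_def sum_distrib_left sum_distrib_right
            sum.distrib[symmetric] algebra_simps)
      also have "(\<Sum>l\<in>UNIV. \<Sum>k\<in>UNIV. (a i \<bullet> c k) * (if k = l then 1 else 0) * (a j \<bullet> c l)) = a i \<bullet> a j"
        by (simp add: orthonormal_parseval[OF c, of "a i" "a j"] if_distrib[of "\<lambda>x. x * _"] 
          if_distrib[of "\<lambda>x. _ * x"] cong: if_cong)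
      also have "(\<Sum>l\<in>UNIV. \<Sum>k\<in>UNIV. (a i \<bullet> c k) * (dderiv (c k) F x \<bullet> dderiv (c l) F x) * (a j \<bullet> c l)) =
          dderiv (a i) F x \<bullet> dderiv (a j) F x"
        unfolding D[of i] D[of j]
        by (simp add: inner_sum_left inner_sum_right sum_distrib_left mult_ac) 
      finally show ?thesis
        by (simp add: frame_metric_def orthonormal_inner[OF a])
    qed
    then show ?thesis by (simp add: vec_eq_iff)
  qed
  have "frame_metric F a x ** (?U ** frame_inverse F c x ** transpose ?U) =
      ?U ** (frame_metric F c x ** (transpose ?U ** ?U) ** frame_inverse F c x) ** transpose ?U"
    unfolding P by (simp add: matrix_mul_assoc)
  also have "\<dots> = mat 1"
    by (simp add: U' U frame_inverse_def matrix_inv_left_right[OF frame_metric_invertible])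
  finally show ?thesis
    unfolding frame_inverse_def by (rule matrix_inv_eqI)
qed

lemma trace_frame_inverse:
  fixes F :: "real^'n \<Rightarrow> real^'m"
  assumes "F differentiable (at x)" and a: "orthonormal a" and c: "orthonormal c"
  shows "trace (frame_inverse F a x) = trace (frame_inverse F c x)"
proof -
  have "transpose (\<chi> i k. a i \<bullet> c k) ** (\<chi> i k. a i \<bullet> c k) = mat 1"
    by (simp add: vec_eq_iff matrix_matrix_mult_def transpose_def mat_def inner_commute[of "a _"]
        orthonormal_parseval[OF a, symmetric] orthonormal_inner[OF c])
  then show ?thesis
    unfolding frame_inverse_change[OF assms]
    by (subst trace_mul_sym) (simp add: matrix_mul_assoc)
qed

lemma frame_inverse_singular_frame:
  fixes F :: "real^'n \<Rightarrow> real^'m"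
  assumes dF: "F differentiable (at x)" and fr: "singular_frame (jacobian F (at x)) a \<kappa> b"
  shows "dderiv (a i) F x = \<kappa> i *\<^sub>R b i"
    and "frame_inverse F a x $ i $ j = (if i = j then 1 / (1 + (\<kappa> i)\<^sup>2) else 0)"
proof -
  note f = fr[unfolded singular_frame_def]
  have D: "dderiv (a i) F x = \<kappa> i *\<^sub>R b i" for i
    using f jacobian_works[THEN iffD1, OF dF] by (metis dderiv_unique)
  show "dderiv (a i) F x = \<kappa> i *\<^sub>R b i" by (rule D)
  have "frame_metric F a x $ i $ j = (if i = j then 1 + (\<kappa> i)\<^sup>2 else 0)" for i j
    using f by (auto simp: frame_metric_def D power2_eq_square order_le_less)
  then have "frame_metric F a x ** (\<chi> i j. if i = j then 1 / (1 + (\<kappa> i)\<^sup>2) else 0) = mat 1"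
    by (simp add: vec_eq_iff matrix_matrix_mult_def mat_def if_distrib[of "\<lambda>x. x * _"] 
          if_distrib[of "\<lambda>x. _ * x"] add_nonneg_eq_0_iff cong: if_cong)
  then show "frame_inverse F a x $ i $ j = (if i = j then 1 / (1 + (\<kappa> i)\<^sup>2) else 0)"
    unfolding frame_inverse_def by (simp add: matrix_inv_eqI)
qed

text \<open>Each summand is \<open>1 - 1 / (1 + (\<kappa> i)\<^sup>2)\<close>. The trace formula
  makes the singular sum differentiable, although its individual summands need not be.\<close>

lemma singular_sum_trace:
  fixes F :: "real^'n \<Rightarrow> real^'m"
  assumes dF: "F differentiable (at x)" and a: "orthonormal a"
  shows "singular_sum F x = real CARD('n) - trace (frame_inverse F a x)"
proof -
  obtain c \<kappa> b where fr: "singular_frame (jacobian F (at x)) c \<kappa> b"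
    using singular_frame_exists by blast
  then have c: "orthonormal c" by (simp add: singular_frame_def)
  have "(\<kappa> i)\<^sup>2 / (1 + (\<kappa> i)\<^sup>2) = 1 - 1 / (1 + (\<kappa> i)\<^sup>2)" for i
    by (simp add: field_simps add_nonneg_eq_0_iff)
  then have "singular_sum F x = real CARD('n) - (\<Sum>i\<in>UNIV. 1 / (1 + (\<kappa> i)\<^sup>2))"
    unfolding singular_sum_frame[OF fr] by (simp add: sum_subtractf)
  also have "(\<Sum>i\<in>UNIV. 1 / (1 + (\<kappa> i)\<^sup>2)) = trace (frame_inverse F c x)"
    by (simp add: trace_def frame_inverse_singular_frame[OF dF fr])
  finally show ?thesis using trace_frame_inverse[OF dF a c] by simp
qed

text \<open>The second derivatives of the graph map are \<open>(0, F\<^sub>i\<^sub>j)\<close>. If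
  the traced normal parts vanish, the traced vector is tangent, that is, of the form
  \<open>(v, dderiv v F x)\<close>; its first component is \<open>0\<close>, so \<open>v = 0\<close>
  and the second one vanishes as well.\<close>

lemma minimal_graph_equation_axis:
  fixes F :: "real^'n \<Rightarrow> real^'m"
  assumes D: "open D" "x \<in> D" and sm: "smooth_on D F" and min: "minimal_graph_on D F"
  shows "(\<Sum>i\<in>UNIV. \<Sum>j\<in>UNIV. frame_inverse F (\<lambda>i. axis i 1) x $ i $ j *\<^sub>R
    dderiv (axis i 1) (dderiv (axis j 1) F) x) = 0"
proof -
  define G where "G y = (y, F y)" for y
  define T where "T = tangent_space G x"
  note dif = smooth_on_differentiable[OF sm] smooth_on_differentiable[OF smooth_on_dderiv[OF sm]]
  have dG: "(G has_derivative (\<lambda>h. (h, dderiv h F y))) (at y)" if "y \<in> D" for y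
    unfolding G_def by (intro derivative_intros has_derivative_dderiv dif that)
  have G1: "dderiv v G y = (v, dderiv v F y)" if "y \<in> D" for v y
    by (rule dderiv_unique[OF dG[OF that]])
  have G2: "dderiv u (dderiv v G) x = (0, dderiv u (dderiv v F) x)" for u v
  proof -
    have "((\<lambda>y. (v, dderiv v F y)) has_derivative (\<lambda>h. (0, dderiv h (dderiv v F) x))) (at x)"
      by (intro derivative_intros has_derivative_dderiv dif D)
    then have "(dderiv v G has_derivative (\<lambda>h. (0, dderiv h (dderiv v F) x))) (at x)"
      by (rule has_derivative_transform_within_open[OF _ D]) (simp add: G1)
    then show ?thesis by (rule dderiv_unique)
  qed
  have T: "T = range (\<lambda>v. (v, dderiv v F x))"
    unfolding T_def tangent_space_def using G1[OF D(2)] unfolding dderiv_def by auto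
  have lin: "linear (\<lambda>v. (v, dderiv v F x))"
    using has_derivative_linear[OF dG[OF D(2)]] .
  have sT: "subspace T"
    unfolding T by (rule linear_subspace_image[OF lin subspace_UNIV])
  have NC: "w - normal_component T w \<in> T" for w
    using theI'[OF normal_component_ex1[OF sT, of w]] unfolding normal_component_def by blast
  have metric: "induced_metric G x = frame_metric F (\<lambda>i. axis i 1) x"
    by (simp add: induced_metric_def frame_metric_def partial_deriv_eq_dderiv G1[OF D(2)] inner_axis_axis vec_eq_iff)
  define X where "X = frame_inverse F (\<lambda>i. axis i 1) x"
  define w where "w i j = (0::real^'n, dderiv (axis i 1) (dderiv (axis j 1) F) x)" for i j
  have "mean_curvature_vector G x = 0"
    using min D unfolding minimal_graph_on_def G_def by blast
  then have "(\<Sum>i\<in>UNIV. \<Sum>j\<in>UNIV. X $ i $ j *\<^sub>R normal_component T (w i j)) = 0"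
    by (simp add: mean_curvature_vector_def second_fundamental_form_def metric X_def frame_inverse_def
        partial_deriv_eq_dderiv G2 w_def T_def)
  then have "(\<Sum>i\<in>UNIV. \<Sum>j\<in>UNIV. X $ i $ j *\<^sub>R w i j) =
      (\<Sum>i\<in>UNIV. \<Sum>j\<in>UNIV. X $ i $ j *\<^sub>R (w i j - normal_component T (w i j)))"
    by (simp add: algebra_simps sum_subtractf)
  also have "\<dots> \<in> T"
    by (intro subspace_sum subspace_scale NC sT)
  finally have "(0, \<Sum>i\<in>UNIV. \<Sum>j\<in>UNIV. X $ i $ j *\<^sub>R dderiv (axis i 1) (dderiv (axis j 1) F) x) \<in> T"
    by (simp add: w_def sum_prod)
  then obtain v where "(0, \<Sum>i\<in>UNIV. \<Sum>j\<in>UNIV. X $ i $ j *\<^sub>R dderiv (axis i 1) (dderiv (axis j 1) F) x) = (v, dderiv v F x)"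
    unfolding T by blast
  then show ?thesis
    using linear_0[OF linear_dderiv[OF dif(1)[OF D(2)]]] by (simp add: X_def)
qed

lemma dderiv_dderiv_sum:
  assumes D: "open D" "x \<in> D" and sm: "smooth_on D F"
    and fin: "finite I" "finite J"
  shows "dderiv (\<Sum>i\<in>I. p i *\<^sub>R u i) (dderiv (\<Sum>j\<in>J. q j *\<^sub>R v j) F) x =
    (\<Sum>i\<in>I. \<Sum>j\<in>J. (p i * q j) *\<^sub>R dderiv (u i) (dderiv (v j) F) x)"
proof -
  note dif = smooth_on_differentiable[OF sm] smooth_on_differentiable[OF smooth_on_dderiv[OF sm]]
  have eq: "dderiv (\<Sum>j\<in>J. q j *\<^sub>R v j) F y = (\<Sum>j\<in>J. q j *\<^sub>R dderiv (v j) F y)" if "y \<in> D" for y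
    by (simp add: linear_sum[OF linear_dderiv[OF dif(1)[OF that]]]
        linear_scale[OF linear_dderiv[OF dif(1)[OF that]]])
  have "((\<lambda>y. \<Sum>j\<in>J. q j *\<^sub>R dderiv (v j) F y) has_derivative
      (\<lambda>h. \<Sum>j\<in>J. q j *\<^sub>R dderiv h (dderiv (v j) F) x)) (at x)"
    by (intro has_derivative_sum has_derivative_scaleR_right has_derivative_dderiv dif D)
  then have "(dderiv (\<Sum>j\<in>J. q j *\<^sub>R v j) F has_derivative
      (\<lambda>h. \<Sum>j\<in>J. q j *\<^sub>R dderiv h (dderiv (v j) F) x)) (at x)"
    by (rule has_derivative_transform_within_open[OF _ D]) (simp add: eq)
  from dderiv_unique[OF this]
  have "dderiv (\<Sum>i\<in>I. p i *\<^sub>R u i) (dderiv (\<Sum>j\<in>J. q j *\<^sub>R v j) F) x =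
      (\<Sum>j\<in>J. q j *\<^sub>R dderiv (\<Sum>i\<in>I. p i *\<^sub>R u i) (dderiv (v j) F) x)" .
  also have "\<dots> = (\<Sum>j\<in>J. \<Sum>i\<in>I. (p i * q j) *\<^sub>R dderiv (u i) (dderiv (v j) F) x)"
    by (simp add: linear_sum[OF linear_dderiv[OF dif(2)[OF D(2)]]]
        linear_scale[OF linear_dderiv[OF dif(2)[OF D(2)]]] scaleR_sum_right mult.commute)
  finally show ?thesis by (subst sum.swap)
qed

text \<open>The inverse metric and the second derivatives change by the same orthogonal matrix, so
  their contraction is the same in every orthonormal basis. This admits the singular frame of a
  point.\<close>

lemma minimal_graph_equation:
  fixes F :: "real^'n \<Rightarrow> real^'m"
  assumes D: "open D" "x \<in> D" and sm: "smooth_on D F" and min: "minimal_graph_on D F"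
    and a: "orthonormal a"
  shows "(\<Sum>i\<in>UNIV. \<Sum>j\<in>UNIV. frame_inverse F a x $ i $ j *\<^sub>R dderiv (a i) (dderiv (a j) F) x) = 0"
proof -
  define e where "e i = (axis i 1 :: real^'n)" for i
  have e: "orthonormal e" unfolding e_def by (rule orthonormal_axis)
  define X where "X = frame_inverse F a x"
  define H where "H i j = dderiv (a i) (dderiv (a j) F) x" for i j
  have Y: "frame_inverse F e x $ k $ l = (\<Sum>j\<in>UNIV. \<Sum>i\<in>UNIV. (e k \<bullet> a i) * X $ i $ j * (e l \<bullet> a j))" for k l
    unfolding frame_inverse_change[OF smooth_on_differentiable[OF sm D(2)] e a]
    by (simp add: matrix_matrix_mult_def transpose_def X_def sum_distrib_right)
  have Hexp: "H i j = (\<Sum>k\<in>UNIV. \<Sum>l\<in>UNIV. ((e k \<bullet> a i) * (e l \<bullet> a j)) *\<^sub>R dderiv (e k) (dderiv (e l) F) x)" for i j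
    unfolding H_def
    by (subst orthonormal_expansion[OF e, of "a i"], subst orthonormal_expansion[OF e, of "a j"],
        subst dderiv_dderiv_sum[OF D sm]) (simp_all add: inner_commute)
  have "(\<Sum>i\<in>UNIV. \<Sum>j\<in>UNIV. X $ i $ j *\<^sub>R H i j) =
      (\<Sum>i\<in>UNIV. \<Sum>j\<in>UNIV. \<Sum>k\<in>UNIV. \<Sum>l\<in>UNIV.
        ((e k \<bullet> a i) * X $ i $ j * (e l \<bullet> a j)) *\<^sub>R dderiv (e k) (dderiv (e l) F) x)"
    unfolding Hexp by (simp add: scaleR_sum_right mult_ac)
  also have "\<dots> = (\<Sum>k\<in>UNIV. \<Sum>l\<in>UNIV. \<Sum>j\<in>UNIV. \<Sum>i\<in>UNIV.
        ((e k \<bullet> a i) * X $ i $ j * (e l \<bullet> a j)) *\<^sub>R dderiv (e k) (dderiv (e l) F) x)"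
  proof -
    have "(\<Sum>i\<in>UNIV. \<Sum>j\<in>UNIV. \<Sum>k\<in>UNIV. \<Sum>l\<in>UNIV. g i j k l) =
        (\<Sum>k\<in>UNIV. \<Sum>l\<in>UNIV. \<Sum>j\<in>UNIV. \<Sum>i\<in>UNIV. g i j k l)" for g :: "'n \<Rightarrow> 'n \<Rightarrow> 'n \<Rightarrow> 'n \<Rightarrow> real^'m"
    proof -
      have "(\<Sum>i\<in>UNIV. \<Sum>j\<in>UNIV. \<Sum>k\<in>UNIV. \<Sum>l\<in>UNIV. g i j k l) =
          (\<Sum>i\<in>UNIV. \<Sum>k\<in>UNIV. \<Sum>l\<in>UNIV. \<Sum>j\<in>UNIV. g i j k l)"
        by (subst sum.swap, rule sum.cong[OF refl], rule sum.cong[OF refl], rule sum.swap)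
      also have "\<dots> = (\<Sum>k\<in>UNIV. \<Sum>l\<in>UNIV. \<Sum>i\<in>UNIV. \<Sum>j\<in>UNIV. g i j k l)"
        by (subst sum.swap, rule sum.cong[OF refl], rule sum.swap)
      also have "\<dots> = (\<Sum>k\<in>UNIV. \<Sum>l\<in>UNIV. \<Sum>j\<in>UNIV. \<Sum>i\<in>UNIV. g i j k l)"
        by (rule sum.cong[OF refl], rule sum.cong[OF refl], rule sum.swap)
      finally show ?thesis .
    qed
    then show ?thesis .
  qed
  also have "\<dots> = (\<Sum>k\<in>UNIV. \<Sum>l\<in>UNIV. frame_inverse F e x $ k $ l *\<^sub>R dderiv (e k) (dderiv (e l) F) x)"
    unfolding Y by (simp add: scaleR_sum_left)
  also have "\<dots> = 0"
    using minimal_graph_equation_axis[OF D sm min] unfolding e_def .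
  finally show ?thesis unfolding X_def H_def .
qed

section \<open>The Laplacian of the singular sum\<close>

definition frame_metric_dderiv ::
    "(real^'n \<Rightarrow> real^'m) \<Rightarrow> ('n \<Rightarrow> real^'n) \<Rightarrow> real^'n \<Rightarrow> 'n \<Rightarrow> 'n \<Rightarrow> real^'n \<Rightarrow> real" where
  "frame_metric_dderiv F a v i j x =
     dderiv (a i) F x \<bullet> dderiv v (dderiv (a j) F) x + dderiv v (dderiv (a i) F) x \<bullet> dderiv (a j) F x"

lemma has_derivative_frame_metric:
  assumes "smooth_on D F" "x \<in> D"
  shows "((\<lambda>y. frame_metric F a y $ i $ j) has_derivative (\<lambda>h. frame_metric_dderiv F a h i j x)) (at x)"
proof -
  note dif = smooth_on_differentiable[OF smooth_on_dderiv[OF assms(1)] assms(2)]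
  have "((\<lambda>y. (if i = j then 1 else 0) + dderiv (a i) F y \<bullet> dderiv (a j) F y) has_derivative
      (\<lambda>h. 0 + (dderiv (a i) F x \<bullet> dderiv h (dderiv (a j) F) x + dderiv h (dderiv (a i) F) x \<bullet> dderiv (a j) F x))) (at x)"
    by (intro has_derivative_add has_derivative_const has_derivative_inner has_derivative_dderiv dif)
  then show ?thesis by (simp add: frame_metric_def frame_metric_dderiv_def)
qed

lemma has_derivative_frame_inverse:
  assumes "smooth_on D F" "x \<in> D"
  shows "((\<lambda>y. frame_inverse F a y $ i $ j) has_derivative
    (\<lambda>h. - (\<Sum>k\<in>UNIV. \<Sum>l\<in>UNIV.
      frame_inverse F a x $ i $ k * frame_metric_dderiv F a h k l x * frame_inverse F a x $ l $ j))) (at x)"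
  unfolding frame_inverse_def
  by (rule has_derivative_matrix_inv_nth[OF frame_metric_invertible has_derivative_frame_metric[OF assms]])

lemma has_derivative_singular_sum:
  fixes F :: "real^'n \<Rightarrow> real^'m"
  assumes D: "open D" "x \<in> D" and sm: "smooth_on D F" and a: "orthonormal a"
  shows "(singular_sum F has_derivative (\<lambda>h. \<Sum>i\<in>UNIV. \<Sum>k\<in>UNIV. \<Sum>l\<in>UNIV.
      frame_inverse F a x $ i $ k * frame_metric_dderiv F a h k l x * frame_inverse F a x $ l $ i)) (at x)"
proof -
  have "((\<lambda>y. real CARD('n) - (\<Sum>i\<in>UNIV. frame_inverse F a y $ i $ i)) has_derivative
    (\<lambda>h. 0 - (\<Sum>i\<in>UNIV. - (\<Sum>k\<in>UNIV. \<Sum>l\<in>UNIV.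
      frame_inverse F a x $ i $ k * frame_metric_dderiv F a h k l x * frame_inverse F a x $ l $ i)))) (at x)"
    by (intro has_derivative_diff has_derivative_const has_derivative_sum has_derivative_frame_inverse[OF sm D(2)])
  then show ?thesis
    by (rule has_derivative_transform_within_open[OF _ D, THEN has_derivative_eq_rhs])
      (simp_all add: singular_sum_trace[OF smooth_on_differentiable[OF sm] a] trace_def sum_negf)
qed

lemma has_derivative_frame_metric_dderiv:
  assumes "smooth_on D F" "x \<in> D"
  shows "(frame_metric_dderiv F a v i j has_derivative
    (\<lambda>h. (dderiv (a i) F x \<bullet> dderiv h (dderiv v (dderiv (a j) F)) x + dderiv h (dderiv (a i) F) x \<bullet> dderiv v (dderiv (a j) F) x) +
      (dderiv v (dderiv (a i) F) x \<bullet> dderiv h (dderiv (a j) F) x + dderiv h (dderiv v (dderiv (a i) F)) x \<bullet> dderiv (a j) F x))) (at x)"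
proof -
  note sm = smooth_on_dderiv[OF assms(1)] smooth_on_dderiv[OF smooth_on_dderiv[OF assms(1)]]
  show ?thesis
    unfolding frame_metric_dderiv_def
    by (intro has_derivative_add has_derivative_inner has_derivative_dderiv sm[THEN smooth_on_differentiable] assms(2))
qed

lemma sum_diagonal_sandwich:
  fixes M :: "'n::finite \<Rightarrow> 'n \<Rightarrow> real"
  shows "(\<Sum>k\<in>UNIV. \<Sum>l\<in>UNIV. (if i = k then p i else 0) * M k l * (if l = j then q l else 0)) = p i * M i j * q j"
  by (simp add: mult_delta_right) (simp add: mult_delta_left)

lemma sum_diagonal_left:
  fixes g :: "'n::finite \<Rightarrow> 'n \<Rightarrow> real"
  shows "(\<Sum>k\<in>UNIV. \<Sum>l\<in>UNIV. (if i = k then p i else 0) * g k l) = (\<Sum>l\<in>UNIV. p i * g i l)"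
  by (subst sum.swap) (simp add: mult_delta_left)

lemma sum_diagonal_right:
  fixes g :: "'n::finite \<Rightarrow> 'n \<Rightarrow> real"
  shows "(\<Sum>k\<in>UNIV. \<Sum>l\<in>UNIV. g k l * (if l = j then q l else 0)) = (\<Sum>k\<in>UNIV. g k j * q j)"
  by (simp add: mult_delta_right)

text \<open>With \<open>X\<close> the inverse metric and \<open>M\<close> the derivative of the
  metric along \<open>v\<close>, the first derivative is the trace of \<open>X M X\<close>, and the
  second is the trace of \<open>X M' X\<close> minus twice that of \<open>X M X M X\<close>. The
  diagonal form of \<open>X\<close> is inserted only at \<open>x\<close>, after
  differentiating.\<close>

lemma singular_sum_dderivs:
  fixes F :: "real^'n \<Rightarrow> real^'m" and v :: "real^'n"
  assumes D: "open D" "x \<in> D" and sm: "smooth_on D F"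
    and fr: "singular_frame (jacobian F (at x)) a \<kappa> b"
  defines "w \<equiv> \<lambda>i. 1 / (1 + (\<kappa> i)\<^sup>2)"
    and "H \<equiv> \<lambda>i. dderiv v (dderiv (a i) F) x"
  shows "dderiv v (singular_sum F) x = 2 * (\<Sum>i\<in>UNIV. (w i)\<^sup>2 * \<kappa> i * (b i \<bullet> H i))"
    and "dderiv v (singular_sum F) differentiable (at x)"
    and "dderiv v (dderiv v (singular_sum F)) x =
      (\<Sum>i\<in>UNIV. (w i)\<^sup>2 * (2 * (H i \<bullet> H i) + 2 * \<kappa> i * (b i \<bullet> dderiv v (dderiv v (dderiv (a i) F)) x)))
      - 2 * (\<Sum>i\<in>UNIV. \<Sum>k\<in>UNIV. (w i)\<^sup>2 * w k * (\<kappa> i * (b i \<bullet> H k) + \<kappa> k * (b k \<bullet> H i))\<^sup>2)"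
proof -
  have a: "orthonormal a" using fr by (simp add: singular_frame_def)
  note dF = smooth_on_differentiable[OF sm]
  note Fa = frame_inverse_singular_frame(1)[OF dF[OF D(2)] fr]
  define X where "X i j y = frame_inverse F a y $ i $ j" for i j y
  define M where "M i j y = frame_metric_dderiv F a v i j y" for i j y
  have X0: "X i j x = (if i = j then w i else 0)" for i j
    unfolding X_def w_def by (rule frame_inverse_singular_frame(2)[OF dF[OF D(2)] fr])
  have M0: "M i j x = \<kappa> i * (b i \<bullet> H j) + \<kappa> j * (b j \<bullet> H i)" for i j
    by (simp add: M_def frame_metric_dderiv_def Fa H_def inner_commute)
  have S1: "dderiv v (singular_sum F) y = (\<Sum>i\<in>UNIV. \<Sum>k\<in>UNIV. \<Sum>l\<in>UNIV. X i k y * M k l y * X l i y)"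
    if "y \<in> D" for y
    unfolding X_def M_def by (rule dderiv_unique[OF has_derivative_singular_sum[OF D(1) that sm a]])
  show "dderiv v (singular_sum F) x = 2 * (\<Sum>i\<in>UNIV. (w i)\<^sup>2 * \<kappa> i * (b i \<bullet> H i))"
  proof -
    have "dderiv v (singular_sum F) x = (\<Sum>i\<in>UNIV. w i * M i i x * w i)"
      unfolding S1[OF D(2)] X0 by (intro sum.cong refl sum_diagonal_sandwich)
    then show ?thesis by (simp add: M0 sum_distrib_left power2_eq_square mult_ac)
  qed
  define X' where "X' i j h = - (\<Sum>k\<in>UNIV. \<Sum>l\<in>UNIV. X i k x * frame_metric_dderiv F a h k l x * X l j x)" for i j h
  have dX: "(X i j has_derivative X' i j) (at x)" for i j
    unfolding X_def X'_def by (rule has_derivative_frame_inverse[OF sm D(2)])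
  have X'v: "X' i j v = - (w i * w j * M i j x)" for i j
    unfolding X'_def X0 M_def[symmetric] by (subst sum_diagonal_sandwich) simp
  define M' where "M' i j h = (dderiv (a i) F x \<bullet> dderiv h (dderiv v (dderiv (a j) F)) x + dderiv h (dderiv (a i) F) x \<bullet> dderiv v (dderiv (a j) F) x) +
      (dderiv v (dderiv (a i) F) x \<bullet> dderiv h (dderiv (a j) F) x + dderiv h (dderiv v (dderiv (a i) F)) x \<bullet> dderiv (a j) F x)" for i j h
  have dM: "(M i j has_derivative M' i j) (at x)" for i j
    unfolding M_def M'_def by (rule has_derivative_frame_metric_dderiv[OF sm D(2)])
  have "((\<lambda>y. \<Sum>i\<in>UNIV. \<Sum>k\<in>UNIV. \<Sum>l\<in>UNIV. X i k y * M k l y * X l i y) has_derivative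
      (\<lambda>h. \<Sum>i\<in>UNIV. \<Sum>k\<in>UNIV. \<Sum>l\<in>UNIV. X i k x * M k l x * X' l i h + (X i k x * M' k l h + X' i k h * M k l x) * X l i x)) (at x)"
    by (intro has_derivative_sum has_derivative_mult dX dM)
  then have d2: "(dderiv v (singular_sum F) has_derivative
      (\<lambda>h. \<Sum>i\<in>UNIV. \<Sum>k\<in>UNIV. \<Sum>l\<in>UNIV. X i k x * M k l x * X' l i h + (X i k x * M' k l h + X' i k h * M k l x) * X l i x)) (at x)"
    by (rule has_derivative_transform_within_open[OF _ D]) (simp add: S1)
  then show "dderiv v (singular_sum F) differentiable (at x)"
    unfolding differentiable_def by blast
  have "dderiv v (dderiv v (singular_sum F)) x =
      (\<Sum>i\<in>UNIV. \<Sum>k\<in>UNIV. \<Sum>l\<in>UNIV. X i k x * M k l x * X' l i v) +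
      ((\<Sum>i\<in>UNIV. \<Sum>k\<in>UNIV. \<Sum>l\<in>UNIV. X i k x * M' k l v * X l i x) +
       (\<Sum>i\<in>UNIV. \<Sum>k\<in>UNIV. \<Sum>l\<in>UNIV. X' i k v * M k l x * X l i x))"
    unfolding dderiv_unique[OF d2] by (simp only: sum.distrib distrib_right)
  also have "(\<Sum>i\<in>UNIV. \<Sum>k\<in>UNIV. \<Sum>l\<in>UNIV. X i k x * M k l x * X' l i v) =
      - (\<Sum>i\<in>UNIV. \<Sum>k\<in>UNIV. (w i)\<^sup>2 * w k * (M i k x)\<^sup>2)"
  proof -
    have "(\<Sum>k\<in>UNIV. \<Sum>l\<in>UNIV. X i k x * M k l x * X' l i v) = (\<Sum>l\<in>UNIV. w i * (M i l x * X' l i v))" for i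
      unfolding X0 mult.assoc by (rule sum_diagonal_left)
    moreover have "w i * (M i l x * X' l i v) = - ((w i)\<^sup>2 * w l * (M i l x)\<^sup>2)" for i l
      by (simp add: X'v M0 power2_eq_square algebra_simps)
    ultimately show ?thesis by (simp add: sum_negf)
  qed
  also have "(\<Sum>i\<in>UNIV. \<Sum>k\<in>UNIV. \<Sum>l\<in>UNIV. X' i k v * M k l x * X l i x) =
      - (\<Sum>i\<in>UNIV. \<Sum>k\<in>UNIV. (w i)\<^sup>2 * w k * (M i k x)\<^sup>2)"
  proof -
    have "(\<Sum>k\<in>UNIV. \<Sum>l\<in>UNIV. X' i k v * M k l x * X l i x) = (\<Sum>k\<in>UNIV. X' i k v * M k i x * w i)" for i
      unfolding X0 by (rule sum_diagonal_right)
    moreover have "X' i k v * M k i x * w i = - ((w i)\<^sup>2 * w k * (M i k x)\<^sup>2)" for i k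
      by (simp add: X'v M0 power2_eq_square algebra_simps)
    ultimately show ?thesis by (simp add: sum_negf)
  qed
  also have "(\<Sum>i\<in>UNIV. \<Sum>k\<in>UNIV. \<Sum>l\<in>UNIV. X i k x * M' k l v * X l i x) =
     (\<Sum>i\<in>UNIV. (w i)\<^sup>2 * M' i i v)"
  proof (rule sum.cong[OF refl])
    fix i
    have "(\<Sum>k\<in>UNIV. \<Sum>l\<in>UNIV. X i k x * M' k l v * X l i x) = w i * M' i i v * w i"
      unfolding X0 by (rule sum_diagonal_sandwich)
    then show "(\<Sum>k\<in>UNIV. \<Sum>l\<in>UNIV. X i k x * M' k l v * X l i x) = (w i)\<^sup>2 * M' i i v"
      by (simp add: power2_eq_square mult_ac)
  qed
  also have "(\<Sum>i\<in>UNIV. (w i)\<^sup>2 * M' i i v) =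
      (\<Sum>i\<in>UNIV. (w i)\<^sup>2 * (2 * (H i \<bullet> H i) + 2 * \<kappa> i * (b i \<bullet> dderiv v (dderiv v (dderiv (a i) F)) x)))"
    by (intro sum.cong) (auto simp: M'_def Fa H_def inner_commute)
  finally show "dderiv v (dderiv v (singular_sum F)) x =
      (\<Sum>i\<in>UNIV. (w i)\<^sup>2 * (2 * (H i \<bullet> H i) + 2 * \<kappa> i * (b i \<bullet> dderiv v (dderiv v (dderiv (a i) F)) x)))
      - 2 * (\<Sum>i\<in>UNIV. \<Sum>k\<in>UNIV. (w i)\<^sup>2 * w k * (\<kappa> i * (b i \<bullet> H k) + \<kappa> k * (b k \<bullet> H i))\<^sup>2)"
    unfolding M0 by simp
qed

text \<open>Differentiating \<open>\<Sum> g\<^sup>i\<^sup>j F\<^sub>i\<^sub>j = 0\<close> along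
  \<open>v\<close> expresses traced third derivatives through products of second derivatives; the
  right-hand side comes from the derivative of the inverse metric.\<close>

lemma minimal_graph_equation_dderiv:
  fixes F :: "real^'n \<Rightarrow> real^'m" and v :: "real^'n"
  assumes D: "open D" "x \<in> D" and sm: "smooth_on D F" and min: "minimal_graph_on D F"
    and fr: "singular_frame (jacobian F (at x)) a \<kappa> b"
  defines "w \<equiv> \<lambda>i. 1 / (1 + (\<kappa> i)\<^sup>2)"
    and "H \<equiv> \<lambda>i. dderiv v (dderiv (a i) F) x"
  shows "(\<Sum>k\<in>UNIV. w k *\<^sub>R dderiv v (dderiv (a k) (dderiv (a k) F)) x) =
    (\<Sum>k\<in>UNIV. \<Sum>l\<in>UNIV. (w k * w l * (\<kappa> k * (b k \<bullet> H l) + \<kappa> l * (b l \<bullet> H k))) *\<^sub>R dderiv (a k) (dderiv (a l) F) x)"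
proof -
  have a: "orthonormal a" using fr by (simp add: singular_frame_def)
  note dF = smooth_on_differentiable[OF sm]
  note Fa = frame_inverse_singular_frame(1)[OF dF[OF D(2)] fr]
  define X where "X i j y = frame_inverse F a y $ i $ j" for i j y
  define M where "M i j = frame_metric_dderiv F a v i j x" for i j
  have X0: "X i j x = (if i = j then w i else 0)" for i j
    unfolding X_def w_def by (rule frame_inverse_singular_frame(2)[OF dF[OF D(2)] fr])
  have M0: "M i j = \<kappa> i * (b i \<bullet> H j) + \<kappa> j * (b j \<bullet> H i)" for i j
    by (simp add: M_def frame_metric_dderiv_def Fa H_def inner_commute)
  define X' where "X' i j h = - (\<Sum>k\<in>UNIV. \<Sum>l\<in>UNIV. X i k x * frame_metric_dderiv F a h k l x * X l j x)" for i j h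
  have dX: "(X i j has_derivative X' i j) (at x)" for i j
    unfolding X_def X'_def by (rule has_derivative_frame_inverse[OF sm D(2)])
  have X'v: "X' i j v = - (w i * w j * M i j)" for i j
    unfolding X'_def X0 M_def[symmetric] by (subst sum_diagonal_sandwich) simp
  have "((\<lambda>y. \<Sum>i\<in>UNIV. \<Sum>j\<in>UNIV. X i j y *\<^sub>R dderiv (a i) (dderiv (a j) F) y) has_derivative
      (\<lambda>h. \<Sum>i\<in>UNIV. \<Sum>j\<in>UNIV. X i j x *\<^sub>R dderiv h (dderiv (a i) (dderiv (a j) F)) x +
        X' i j h *\<^sub>R dderiv (a i) (dderiv (a j) F) x)) (at x)"
    by (intro has_derivative_sum has_derivative_scaleR dX has_derivative_dderiv
        smooth_on_differentiable[OF _ D(2)] smooth_on_dderiv sm)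
  moreover have "((\<lambda>y. \<Sum>i\<in>UNIV. \<Sum>j\<in>UNIV. X i j y *\<^sub>R dderiv (a i) (dderiv (a j) F) y) has_derivative (\<lambda>h. 0)) (at x)"
    by (rule has_derivative_transform_within_open[OF has_derivative_const D])
      (simp add: X_def minimal_graph_equation[OF D(1) _ sm min a])
  ultimately have "(\<Sum>i\<in>UNIV. \<Sum>j\<in>UNIV. X i j x *\<^sub>R dderiv v (dderiv (a i) (dderiv (a j) F)) x +
        X' i j v *\<^sub>R dderiv (a i) (dderiv (a j) F) x) = 0"
    by (rule fun_cong[OF has_derivative_unique])
  then have "(\<Sum>i\<in>UNIV. \<Sum>j\<in>UNIV. X i j x *\<^sub>R dderiv v (dderiv (a i) (dderiv (a j) F)) x) =
      (\<Sum>i\<in>UNIV. \<Sum>j\<in>UNIV. (w i * w j * M i j) *\<^sub>R dderiv (a i) (dderiv (a j) F) x)"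
    by (simp add: X'v sum.distrib sum_negf sum_subtractf)
  then show ?thesis
    unfolding X0 M0 by (simp add: if_distrib[of "\<lambda>x. x *\<^sub>R _"] cong: if_cong)
qed

section \<open>The Laplacian of the singular sum as a quadratic form in the second
  derivatives\<close>

text \<open>Here \<open>f l i k\<close> stands for \<open>b\<^sub>l \<bullet> F\<^sub>i\<^sub>k\<close>, \<open>n2 i k\<close> for \<open>F\<^sub>i\<^sub>k \<bullet> F\<^sub>i\<^sub>k\<close> and \<open>t i k\<close> for \<open>b\<^sub>i \<bullet> F\<^sub>i\<^sub>k\<^sub>k\<close>;
  the differentiated minimal graph equation eliminates the third derivatives, which cancel
  the mixed products \<open>f i j k * f j i k\<close>.\<close>

lemma laplacian_algebra:
  fixes w \<kappa> :: "'n::finite \<Rightarrow> real" and f :: "'n \<Rightarrow> 'n \<Rightarrow> 'n \<Rightarrow> real" and n2 t :: "'n \<Rightarrow> 'n \<Rightarrow> real"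
  assumes w: "\<And>i. w i = 1 / (1 + (\<kappa> i)\<^sup>2)"
    and sym: "\<And>i j k. f i j k = f i k j"
    and t: "\<And>i. (\<Sum>k\<in>UNIV. w k * t i k) =
      (\<Sum>j\<in>UNIV. \<Sum>k\<in>UNIV. w j * w k * (\<kappa> j * f j k i + \<kappa> k * f k j i) * f i j k)"
  shows "(\<Sum>k\<in>UNIV. w k * ((\<Sum>i\<in>UNIV. (w i)\<^sup>2 * (2 * n2 i k + 2 * \<kappa> i * t i k))
      - 2 * (\<Sum>i\<in>UNIV. \<Sum>j\<in>UNIV. (w i)\<^sup>2 * w j * (\<kappa> i * f i j k + \<kappa> j * f j i k)\<^sup>2))) =
    2 * (\<Sum>k\<in>UNIV. \<Sum>i\<in>UNIV. w k * ((w i)\<^sup>2 * (n2 i k - (\<Sum>l\<in>UNIV. (f l i k)\<^sup>2)) +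
      (\<Sum>l\<in>UNIV. w i * w l * (w i + w l - 1) * (f l i k)\<^sup>2)))"
proof -
  have s: "w l * (\<kappa> l)\<^sup>2 = 1 - w l" for l
    unfolding w by (simp add: field_simps add_nonneg_eq_0_iff)
  have swap: "(\<Sum>k\<in>UNIV. \<Sum>i\<in>UNIV. \<Sum>j\<in>UNIV. g k i j) = (\<Sum>k\<in>UNIV. \<Sum>i\<in>UNIV. \<Sum>j\<in>UNIV. g k j i)"
    for g :: "'n \<Rightarrow> 'n \<Rightarrow> 'n \<Rightarrow> real"
    by (rule sum.cong[OF refl], rule sum.swap)
  have rot: "(\<Sum>k\<in>UNIV. \<Sum>i\<in>UNIV. \<Sum>j\<in>UNIV. g k i j) = (\<Sum>k\<in>UNIV. \<Sum>i\<in>UNIV. \<Sum>j\<in>UNIV. g j k i)"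
    for g :: "'n \<Rightarrow> 'n \<Rightarrow> 'n \<Rightarrow> real"
  proof -
    have "(\<Sum>k\<in>UNIV. \<Sum>i\<in>UNIV. \<Sum>j\<in>UNIV. g j k i) = (\<Sum>k\<in>UNIV. \<Sum>j\<in>UNIV. \<Sum>i\<in>UNIV. g j k i)"
      by (rule sum.cong[OF refl], rule sum.swap)
    also have "\<dots> = (\<Sum>j\<in>UNIV. \<Sum>k\<in>UNIV. \<Sum>i\<in>UNIV. g j k i)" by (rule sum.swap)
    finally show ?thesis by simp
  qed
  \<comment> \<open>The squares expand into \<open>R + P + 2 * C\<close>, where \<open>R\<close> is
    the part from \<open>(\<kappa> i * f i j k)\<^sup>2\<close> with \<open>i\<close> and
    \<open>j\<close> interchanged. The third derivatives contribute \<open>2 * C\<close> with the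
    opposite sign, so \<open>C\<close> drops out.\<close>
  define C where "C = (\<Sum>k\<in>UNIV. \<Sum>i\<in>UNIV. \<Sum>j\<in>UNIV. w k * (w i)\<^sup>2 * w j * \<kappa> i * \<kappa> j * f i j k * f j i k)"
  define P where "P = (\<Sum>k\<in>UNIV. \<Sum>i\<in>UNIV. \<Sum>j\<in>UNIV. w k * (w i)\<^sup>2 * w j * (\<kappa> j)\<^sup>2 * (f j i k)\<^sup>2)"
  define R where "R = (\<Sum>k\<in>UNIV. \<Sum>i\<in>UNIV. \<Sum>j\<in>UNIV. w k * (w j)\<^sup>2 * w i * (\<kappa> j)\<^sup>2 * (f j i k)\<^sup>2)"
  define N where "N = (\<Sum>k\<in>UNIV. \<Sum>i\<in>UNIV. w k * (w i)\<^sup>2 * n2 i k)"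
  have T: "(\<Sum>k\<in>UNIV. \<Sum>i\<in>UNIV. w k * (w i)\<^sup>2 * \<kappa> i * t i k) = 2 * C"
  proof -
    have "(\<Sum>k\<in>UNIV. \<Sum>i\<in>UNIV. w k * (w i)\<^sup>2 * \<kappa> i * t i k) =
        (\<Sum>i\<in>UNIV. (w i)\<^sup>2 * \<kappa> i * (\<Sum>k\<in>UNIV. w k * t i k))"
      by (subst sum.swap) (simp add: sum_distrib_left mult_ac)
    also have "\<dots> = (\<Sum>i\<in>UNIV. \<Sum>j\<in>UNIV. \<Sum>k\<in>UNIV. (w i)\<^sup>2 * \<kappa> i * w j * w k * \<kappa> j * f j k i * f i j k) +
        (\<Sum>i\<in>UNIV. \<Sum>j\<in>UNIV. \<Sum>k\<in>UNIV. (w i)\<^sup>2 * \<kappa> i * w j * w k * \<kappa> k * f k j i * f i j k)"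
      unfolding t by (simp add: sum_distrib_left sum.distrib[symmetric] algebra_simps)
    also have "(\<Sum>i\<in>UNIV. \<Sum>j\<in>UNIV. \<Sum>k\<in>UNIV. (w i)\<^sup>2 * \<kappa> i * w j * w k * \<kappa> k * f k j i * f i j k) =
        (\<Sum>i\<in>UNIV. \<Sum>j\<in>UNIV. \<Sum>k\<in>UNIV. (w i)\<^sup>2 * \<kappa> i * w j * w k * \<kappa> j * f j k i * f i j k)"
      by (subst swap) (simp add: sym[of i j k for i j k] mult_ac)
    also have "(\<Sum>i\<in>UNIV. \<Sum>j\<in>UNIV. \<Sum>k\<in>UNIV. (w i)\<^sup>2 * \<kappa> i * w j * w k * \<kappa> j * f j k i * f i j k) = C"
      unfolding C_def by (subst rot) (intro sum.cong refl, simp add: sym[of j i k for i j k] mult_ac)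
    finally show ?thesis by simp
  qed
  have E: "(\<Sum>k\<in>UNIV. \<Sum>i\<in>UNIV. \<Sum>j\<in>UNIV. w k * (w i)\<^sup>2 * w j * (\<kappa> i * f i j k + \<kappa> j * f j i k)\<^sup>2) = R + P + 2 * C"
  proof -
    have "(\<Sum>k\<in>UNIV. \<Sum>i\<in>UNIV. \<Sum>j\<in>UNIV. w k * (w i)\<^sup>2 * w j * (\<kappa> i * f i j k + \<kappa> j * f j i k)\<^sup>2) =
        (\<Sum>k\<in>UNIV. \<Sum>i\<in>UNIV. \<Sum>j\<in>UNIV. w k * (w i)\<^sup>2 * w j * (\<kappa> i)\<^sup>2 * (f i j k)\<^sup>2) + P + 2 * C"
      unfolding P_def C_def by (simp add: sum_distrib_left sum.distrib[symmetric] power2_eq_square algebra_simps)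
    then show ?thesis unfolding R_def by (subst (asm) swap) simp
  qed
  have "(\<Sum>k\<in>UNIV. w k * ((\<Sum>i\<in>UNIV. (w i)\<^sup>2 * (2 * n2 i k + 2 * \<kappa> i * t i k))
      - 2 * (\<Sum>i\<in>UNIV. \<Sum>j\<in>UNIV. (w i)\<^sup>2 * w j * (\<kappa> i * f i j k + \<kappa> j * f j i k)\<^sup>2))) =
    2 * N + 2 * (\<Sum>k\<in>UNIV. \<Sum>i\<in>UNIV. w k * (w i)\<^sup>2 * \<kappa> i * t i k)
      - 2 * (\<Sum>k\<in>UNIV. \<Sum>i\<in>UNIV. \<Sum>j\<in>UNIV. w k * (w i)\<^sup>2 * w j * (\<kappa> i * f i j k + \<kappa> j * f j i k)\<^sup>2)"
    unfolding N_def by (simp add: sum_distrib_left sum.distrib sum_subtractf right_diff_distrib distrib_left mult_ac)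
  also have "\<dots> = 2 * N - 2 * R - 2 * P" unfolding T E by simp
  also have "\<dots> = 2 * (\<Sum>k\<in>UNIV. \<Sum>i\<in>UNIV. w k * ((w i)\<^sup>2 * (n2 i k - (\<Sum>l\<in>UNIV. (f l i k)\<^sup>2)) +
      (\<Sum>l\<in>UNIV. w i * w l * (w i + w l - 1) * (f l i k)\<^sup>2)))"
  proof -
    \<comment> \<open>The origin of the coefficient \<open>w i + w j - 1\<close>: by
      \<open>s\<close>, both terms together carry \<open>w i * (w i + w j) * (1 - w j)\<close>,
      which is \<open>(w i)\<^sup>2 - w i * w j * (w i + w j - 1)\<close>.\<close>
    have c: "w k * (w j)\<^sup>2 * w i * (\<kappa> j)\<^sup>2 * F + w k * (w i)\<^sup>2 * w j * (\<kappa> j)\<^sup>2 * F =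
      w k * (w i)\<^sup>2 * F - w k * w i * w j * (w i + w j - 1) * F" for i j k F
    proof -
      have "w k * (w j)\<^sup>2 * w i * (\<kappa> j)\<^sup>2 * F + w k * (w i)\<^sup>2 * w j * (\<kappa> j)\<^sup>2 * F =
        w k * w i * (w j + w i) * (w j * (\<kappa> j)\<^sup>2) * F" by (simp add: power2_eq_square algebra_simps)
      also have "\<dots> = w k * (w i)\<^sup>2 * F - w k * w i * w j * (w i + w j - 1) * F"
        unfolding s by (simp add: power2_eq_square algebra_simps)
      finally show ?thesis .
    qed
    have "R + P = (\<Sum>k\<in>UNIV. \<Sum>i\<in>UNIV. \<Sum>j\<in>UNIV. w k * (w i)\<^sup>2 * (f j i k)\<^sup>2 - w k * w i * w j * (w i + w j - 1) * (f j i k)\<^sup>2)"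
      unfolding R_def P_def sum.distrib[symmetric] c ..
    moreover have "w k * ((w i)\<^sup>2 * (n2 i k - (\<Sum>l\<in>UNIV. (f l i k)\<^sup>2)) +
        (\<Sum>l\<in>UNIV. w i * w l * (w i + w l - 1) * (f l i k)\<^sup>2)) = w k * (w i)\<^sup>2 * n2 i k -
        (\<Sum>j\<in>UNIV. w k * (w i)\<^sup>2 * (f j i k)\<^sup>2 - w k * w i * w j * (w i + w j - 1) * (f j i k)\<^sup>2)" for k i
    proof -
      have "(\<Sum>j\<in>UNIV. w k * (w i)\<^sup>2 * (f j i k)\<^sup>2 - w k * w i * w j * (w i + w j - 1) * (f j i k)\<^sup>2) =
          w k * (w i)\<^sup>2 * (\<Sum>l\<in>UNIV. (f l i k)\<^sup>2) - w k * (\<Sum>l\<in>UNIV. w i * w l * (w i + w l - 1) * (f l i k)\<^sup>2)"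
        by (simp add: sum_subtractf sum_distrib_left mult.assoc)
      then show ?thesis by (simp add: algebra_simps)
    qed
    ultimately show ?thesis unfolding N_def by (simp only: sum_subtractf) simp
  qed
  finally show ?thesis .
qed

text \<open>Since the coordinates are harmonic on a minimal graph, the left-hand side is the
  Laplace--Beltrami operator of the graph applied to the singular sum.\<close>

lemma laplacian_singular_sum:
  fixes F :: "real^'n \<Rightarrow> real^'m"
  assumes D: "open D" "x \<in> D" and sm: "smooth_on D F" and min: "minimal_graph_on D F"
    and fr: "singular_frame (jacobian F (at x)) a \<kappa> b"
  defines "w \<equiv> \<lambda>i. 1 / (1 + (\<kappa> i)\<^sup>2)"
    and "H \<equiv> \<lambda>i k. dderiv (a k) (dderiv (a i) F) x"
  shows "(\<Sum>k\<in>UNIV. w k * dderiv (a k) (dderiv (a k) (singular_sum F)) x) =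
    2 * (\<Sum>k\<in>UNIV. \<Sum>i\<in>UNIV. w k * ((w i)\<^sup>2 * (H i k \<bullet> H i k - (\<Sum>l\<in>UNIV. (b l \<bullet> H i k)\<^sup>2)) +
      (\<Sum>l\<in>UNIV. w i * w l * (w i + w l - 1) * (b l \<bullet> H i k)\<^sup>2)))"
proof -
  have Hsym: "H i k = H k i" for i k
    unfolding H_def by (rule dderiv_commute[OF D sm])
  \<comment> \<open>Moves the derivative along \<open>v\<close> to the outside, where the
    differentiated minimal graph equation has it.\<close>
  have third: "dderiv u (dderiv u (dderiv v F)) x = dderiv v (dderiv u (dderiv u F)) x" for u v
  proof -
    have "dderiv u (dderiv u (dderiv v F)) x = dderiv u (dderiv v (dderiv u F)) x"
      by (rule dderiv_cong_open[OF D])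
        (auto intro: dderiv_commute[OF D(1) _ sm] smooth_on_differentiable[OF _ D(2)] smooth_on_dderiv sm)
    also have "\<dots> = dderiv v (dderiv u (dderiv u F)) x"
      by (rule dderiv_commute[OF D smooth_on_dderiv[OF sm]])
    finally show ?thesis .
  qed
  define t where "t i k = b i \<bullet> dderiv (a k) (dderiv (a k) (dderiv (a i) F)) x" for i k
  have t: "(\<Sum>k\<in>UNIV. w k * t i k) =
      (\<Sum>j\<in>UNIV. \<Sum>k\<in>UNIV. w j * w k * (\<kappa> j * (b j \<bullet> H k i) + \<kappa> k * (b k \<bullet> H j i)) * (b i \<bullet> H j k))" for i
  proof -
    have "(\<Sum>k\<in>UNIV. w k * t i k) = b i \<bullet> (\<Sum>k\<in>UNIV. w k *\<^sub>R dderiv (a i) (dderiv (a k) (dderiv (a k) F)) x)"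
      unfolding t_def third[of "a k" "a i" for k] by (simp add: inner_sum_right)
    also have "\<dots> = b i \<bullet> (\<Sum>k\<in>UNIV. \<Sum>l\<in>UNIV. (w k * w l * (\<kappa> k * (b k \<bullet> H l i) + \<kappa> l * (b l \<bullet> H k i))) *\<^sub>R H l k)"
      unfolding H_def w_def minimal_graph_equation_dderiv[OF D sm min fr] ..
    also have "\<dots> = (\<Sum>j\<in>UNIV. \<Sum>k\<in>UNIV. w j * w k * (\<kappa> j * (b j \<bullet> H k i) + \<kappa> k * (b k \<bullet> H j i)) * (b i \<bullet> H j k))"
      unfolding inner_sum_right inner_scaleR_right
    proof (intro sum.cong refl)
      fix k l
      show "w k * w l * (\<kappa> k * (b k \<bullet> H l i) + \<kappa> l * (b l \<bullet> H k i)) * (b i \<bullet> H l k) =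
          w k * w l * (\<kappa> k * (b k \<bullet> H l i) + \<kappa> l * (b l \<bullet> H k i)) * (b i \<bullet> H k l)"
        by (simp only: Hsym[of l k])
    qed
    finally show ?thesis .
  qed
  have "(\<Sum>k\<in>UNIV. w k * dderiv (a k) (dderiv (a k) (singular_sum F)) x) =
    (\<Sum>k\<in>UNIV. w k * ((\<Sum>i\<in>UNIV. (w i)\<^sup>2 * (2 * (H i k \<bullet> H i k) + 2 * \<kappa> i * t i k))
      - 2 * (\<Sum>i\<in>UNIV. \<Sum>j\<in>UNIV. (w i)\<^sup>2 * w j * (\<kappa> i * (b i \<bullet> H j k) + \<kappa> j * (b j \<bullet> H i k))\<^sup>2)))"
    unfolding singular_sum_dderivs(3)[OF D sm fr] t_def H_def w_def ..
  also have "\<dots> = 2 * (\<Sum>k\<in>UNIV. \<Sum>i\<in>UNIV. w k * ((w i)\<^sup>2 * (H i k \<bullet> H i k - (\<Sum>l\<in>UNIV. (b l \<bullet> H i k)\<^sup>2)) +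
      (\<Sum>l\<in>UNIV. w i * w l * (w i + w l - 1) * (b l \<bullet> H i k)\<^sup>2)))"
    by (rule laplacian_algebra[OF _ _ t]) (simp_all add: w_def Hsym)
  finally show ?thesis .
qed

section \<open>Lower bounds for the quadratic form\<close>

text \<open>With \<open>s i = 1 - w i\<close>, the estimate rests on the superadditivity of
  \<open>s (1 - s) / (1 - 2 s)\<close> on \<open>[0, 1/2)\<close>: it lets Cauchy--Schwarz absorb the one term
  with a negative coefficient, up to a multiple of the gradient.\<close>

lemma diagonal_terms_lower_bound:
  fixes w \<kappa> f :: "'n::finite \<Rightarrow> real"
  assumes \<kappa>: "\<And>i. 0 \<le> \<kappa> i" and w: "\<And>i. w i = 1 / (1 + (\<kappa> i)\<^sup>2)"
    and S: "(\<Sum>i\<in>UNIV. 1 - w i) \<le> 1" and K: "\<And>i. \<bar>f i\<bar> \<le> K"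
  shows "(\<Sum>i\<in>UNIV. w i * w i * (w i + w i - 1) * (f i)\<^sup>2) \<ge>
    - 2 * K * \<bar>\<Sum>i\<in>UNIV. (w i)\<^sup>2 * \<kappa> i * f i\<bar>"
proof -
  define s where "s i = 1 - w i" for i
  \<comment> \<open>In these variables the form is the sum of
    \<open>(1 - 2 * s i) * (y i)\<^sup>2\<close>, and \<open>B\<close>, which is half a directional
    derivative of the singular sum, is the sum of \<open>c i * y i\<close> with
    \<open>(c i)\<^sup>2 = s i * (1 - s i)\<close>.\<close>
  define c where "c i = w i * \<kappa> i" for i
  define y where "y i = w i * f i" for i
  define B where "B = (\<Sum>i\<in>UNIV. c i * y i)"
  have w01: "0 < w i" "w i \<le> 1" for i
    unfolding w by (simp_all add: add_pos_nonneg field_simps)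
  then have s0: "0 \<le> s i" for i by (simp add: s_def)
  have sw: "w i * (\<kappa> i)\<^sup>2 = s i" for i
    unfolding s_def w by (simp add: field_simps add_nonneg_eq_0_iff)
  have c2: "(c i)\<^sup>2 = s i * (1 - s i)" for i
  proof -
    have "(c i)\<^sup>2 = w i * (w i * (\<kappa> i)\<^sup>2)" by (simp add: c_def power2_eq_square)
    then show ?thesis unfolding sw by (simp add: s_def)
  qed
  have c0: "0 \<le> c i" for i using w01 \<kappa> by (simp add: c_def less_imp_le)
  have K0: "0 \<le> K" using K[of undefined] by linarith
  have lhs: "(\<Sum>i\<in>UNIV. w i * w i * (w i + w i - 1) * (f i)\<^sup>2) = (\<Sum>i\<in>UNIV. (1 - 2 * s i) * (y i)\<^sup>2)"
    by (intro sum.cong) (auto simp: y_def s_def power2_eq_square)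
  have rhs: "(\<Sum>i\<in>UNIV. (w i)\<^sup>2 * \<kappa> i * f i) = B"
    unfolding B_def by (intro sum.cong) (auto simp: y_def c_def power2_eq_square)
  have "(\<Sum>i\<in>UNIV. (1 - 2 * s i) * (y i)\<^sup>2) \<ge> - 2 * K * \<bar>B\<bar>"
  proof (cases "\<forall>i. s i \<le> 1 / 2")
    case True
    then have "(\<Sum>i\<in>UNIV. (1 - 2 * s i) * (y i)\<^sup>2) \<ge> 0"
      by (intro sum_nonneg mult_nonneg_nonneg) (auto simp: field_simps)
    moreover have "- 2 * K * \<bar>B\<bar> \<le> 0" using K0 by simp
    ultimately show ?thesis by linarith
  next
    case False
    \<comment> \<open>The numbers \<open>s i\<close> are nonnegative with sum at most
      \<open>1\<close>, so every other index has \<open>s i \<le> \<tau> < 1 / 2\<close> with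
      \<open>\<tau> = 1 - s p\<close>.\<close>
    then obtain p where p: "s p > 1 / 2" by (auto simp: not_le)
    define I where "I = UNIV - {p}"
    have split: "(\<Sum>i\<in>UNIV. g i) = g p + (\<Sum>i\<in>I. g i)" for g :: "'n \<Rightarrow> real"
      unfolding I_def by (simp add: sum.remove)
    define \<tau> where "\<tau> = 1 - s p"
    have \<tau>: "0 < \<tau>" "\<tau> < 1 / 2" using p w01[of p] by (simp_all add: \<tau>_def s_def)
    have sumI: "(\<Sum>i\<in>I. s i) \<le> \<tau>"
      using S split[of s] by (simp add: \<tau>_def s_def[symmetric])
    have sI: "s i \<le> \<tau>" if "i \<in> I" for i
      using member_le_sum[of i I s] sumI s0 that by (simp add: I_def)
    define E where "E = (\<Sum>i\<in>I. (1 - 2 * s i) * (y i)\<^sup>2)"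
    define R where "R = (\<Sum>i\<in>I. c i * y i)"
    have E0: "0 \<le> E" unfolding E_def
      using sI \<tau> by (intro sum_nonneg mult_nonneg_nonneg) (auto simp: algebra_simps, fastforce)
    \<comment> \<open>Cauchy--Schwarz with weights \<open>1 - 2 * s i\<close>. As
      \<open>(1 - s) / (1 - 2 * s)\<close> increases on \<open>[0, 1/2)\<close>, the dual sum is at
      most \<open>\<tau> * (1 - \<tau>) / (1 - 2 * \<tau>)\<close>, which is exactly
      \<open>(c p)\<^sup>2 / (2 * s p - 1)\<close>.\<close>
    have "(2 * s p - 1) * R\<^sup>2 \<le> (c p)\<^sup>2 * E"
    proof -
      have d: "0 < 1 - 2 * s i" if "i \<in> I" for i using sI[OF that] \<tau> by linarith
      have "R = (\<Sum>i\<in>I. (c i / sqrt (1 - 2 * s i)) * (sqrt (1 - 2 * s i) * y i))"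
        unfolding R_def using d by (intro sum.cong) (auto simp: less_le)
      also have "\<dots>\<^sup>2 \<le> (\<Sum>i\<in>I. (c i / sqrt (1 - 2 * s i))\<^sup>2) * (\<Sum>i\<in>I. (sqrt (1 - 2 * s i) * y i)\<^sup>2)"
        by (rule Cauchy_Schwarz_ineq_sum)
      also have "(\<Sum>i\<in>I. (sqrt (1 - 2 * s i) * y i)\<^sup>2) = E"
        unfolding E_def using d by (intro sum.cong) (auto simp: power_mult_distrib less_imp_le)
      also have "(\<Sum>i\<in>I. (c i / sqrt (1 - 2 * s i))\<^sup>2) \<le> (\<Sum>i\<in>I. s i * ((1 - \<tau>) / (1 - 2 * \<tau>)))"
      proof (rule sum_mono)
        fix i assume i: "i \<in> I"
        have "(c i / sqrt (1 - 2 * s i))\<^sup>2 = s i * ((1 - s i) / (1 - 2 * s i))"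
          using d[OF i] by (simp add: power_divide c2)
        also have "\<dots> \<le> s i * ((1 - \<tau>) / (1 - 2 * \<tau>))"
        proof (rule mult_left_mono[OF _ s0])
          have "(1 - s i) * (1 - 2 * \<tau>) \<le> (1 - \<tau>) * (1 - 2 * s i)"
            using sI[OF i] by (simp add: algebra_simps)
          then show "(1 - s i) / (1 - 2 * s i) \<le> (1 - \<tau>) / (1 - 2 * \<tau>)"
            using d[OF i] \<tau> by (simp add: divide_simps mult.commute)
        qed
        finally show "(c i / sqrt (1 - 2 * s i))\<^sup>2 \<le> s i * ((1 - \<tau>) / (1 - 2 * \<tau>))" .
      qed
      also have "\<dots> = (\<Sum>i\<in>I. s i) * ((1 - \<tau>) / (1 - 2 * \<tau>))" by (rule sum_distrib_right[symmetric])
      also have "\<dots> \<le> \<tau> * ((1 - \<tau>) / (1 - 2 * \<tau>))"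
        using sumI \<tau> by (intro mult_right_mono) auto
      also have "\<dots> = (c p)\<^sup>2 / (2 * s p - 1)"
        by (simp add: c2 \<tau>_def)
      finally have "R\<^sup>2 \<le> (c p)\<^sup>2 / (2 * s p - 1) * E"
        using E0 by (simp add: mult_right_mono)
      then show ?thesis using p by (simp add: field_simps)
    qed
    \<comment> \<open>For \<open>B = 0\<close> one has \<open>c p * y p = - R\<close> and the
      preceding bound suffices; in general the error is linear in \<open>B\<close>. From
      \<open>s p > 1 / 2\<close> follows \<open>\<kappa> p \<ge> 1\<close>, which yields the full
      factor \<open>(c p)\<^sup>2\<close> in the error and so allows its cancellation.\<close>
    moreover have "(c p)\<^sup>2 * (y p)\<^sup>2 \<le> R\<^sup>2 + 2 * \<bar>B\<bar> * ((c p)\<^sup>2 * K)"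
    proof -
      have R: "R = B - c p * y p" using split[of "\<lambda>i. c i * y i"] by (simp add: B_def R_def)
      have "(c p)\<^sup>2 * (y p)\<^sup>2 = R\<^sup>2 + 2 * B * (c p * y p) - B\<^sup>2"
        unfolding R by (simp add: power2_eq_square algebra_simps)
      also have "\<dots> \<le> R\<^sup>2 + 2 * \<bar>B\<bar> * (c p * \<bar>y p\<bar>)"
      proof -
        have "B * (c p * y p) \<le> \<bar>B * (c p * y p)\<bar>" by simp
        also have "\<dots> = \<bar>B\<bar> * (c p * \<bar>y p\<bar>)" using c0 by (simp add: abs_mult)
        finally show ?thesis using zero_le_power2[of B] by linarith
      qed
      also have "c p * \<bar>y p\<bar> \<le> (c p)\<^sup>2 * K"
      proof -
        have "1 \<le> (\<kappa> p)\<^sup>2"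
        proof (rule ccontr)
          assume "\<not> 1 \<le> (\<kappa> p)\<^sup>2"
          then have "w p * (\<kappa> p)\<^sup>2 \<le> w p * 1" using w01 by (intro mult_left_mono) (auto simp: less_imp_le)
          then show False using p sw[of p] by (simp add: s_def)
        qed
        then have \<kappa>1: "1 \<le> \<kappa> p" using \<kappa>[of p] by (metis one_le_power one_power2 power2_le_imp_le)
        have "\<bar>y p\<bar> = w p * \<bar>f p\<bar>" using w01[of p] by (simp add: y_def abs_mult)
        also have "\<dots> \<le> (w p * \<kappa> p) * K"
          using K[of p] K0 w01[of p] \<kappa>1 by (intro mult_mono) auto
        finally have "\<bar>y p\<bar> \<le> c p * K" by (simp add: c_def)
        then show ?thesis using c0[of p] by (simp add: power2_eq_square mult_left_mono mult.assoc)
      qed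
      finally show ?thesis by (simp add: mult_left_mono)
    qed
    ultimately have "(c p)\<^sup>2 * ((2 * s p - 1) * (y p)\<^sup>2) \<le> (c p)\<^sup>2 * (E + 2 * \<bar>B\<bar> * K)"
    proof -
      assume 1: "(2 * s p - 1) * R\<^sup>2 \<le> (c p)\<^sup>2 * E"
        and 2: "(c p)\<^sup>2 * (y p)\<^sup>2 \<le> R\<^sup>2 + 2 * \<bar>B\<bar> * ((c p)\<^sup>2 * K)"
      have "(2 * s p - 1) * ((c p)\<^sup>2 * (y p)\<^sup>2) \<le> (2 * s p - 1) * (R\<^sup>2 + 2 * \<bar>B\<bar> * ((c p)\<^sup>2 * K))"
        using 2 p by (intro mult_left_mono) auto
      also have "\<dots> \<le> (c p)\<^sup>2 * E + 1 * (2 * \<bar>B\<bar> * ((c p)\<^sup>2 * K))"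
        unfolding distrib_left using K0 w01[of p] by (intro add_mono 1 mult_right_mono) (auto simp: s_def)
      finally show ?thesis by (simp add: algebra_simps)
    qed
    moreover have "(c p)\<^sup>2 > 0" unfolding c2 using p \<tau> by (simp add: \<tau>_def)
    ultimately have "(2 * s p - 1) * (y p)\<^sup>2 \<le> E + 2 * \<bar>B\<bar> * K" by simp
    then show ?thesis
      using split[of "\<lambda>i. (1 - 2 * s i) * (y i)\<^sup>2"] by (simp add: E_def algebra_simps)
  qed
  then show ?thesis unfolding lhs rhs .
qed

text \<open>The nonzero vectors \<open>b l\<close> are orthonormal and span the image of
  \<open>A\<close>, so the defect in Bessel's inequality is the squared length of the component of
  \<open>v\<close> normal to that image.\<close>

lemma bessel_singular_frame:
  assumes "singular_frame A a \<kappa> b"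
  shows "v \<bullet> v - (\<Sum>l\<in>UNIV. (b l \<bullet> v)\<^sup>2) = (norm (v - (\<Sum>l\<in>UNIV. (b l \<bullet> v) *\<^sub>R b l)))\<^sup>2"
proof -
  note f = assms[unfolded singular_frame_def]
  define u where "u = (\<Sum>l\<in>UNIV. (b l \<bullet> v) *\<^sub>R b l)"
  have b0: "b l = 0" if "\<not> 0 < \<kappa> l" for l
    using f that by (metis inner_eq_zero_iff)
  have uu: "u \<bullet> u = (\<Sum>l\<in>UNIV. (b l \<bullet> v)\<^sup>2)"
  proof -
    have "u \<bullet> u = (\<Sum>l\<in>UNIV. (b l \<bullet> v) * (\<Sum>k\<in>UNIV. (b k \<bullet> v) * (b k \<bullet> b l)))"
      by (simp add: u_def inner_sum_left inner_sum_right)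
    also have "\<dots> = (\<Sum>l\<in>UNIV. (b l \<bullet> v) * (b l \<bullet> v))"
    proof (rule sum.cong[OF refl], rule arg_cong[where f = "(*) _"])
      fix l
      have "(b k \<bullet> v) * (b k \<bullet> b l) = (if k = l then b l \<bullet> v else 0)" for k
        using f b0[of l] by (cases "0 < \<kappa> l") auto
      then show "(\<Sum>k\<in>UNIV. (b k \<bullet> v) * (b k \<bullet> b l)) = b l \<bullet> v" by simp
    qed
    finally show ?thesis by (simp add: power2_eq_square)
  qed
  moreover have "v \<bullet> u = (\<Sum>l\<in>UNIV. (b l \<bullet> v)\<^sup>2)"
    by (simp add: u_def inner_sum_right power2_eq_square inner_commute)
  ultimately have "(v - u) \<bullet> (v - u) = v \<bullet> v - (\<Sum>l\<in>UNIV. (b l \<bullet> v)\<^sup>2)"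
    by (simp add: inner_diff_left inner_diff_right inner_commute)
  then show ?thesis by (simp add: u_def power2_norm_eq_inner)
qed

text \<open>Sorts the terms by sign: where the singular sum is at most \<open>1\<close>, the normal
  and the off-diagonal terms are nonnegative, and only the last sum can be negative.\<close>

lemma laplacian_split:
  fixes F :: "real^'n \<Rightarrow> real^'m"
  assumes D: "open D" "x \<in> D" and sm: "smooth_on D F" and min: "minimal_graph_on D F"
    and fr: "singular_frame (jacobian F (at x)) a \<kappa> b"
  defines "w \<equiv> \<lambda>i. 1 / (1 + (\<kappa> i)\<^sup>2)"
    and "H \<equiv> \<lambda>i k. dderiv (a k) (dderiv (a i) F) x"
  shows "(\<Sum>k\<in>UNIV. w k * dderiv (a k) (dderiv (a k) (singular_sum F)) x) =
    2 * (\<Sum>k\<in>UNIV. w k * (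
      (\<Sum>i\<in>UNIV. (w i)\<^sup>2 * (norm (H i k - (\<Sum>l\<in>UNIV. (b l \<bullet> H i k) *\<^sub>R b l)))\<^sup>2) +
      (\<Sum>i\<in>UNIV. \<Sum>l\<in>UNIV - {i}. w i * w l * (w i + w l - 1) * (b l \<bullet> H i k)\<^sup>2) +
      (\<Sum>i\<in>UNIV. w i * w i * (w i + w i - 1) * (b i \<bullet> H i k)\<^sup>2)))"
proof -
  have split: "(\<Sum>l\<in>UNIV. w i * w l * (w i + w l - 1) * (b l \<bullet> H i k)\<^sup>2) =
      (\<Sum>l\<in>UNIV - {i}. w i * w l * (w i + w l - 1) * (b l \<bullet> H i k)\<^sup>2) +
      w i * w i * (w i + w i - 1) * (b i \<bullet> H i k)\<^sup>2" for i k
    by (subst sum.remove[of _ i]) simp_all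
  have "(\<Sum>i\<in>UNIV. w k * ((w i)\<^sup>2 * (H i k \<bullet> H i k - (\<Sum>l\<in>UNIV. (b l \<bullet> H i k)\<^sup>2)) +
      (\<Sum>l\<in>UNIV. w i * w l * (w i + w l - 1) * (b l \<bullet> H i k)\<^sup>2))) = 
      w k * ((\<Sum>i\<in>UNIV. (w i)\<^sup>2 * (norm (H i k - (\<Sum>l\<in>UNIV. (b l \<bullet> H i k) *\<^sub>R b l)))\<^sup>2) +
      (\<Sum>i\<in>UNIV. \<Sum>l\<in>UNIV - {i}. w i * w l * (w i + w l - 1) * (b l \<bullet> H i k)\<^sup>2) +
      (\<Sum>i\<in>UNIV. w i * w i * (w i + w i - 1) * (b i \<bullet> H i k)\<^sup>2))" for k
    unfolding bessel_singular_frame[OF fr] sum_distrib_left[symmetric]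
    by (simp only: split sum.distrib add.assoc)
  then show ?thesis
    using laplacian_singular_sum[OF D sm min fr] unfolding w_def H_def by (simp only:)
qed

text \<open>The coefficient is \<open>1 - s\<^sub>i - s\<^sub>l\<close>; two distinct summands of
  the singular sum cannot exceed the total, since the others are nonnegative.\<close>

lemma off_diagonal_coefficient_bounds:
  assumes fr: "singular_frame (jacobian F (at x)) a \<kappa> b" and S: "singular_sum F x \<le> 1"
  shows "(\<Sum>i\<in>UNIV. 1 - 1 / (1 + (\<kappa> i)\<^sup>2)) \<le> 1"
    and "l \<noteq> i \<Longrightarrow> 0 \<le> 1 / (1 + (\<kappa> i)\<^sup>2) + 1 / (1 + (\<kappa> l)\<^sup>2) - 1"
proof -
  define s where "s i = 1 - 1 / (1 + (\<kappa> i)\<^sup>2)" for i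
  have eq: "s i = (\<kappa> i)\<^sup>2 / (1 + (\<kappa> i)\<^sup>2)" for i
    by (simp add: s_def field_simps add_nonneg_eq_0_iff)
  show le: "(\<Sum>i\<in>UNIV. 1 - 1 / (1 + (\<kappa> i)\<^sup>2)) \<le> 1"
    using S unfolding singular_sum_frame[OF fr] eq[symmetric] s_def .
  assume "l \<noteq> i"
  then have "s l + s i = sum s {l, i}" by simp
  also have "\<dots> \<le> sum s UNIV"
    by (rule sum_mono2) (auto simp: eq)
  finally show "0 \<le> 1 / (1 + (\<kappa> i)\<^sup>2) + 1 / (1 + (\<kappa> l)\<^sup>2) - 1"
    using le by (simp add: s_def)
qed

lemma singular_frame_norm_le:
  assumes "singular_frame A a \<kappa> b"
  shows "norm (b l) \<le> 1"
  using assms unfolding singular_frame_def norm_eq_sqrt_inner by auto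

text \<open>For each fixed \<open>k\<close> the diagonal terms are bounded below through the
  derivative of the singular sum along \<open>a k\<close>; all other terms are dropped as
  nonnegative.\<close>

lemma singular_sum_subharmonic:
  fixes F :: "real^'n \<Rightarrow> real^'m"
  assumes D: "open D" "x \<in> D" and sm: "smooth_on D F" and min: "minimal_graph_on D F"
    and fr: "singular_frame (jacobian F (at x)) a \<kappa> b" and S: "singular_sum F x \<le> 1"
    and K: "\<And>i k. norm (dderiv (a k) (dderiv (a i) F) x) \<le> K"
  defines "w \<equiv> \<lambda>i. 1 / (1 + (\<kappa> i)\<^sup>2)"
  shows "(\<Sum>k\<in>UNIV. w k * dderiv (a k) (dderiv (a k) (singular_sum F)) x) \<ge>
    - 2 * K * (\<Sum>k\<in>UNIV. w k * \<bar>dderiv (a k) (singular_sum F) x\<bar>)"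
proof -
  define H where "H i k = dderiv (a k) (dderiv (a i) F) x" for i k
  have w01: "0 < w i" for i
    unfolding w_def by (simp add: add_pos_nonneg)
  have diag: "(\<Sum>i\<in>UNIV. w i * w i * (w i + w i - 1) * (b i \<bullet> H i k)\<^sup>2) \<ge>
      - K * \<bar>dderiv (a k) (singular_sum F) x\<bar>" for k
  proof -
    have "(\<Sum>i\<in>UNIV. w i * w i * (w i + w i - 1) * (b i \<bullet> H i k)\<^sup>2) \<ge>
        - 2 * K * \<bar>\<Sum>i\<in>UNIV. (w i)\<^sup>2 * \<kappa> i * (b i \<bullet> H i k)\<bar>"
    proof (rule diagonal_terms_lower_bound)
      show "\<bar>b i \<bullet> H i k\<bar> \<le> K" for i
        using Cauchy_Schwarz_ineq2[of "b i" "H i k"] singular_frame_norm_le[OF fr, of i] K[of k i]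
          mult_mono[of "norm (b i)" 1 "norm (H i k)" K] by (simp add: H_def)
    qed (use fr off_diagonal_coefficient_bounds(1)[OF fr S] in \<open>auto simp: singular_frame_def w_def\<close>)
    then show ?thesis
      unfolding singular_sum_dderivs(1)[OF D sm fr] H_def w_def by (simp add: abs_mult)
  qed
  have "- 2 * K * (\<Sum>k\<in>UNIV. w k * \<bar>dderiv (a k) (singular_sum F) x\<bar>) =
      2 * (\<Sum>k\<in>UNIV. w k * (- K * \<bar>dderiv (a k) (singular_sum F) x\<bar>))"
    by (simp add: sum_distrib_left sum_negf mult_ac)
  also have "\<dots> \<le> 2 * (\<Sum>k\<in>UNIV. w k * (
      (\<Sum>i\<in>UNIV. (w i)\<^sup>2 * (norm (H i k - (\<Sum>l\<in>UNIV. (b l \<bullet> H i k) *\<^sub>R b l)))\<^sup>2) +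
      (\<Sum>i\<in>UNIV. \<Sum>l\<in>UNIV - {i}. w i * w l * (w i + w l - 1) * (b l \<bullet> H i k)\<^sup>2) +
      (\<Sum>i\<in>UNIV. w i * w i * (w i + w i - 1) * (b i \<bullet> H i k)\<^sup>2)))"
  proof (intro mult_left_mono sum_mono)
    fix k
    have "0 \<le> (\<Sum>i\<in>UNIV. (w i)\<^sup>2 * (norm (H i k - (\<Sum>l\<in>UNIV. (b l \<bullet> H i k) *\<^sub>R b l)))\<^sup>2)"
      by (intro sum_nonneg) simp
    moreover have "0 \<le> (\<Sum>i\<in>UNIV. \<Sum>l\<in>UNIV - {i}. w i * w l * (w i + w l - 1) * (b l \<bullet> H i k)\<^sup>2)"
      using w01 off_diagonal_coefficient_bounds(2)[OF fr S]
      by (intro sum_nonneg mult_nonneg_nonneg) (auto simp: w_def less_imp_le)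
    ultimately show "- K * \<bar>dderiv (a k) (singular_sum F) x\<bar> \<le>
      (\<Sum>i\<in>UNIV. (w i)\<^sup>2 * (norm (H i k - (\<Sum>l\<in>UNIV. (b l \<bullet> H i k) *\<^sub>R b l)))\<^sup>2) +
      (\<Sum>i\<in>UNIV. \<Sum>l\<in>UNIV - {i}. w i * w l * (w i + w l - 1) * (b l \<bullet> H i k)\<^sup>2) +
      (\<Sum>i\<in>UNIV. w i * w i * (w i + w i - 1) * (b i \<bullet> H i k)\<^sup>2)"
      using diag[of k] by linarith
  qed (use w01 in \<open>auto simp: less_imp_le\<close>)
  also have "\<dots> = (\<Sum>k\<in>UNIV. w k * dderiv (a k) (dderiv (a k) (singular_sum F)) x)"
    using laplacian_split[OF D sm min fr] unfolding H_def w_def by simp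
  finally show ?thesis .
qed

text \<open>The Laplacian is now \<open>0\<close>, and so is the gradient, hence the error in the
  diagonal estimate. Sums of nonnegative terms with positive weights that add up to \<open>0\<close>
  vanish termwise.\<close>

lemma singular_sum_constant_rigidity:
  fixes F :: "real^'n \<Rightarrow> real^'m"
  assumes D: "open D" "x \<in> D" and sm: "smooth_on D F" and min: "minimal_graph_on D F"
    and fr: "singular_frame (jacobian F (at x)) a \<kappa> b" and S: "\<And>y. y \<in> D \<Longrightarrow> singular_sum F y = 1"
  defines "w \<equiv> \<lambda>i. 1 / (1 + (\<kappa> i)\<^sup>2)"
    and "H \<equiv> \<lambda>i k. dderiv (a k) (dderiv (a i) F) x"
  shows "H i k = (\<Sum>l\<in>UNIV. (b l \<bullet> H i k) *\<^sub>R b l)"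
    and "l \<noteq> i \<Longrightarrow> w i + w l \<noteq> 1 \<Longrightarrow> b l \<bullet> H i k = 0"
proof -
  have w01: "0 < w i" for i
    unfolding w_def by (simp add: add_pos_nonneg)
  have const: "dderiv v g y = 0" if "y \<in> D" "\<And>z. z \<in> D \<Longrightarrow> g z = c" for v y c and g :: "real^'n \<Rightarrow> real"
  proof -
    have "(g has_derivative (\<lambda>h. 0)) (at y)"
      by (rule has_derivative_transform_within_open[OF has_derivative_const D(1)]) (use that in auto)
    then show ?thesis by (rule dderiv_unique)
  qed
  have S1: "dderiv v (singular_sum F) y = 0" if "y \<in> D" for v y
    using const[OF that S] .
  have S2: "dderiv v (dderiv v (singular_sum F)) x = 0" for v
    using const[OF D(2) S1] .
  have x1: "singular_sum F x \<le> 1" using S[OF D(2)] by simp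
  define P where "P k = (\<Sum>i\<in>UNIV. (w i)\<^sup>2 * (norm (H i k - (\<Sum>l\<in>UNIV. (b l \<bullet> H i k) *\<^sub>R b l)))\<^sup>2)" for k
  define R where "R k = (\<Sum>i\<in>UNIV. \<Sum>l\<in>UNIV - {i}. w i * w l * (w i + w l - 1) * (b l \<bullet> H i k)\<^sup>2)" for k
  define T where "T k = (\<Sum>i\<in>UNIV. w i * w i * (w i + w i - 1) * (b i \<bullet> H i k)\<^sup>2)" for k
  have P0: "0 \<le> P k" for k unfolding P_def by (intro sum_nonneg) simp
  have offd: "0 \<le> w i * w l * (w i + w l - 1) * (b l \<bullet> H i k)\<^sup>2" if "l \<noteq> i" for i l k
    using w01 off_diagonal_coefficient_bounds(2)[OF fr x1 that]
    by (intro mult_nonneg_nonneg) (auto simp: w_def less_imp_le)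
  have R0: "0 \<le> R k" for k
    unfolding R_def by (intro sum_nonneg offd) auto
  have T0: "0 \<le> T k" for k
  proof -
    \<comment> \<open>Any finite bound serves here, since it is multiplied by the vanishing
      gradient.\<close>
    define K where "K = Max (range (\<lambda>i. \<bar>b i \<bullet> H i k\<bar>))"
    have "T k \<ge> - 2 * K * \<bar>\<Sum>i\<in>UNIV. (w i)\<^sup>2 * \<kappa> i * (b i \<bullet> H i k)\<bar>"
      unfolding T_def
      by (rule diagonal_terms_lower_bound)
        (use fr off_diagonal_coefficient_bounds(1)[OF fr x1] in \<open>auto simp: singular_frame_def w_def K_def\<close>)
    moreover have "(\<Sum>i\<in>UNIV. (w i)\<^sup>2 * \<kappa> i * (b i \<bullet> H i k)) = 0"
      using S1[OF D(2)] singular_sum_dderivs(1)[OF D sm fr, of "a k"] unfolding H_def w_def by simp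
    ultimately show ?thesis by simp
  qed
  have "(\<Sum>k\<in>UNIV. w k * (P k + R k + T k)) = 0"
    using laplacian_split[OF D sm min fr]
    unfolding P_def R_def T_def H_def w_def S2 by simp
  then have "w k * (P k + R k + T k) = 0" for k
    using w01 P0 R0 T0 by (subst (asm) sum_nonneg_eq_0_iff) (auto intro!: mult_nonneg_nonneg add_nonneg_nonneg simp: less_imp_le)
  then have "P k + R k + T k = 0" for k using w01[of k] by (metis less_irrefl mult_eq_0_iff)
  then have PR: "P k = 0" "R k = 0" for k
    using P0[of k] R0[of k] T0[of k] by (metis add_nonneg_eq_0_iff add_nonneg_nonneg)+
  have "(w i)\<^sup>2 * (norm (H i k - (\<Sum>l\<in>UNIV. (b l \<bullet> H i k) *\<^sub>R b l)))\<^sup>2 = 0"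
    using PR(1)[of k] unfolding P_def by (subst (asm) sum_nonneg_eq_0_iff) auto
  then show "H i k = (\<Sum>l\<in>UNIV. (b l \<bullet> H i k) *\<^sub>R b l)"
    using w01[of i] by simp
  assume li: "l \<noteq> i" "w i + w l \<noteq> 1"
  have "(\<Sum>l\<in>UNIV - {i}. w i * w l * (w i + w l - 1) * (b l \<bullet> H i k)\<^sup>2) = 0"
    using PR(2)[of k] unfolding R_def by (subst (asm) sum_nonneg_eq_0_iff) (auto intro!: sum_nonneg offd)
  then have "w i * w l * (w i + w l - 1) * (b l \<bullet> H i k)\<^sup>2 = 0"
    using li(1) by (subst (asm) sum_nonneg_eq_0_iff) (auto intro!: offd)
  then show "b l \<bullet> H i k = 0"
    using w01[of i] w01[of l] li(2) by simp
qed

section \<open>The strong maximum principle\<close>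

text \<open>The second derivative exists at \<open>x\<close> alone. Were it positive, the first
  derivative along the line would be positive just to the right of \<open>0\<close>, and the mean
  value theorem would produce a larger value of \<open>f\<close>.\<close>

lemma interior_max_line_derivatives:
  fixes f :: "'a::real_normed_vector \<Rightarrow> real"
  assumes U: "open U" "x \<in> U" and f: "\<And>y. y \<in> U \<Longrightarrow> f differentiable (at y)"
    and f2: "dderiv v f differentiable (at x)" and max: "\<And>y. y \<in> U \<Longrightarrow> f y \<le> f x"
  shows "dderiv v f x = 0" and "dderiv v (dderiv v f) x \<le> 0"
proof -
  obtain d where d: "d > 0" "\<And>t. \<bar>t\<bar> < d \<Longrightarrow> x + t *\<^sub>R v \<in> U"
    using open_line_eventually[OF U, of v] unfolding eventually_nhds_metric by (auto simp: dist_real_def)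
  define g where "g t = f (x + t *\<^sub>R v)" for t
  define \<psi> where "\<psi> t = dderiv v f (x + t *\<^sub>R v)" for t
  have g: "(g has_real_derivative \<psi> t) (at t)" if "\<bar>t\<bar> < d" for t
    unfolding g_def \<psi>_def has_real_derivative_iff_has_vector_derivative
    by (rule has_derivative_line[OF f[OF d(2)[OF that]]])
  have "\<psi> 0 = 0"
    by (rule DERIV_local_max[OF g d(1)]) (use d max in \<open>auto simp: g_def\<close>)
  then show "dderiv v f x = 0" by (simp add: \<psi>_def)
  have \<psi>: "(\<psi> has_real_derivative dderiv v (dderiv v f) x) (at 0)"
    unfolding \<psi>_def has_real_derivative_iff_has_vector_derivative
    using has_derivative_line[of "dderiv v f" x 0 v] f2 by simp
  show "dderiv v (dderiv v f) x \<le> 0"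
  proof (rule ccontr)
    assume "\<not> dderiv v (dderiv v f) x \<le> 0"
    then obtain e where e: "e > 0" "\<And>h. 0 < h \<Longrightarrow> h < e \<Longrightarrow> \<psi> 0 < \<psi> (0 + h)"
      using DERIV_pos_inc_right[OF \<psi>] by auto
    define h where "h = min d e / 2"
    have h: "0 < h" "h < d" "h < e" using d e by (auto simp: h_def min_def)
    obtain t where t: "0 < t" "t < h" "g h - g 0 = (h - 0) * \<psi> t"
      using MVT2[of 0 h g \<psi>] h g by (auto simp: abs_less_iff)
    have "\<psi> t > 0" using e(2)[of t] t h \<open>\<psi> 0 = 0\<close> by simp
    then have "g h > g 0" using t h by (metis diff_gt_0_iff_gt diff_zero mult_pos_pos)
    moreover have "g h \<le> g 0" using max d(2)[of h] h by (simp add: g_def)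
    ultimately show False by simp
  qed
qed

text \<open>Hopf's barrier: for large \<open>\<alpha>\<close> and away from \<open>z\<close>, the
  term with \<open>\<alpha>\<^sup>2\<close> dominates all others.\<close>

lemma dderiv_gaussian:
  fixes z :: "'a::real_inner" and \<alpha> :: real
  defines "g \<equiv> \<lambda>y. exp (- \<alpha> * ((y - z) \<bullet> (y - z)))"
  shows "g differentiable (at y)" "dderiv u g differentiable (at y)"
    and "dderiv u g y = - 2 * \<alpha> * ((y - z) \<bullet> u) * g y"
    and "dderiv u (dderiv u g) y = (4 * \<alpha>\<^sup>2 * ((y - z) \<bullet> u)\<^sup>2 - 2 * \<alpha> * (u \<bullet> u)) * g y"
proof -
  have d: "(g has_derivative (\<lambda>h. - 2 * \<alpha> * ((y - z) \<bullet> h) * g y)) (at y)" for y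
    unfolding g_def by (auto intro!: derivative_eq_intros simp: inner_commute algebra_simps)
  show "g differentiable (at y)" using d unfolding differentiable_def by blast
  have 1: "dderiv u g y = - 2 * \<alpha> * ((y - z) \<bullet> u) * g y" for y
    using dderiv_unique[OF d] .
  show "dderiv u g y = - 2 * \<alpha> * ((y - z) \<bullet> u) * g y" by (rule 1)
  have e: "dderiv u g = (\<lambda>y. - 2 * \<alpha> * ((y - z) \<bullet> u) * g y)" by (rule ext) (rule 1)
  have d2: "(dderiv u g has_derivative (\<lambda>h. - 2 * \<alpha> * ((y - z) \<bullet> u) * (- 2 * \<alpha> * ((y - z) \<bullet> h) * g y) +
      - 2 * \<alpha> * (h \<bullet> u) * g y)) (at y)"
    unfolding e by (rule derivative_eq_intros d refl | simp)+
  then show "dderiv u g differentiable (at y)" unfolding differentiable_def by blast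
  show "dderiv u (dderiv u g) y = (4 * \<alpha>\<^sup>2 * ((y - z) \<bullet> u)\<^sup>2 - 2 * \<alpha> * (u \<bullet> u)) * g y"
    using dderiv_unique[OF d2, of u] by (simp add: power2_eq_square algebra_simps)
qed

lemma singular_sum_differentiable:
  fixes F :: "real^'n \<Rightarrow> real^'m"
  assumes "open D" "smooth_on D F" "x \<in> D"
  shows "singular_sum F differentiable (at x)"
  using has_derivative_singular_sum[OF assms(1,3,2) orthonormal_axis] unfolding differentiable_def by blast

lemma continuous_on_singular_sum:
  fixes F :: "real^'n \<Rightarrow> real^'m"
  assumes "open D" "smooth_on D F"
  shows "continuous_on D (singular_sum F)"
  using singular_sum_differentiable[OF assms] assms(1)
  by (simp add: continuous_on_eq_continuous_at differentiable_imp_continuous_within)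

text \<open>At an interior maximum the derivatives of the singular sum are controlled by those of
  the barrier. Inserted into \<open>singular_sum_subharmonic\<close> they share the factor
  \<open>2 * \<alpha> * \<epsilon> * g p\<close>; dividing by it leaves a bound on
  \<open>\<alpha>\<close> without \<open>\<epsilon>\<close>, so a large \<open>\<alpha>\<close>
  rules out such maxima.\<close>

lemma barrier_no_interior_max:
  fixes F :: "real^'n \<Rightarrow> real^'m"
  assumes D: "open D" "p \<in> D" and sm: "smooth_on D F" and min: "minimal_graph_on D F"
    and S: "singular_sum F p \<le> 1"
    and U: "open U" "p \<in> U" "U \<subseteq> D" and "\<epsilon> > 0" and "\<alpha> > 0"
    and max: "\<And>y. y \<in> U \<Longrightarrow> singular_sum F y + \<epsilon> * exp (- \<alpha> * ((y - z) \<bullet> (y - z))) \<le>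
      singular_sum F p + \<epsilon> * exp (- \<alpha> * ((p - z) \<bullet> (p - z)))"
    and K: "\<And>u v. norm u = 1 \<Longrightarrow> norm v = 1 \<Longrightarrow> norm (dderiv u (dderiv v F) p) \<le> K"
    and \<Lambda>: "\<And>u. norm u = 1 \<Longrightarrow> norm (dderiv u F p) \<le> \<Lambda>"
    and \<rho>: "0 \<le> \<rho>" "\<rho> \<le> norm (p - z)" "norm (p - z) \<le> R"
  shows "2 * \<alpha> * \<rho>\<^sup>2 / (1 + \<Lambda>\<^sup>2) \<le> real CARD('n) * (1 + 2 * K * R)"
proof -
  obtain a \<kappa> b where fr: "singular_frame (jacobian F (at p)) a \<kappa> b"
    using singular_frame_exists by blast
  note f = fr[unfolded singular_frame_def]
  have a: "orthonormal a" using f by blast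
  have a1: "norm (a i) = 1" for i by (rule orthonormal_norm[OF a])
  define w where "w i = 1 / (1 + (\<kappa> i)\<^sup>2)" for i
  have w01: "0 < w i" "w i \<le> 1" for i
    unfolding w_def by (simp_all add: add_pos_nonneg field_simps)
  \<comment> \<open>Ellipticity: \<open>\<kappa> i\<close> is the length of
    \<open>dderiv (a i) F p\<close>, so \<open>\<Lambda>\<close> bounds the weights away from
    \<open>0\<close>.\<close>
  have w\<Lambda>: "1 / (1 + \<Lambda>\<^sup>2) \<le> w i" for i
  proof -
    have "(norm (dderiv (a i) F p))\<^sup>2 = (\<kappa> i)\<^sup>2"
      using f unfolding frame_inverse_singular_frame(1)[OF smooth_on_differentiable[OF sm D(2)] fr] power2_norm_eq_inner
      by (auto simp: power2_eq_square order_le_less)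
    then have "(\<kappa> i)\<^sup>2 \<le> \<Lambda>\<^sup>2"
      using power_mono[OF \<Lambda>[OF a1[of i]], of 2] by simp
    then show ?thesis unfolding w_def by (intro divide_left_mono) (auto intro!: add_pos_nonneg mult_pos_pos)
  qed
  have K0: "0 \<le> K" using K[OF a1 a1, of undefined undefined] by (meson norm_ge_zero order_trans)
  define g where "g y = exp (- \<alpha> * ((y - z) \<bullet> (y - z)))" for y
  note g = dderiv_gaussian[where z = z and \<alpha> = \<alpha>, folded g_def]
  define y where "y k = (p - z) \<bullet> a k" for k
  have yR: "\<bar>y k\<bar> \<le> R" for k
    using Cauchy_Schwarz_ineq2[of "p - z" "a k"] a1[of k] \<rho>(3) by (simp add: y_def)
  have R0: "0 \<le> R" using \<rho> by linarith
  have g0: "g p > 0" by (simp add: g_def)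
  have d1: "((\<lambda>y. singular_sum F y + \<epsilon> * g y) has_derivative
      (\<lambda>h. dderiv h (singular_sum F) q + \<epsilon> * dderiv h g q)) (at q)" if "q \<in> D" for q
    by (intro has_derivative_add has_derivative_mult_right has_derivative_dderiv
        singular_sum_differentiable[OF D(1) sm that] g)
  have e1: "dderiv v (\<lambda>y. singular_sum F y + \<epsilon> * g y) q = dderiv v (singular_sum F) q + \<epsilon> * dderiv v g q"
    if "q \<in> D" for v q using dderiv_unique[OF d1[OF that]] .
  have d2: "(dderiv v (\<lambda>y. singular_sum F y + \<epsilon> * g y) has_derivative
      (\<lambda>h. dderiv h (dderiv v (singular_sum F)) p + \<epsilon> * dderiv h (dderiv v g) p)) (at p)" for v
  proof -
    have "((\<lambda>y. dderiv v (singular_sum F) y + \<epsilon> * dderiv v g y) has_derivative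
      (\<lambda>h. dderiv h (dderiv v (singular_sum F)) p + \<epsilon> * dderiv h (dderiv v g) p)) (at p)"
      by (intro has_derivative_add has_derivative_mult_right has_derivative_dderiv
        singular_sum_dderivs(2)[OF D sm fr] g)
    then show ?thesis
      by (rule has_derivative_transform_within_open[OF _ D]) (simp add: e1)
  qed
  have dif: "(\<lambda>y. singular_sum F y + \<epsilon> * g y) differentiable (at q)" if "q \<in> U" for q
    using d1 U(3) that unfolding differentiable_def by blast
  have dif2: "dderiv v (\<lambda>y. singular_sum F y + \<epsilon> * g y) differentiable (at p)" for v
    using d2 unfolding differentiable_def by blast
  note mx = interior_max_line_derivatives[OF U(1,2) dif dif2 max[folded g_def]]
  have S1: "dderiv (a k) (singular_sum F) p = \<epsilon> * (2 * \<alpha> * y k * g p)" for k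
    using mx(1)[of "a k"] unfolding e1[OF D(2)] g(3) y_def by simp
  have S2: "dderiv (a k) (dderiv (a k) (singular_sum F)) p \<le> - \<epsilon> * ((4 * \<alpha>\<^sup>2 * (y k)\<^sup>2 - 2 * \<alpha>) * g p)" for k
    using mx(2)[of "a k"] unfolding dderiv_unique[OF d2] g(4) y_def
    by (simp add: power2_norm_eq_inner[symmetric] a1)
  define C where "C = 2 * \<alpha> * \<epsilon> * g p"
  have C: "C > 0" using \<open>\<alpha> > 0\<close> \<open>\<epsilon> > 0\<close> g0 by (simp add: C_def)
  have "- 2 * K * (\<Sum>k\<in>UNIV. w k * (C * \<bar>y k\<bar>)) \<le> (\<Sum>k\<in>UNIV. w k * dderiv (a k) (dderiv (a k) (singular_sum F)) p)"
  proof -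
    have "\<bar>dderiv (a k) (singular_sum F) p\<bar> = C * \<bar>y k\<bar>" for k
      using \<open>\<alpha> > 0\<close> \<open>\<epsilon> > 0\<close> g0 by (simp add: S1 C_def abs_mult)
    then show ?thesis
      using singular_sum_subharmonic[OF D sm min fr S, of K] K a1 unfolding w_def by simp
  qed
  also have "\<dots> \<le> (\<Sum>k\<in>UNIV. w k * (C * (1 - 2 * \<alpha> * (y k)\<^sup>2)))"
    using S2 w01 by (intro sum_mono mult_left_mono) (auto simp: C_def less_imp_le power2_eq_square algebra_simps)
  finally have "0 \<le> (\<Sum>k\<in>UNIV. w k * (C * (1 - 2 * \<alpha> * (y k)\<^sup>2))) + 2 * K * (\<Sum>k\<in>UNIV. w k * (C * \<bar>y k\<bar>))"
    by linarith
  also have "\<dots> = C * (\<Sum>k\<in>UNIV. w k * (1 + 2 * K * \<bar>y k\<bar>) - 2 * \<alpha> * (w k * (y k)\<^sup>2))"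
    by (simp add: sum_distrib_left sum.distrib[symmetric] algebra_simps)
  finally have "0 \<le> (\<Sum>k\<in>UNIV. w k * (1 + 2 * K * \<bar>y k\<bar>) - 2 * \<alpha> * (w k * (y k)\<^sup>2))"
    using C by (simp add: zero_le_mult_iff)
  then have "2 * \<alpha> * (\<Sum>k\<in>UNIV. w k * (y k)\<^sup>2) \<le> (\<Sum>k\<in>UNIV. w k * (1 + 2 * K * \<bar>y k\<bar>))"
    by (simp add: sum_subtractf sum_distrib_left)
  also have "\<dots> \<le> (\<Sum>k\<in>(UNIV::'n set). 1 * (1 + 2 * K * R))"
    using w01 yR K0 R0 by (intro sum_mono mult_mono add_mono mult_left_mono) (auto simp: less_imp_le)
  also have "\<dots> = real CARD('n) * (1 + 2 * K * R)" by simp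
  also have "2 * \<alpha> * \<rho>\<^sup>2 / (1 + \<Lambda>\<^sup>2) \<le> 2 * \<alpha> * (\<Sum>k\<in>UNIV. w k * (y k)\<^sup>2)"
  proof -
    have "\<rho>\<^sup>2 / (1 + \<Lambda>\<^sup>2) \<le> (norm (p - z))\<^sup>2 * (1 / (1 + \<Lambda>\<^sup>2))"
      using \<rho> power_mono[of \<rho> "norm (p - z)" 2] by (simp add: divide_right_mono)
    also have "\<dots> = (\<Sum>k\<in>UNIV. (1 / (1 + \<Lambda>\<^sup>2)) * (y k)\<^sup>2)"
    proof -
      have "(norm (p - z))\<^sup>2 = (\<Sum>k\<in>UNIV. (y k)\<^sup>2)"
        unfolding power2_norm_eq_inner by (subst orthonormal_parseval[OF a]) (simp add: y_def power2_eq_square)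
      then show ?thesis by (simp add: sum_distrib_right sum_divide_distrib)
    qed
    also have "\<dots> \<le> (\<Sum>k\<in>UNIV. w k * (y k)\<^sup>2)"
      by (intro sum_mono mult_right_mono w\<Lambda>) auto
    finally have "2 * \<alpha> * (\<rho>\<^sup>2 / (1 + \<Lambda>\<^sup>2)) \<le> 2 * \<alpha> * (\<Sum>k\<in>UNIV. w k * (y k)\<^sup>2)"
      using \<open>\<alpha> > 0\<close> by (intro mult_left_mono) auto
    then show ?thesis by simp
  qed
  finally show ?thesis by simp
qed

text \<open>All unit directions are covered at once because the singular frame to which the bound is
  applied varies with the point.\<close>

lemma dderiv_bounded_on_compact:
  fixes F :: "real^'n \<Rightarrow> real^'m"
  assumes C: "compact C" "C \<subseteq> D" and sm: "smooth_on D F"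
  shows "\<exists>\<Lambda>. \<forall>x\<in>C. \<forall>u. norm u = 1 \<longrightarrow> norm (dderiv u F x) \<le> \<Lambda>"
proof -
  have "\<exists>B. \<forall>x\<in>C. norm (dderiv (axis i 1) F x) \<le> B" for i
  proof -
    have "compact ((\<lambda>x. dderiv (axis i 1) F x) ` C)"
      using C smooth_on_continuous[OF smooth_on_dderiv[OF sm]]
      by (intro compact_continuous_image) (auto intro: continuous_on_subset)
    then show ?thesis using compact_imp_bounded bounded_iff by (metis imageI)
  qed
  then obtain B where B: "\<And>i x. x \<in> C \<Longrightarrow> norm (dderiv (axis i 1) F x) \<le> B i" by metis
  have "norm (dderiv u F x) \<le> (\<Sum>i\<in>UNIV. B i)" if x: "x \<in> C" and u: "norm u = 1" for x u
  proof -
    have lin: "linear (\<lambda>v. dderiv v F x)"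
      using x C by (intro linear_dderiv smooth_on_differentiable[OF sm]) auto
    have "norm (dderiv u F x) = norm (\<Sum>i\<in>UNIV. (u \<bullet> axis i 1) *\<^sub>R dderiv (axis i 1) F x)"
      by (subst orthonormal_expansion[OF orthonormal_axis, of u])
        (simp add: linear_sum[OF lin] linear_scale[OF lin])
    also have "\<dots> \<le> (\<Sum>i\<in>UNIV. 1 * B i)"
    proof (rule sum_norm_le)
      fix i
      show "norm ((u \<bullet> axis i 1) *\<^sub>R dderiv (axis i 1) F x) \<le> 1 * B i"
        unfolding norm_scaleR using u B[OF x, of i] Cauchy_Schwarz_ineq2[of u "axis i 1"]
        by (intro mult_mono) auto
    qed
    finally show ?thesis by simp
  qed
  then show ?thesis by blast
qed

lemma dderiv2_bounded_on_compact:
  fixes F :: "real^'n \<Rightarrow> real^'m"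
  assumes C: "compact C" "C \<subseteq> D" and D: "open D" and sm: "smooth_on D F"
  shows "\<exists>K. \<forall>x\<in>C. \<forall>u v. norm u = 1 \<longrightarrow> norm v = 1 \<longrightarrow> norm (dderiv u (dderiv v F) x) \<le> K"
proof -
  have "\<exists>B. \<forall>x\<in>C. \<forall>u. norm u = 1 \<longrightarrow> norm (dderiv u (dderiv (axis i 1) F) x) \<le> B" for i
    by (rule dderiv_bounded_on_compact[OF C smooth_on_dderiv[OF sm]])
  then obtain B where B: "\<And>i x u. x \<in> C \<Longrightarrow> norm u = 1 \<Longrightarrow> norm (dderiv u (dderiv (axis i 1) F) x) \<le> B i"
    by metis
  have "norm (dderiv u (dderiv v F) x) \<le> (\<Sum>i\<in>UNIV. B i)" if x: "x \<in> C" and u: "norm u = 1" "norm v = 1" for x u v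
  proof -
    have "norm (dderiv u (dderiv v F) x) = norm (\<Sum>j\<in>UNIV. (v \<bullet> axis j 1) *\<^sub>R dderiv u (dderiv (axis j 1) F) x)"
      using dderiv_dderiv_sum[OF D _ sm, of x "{()}" "UNIV" "\<lambda>_. 1" "\<lambda>_. u" "\<lambda>j. v \<bullet> axis j 1" "\<lambda>j. axis j 1"]
        x C orthonormal_expansion[OF orthonormal_axis, of v] by auto
    also have "\<dots> \<le> (\<Sum>i\<in>UNIV. 1 * B i)"
    proof (rule sum_norm_le)
      fix i
      show "norm ((v \<bullet> axis i 1) *\<^sub>R dderiv u (dderiv (axis i 1) F) x) \<le> 1 * B i"
        unfolding norm_scaleR using u B[OF x u(1), of i] Cauchy_Schwarz_ineq2[of v "axis i 1"]
        by (intro mult_mono) auto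
    qed
    finally show ?thesis by simp
  qed
  then show ?thesis by blast
qed

text \<open>Hopf's argument shows that the relatively closed contact set \<open>E\<close> is open.
  Otherwise some ball free of contact inside touches \<open>E\<close> at a point \<open>q'\<close>,
  and adding a small barrier to the singular sum creates an interior maximum near \<open>q'\<close>,
  which \<open>barrier_no_interior_max\<close> excludes.\<close>

lemma singular_sum_strong_maximum:
  fixes F :: "real^'n \<Rightarrow> real^'m"
  assumes D: "open D" "connected D" and sm: "smooth_on D F" and min: "minimal_graph_on D F"
    and le: "\<And>x. x \<in> D \<Longrightarrow> singular_sum F x \<le> 1"
    and x0: "x0 \<in> D" "singular_sum F x0 = 1"
  shows "\<forall>x\<in>D. singular_sum F x = 1"
proof -
  define E where "E = {x \<in> D. singular_sum F x = 1}"
  have cont: "continuous_on D (singular_sum F)" by (rule continuous_on_singular_sum[OF D(1) sm])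
  have "closedin (top_of_set D) E"
    unfolding E_def by (rule continuous_closedin_preimage_constant[OF cont])
  moreover have "open E"
  proof (rule ccontr)
    assume "\<not> open E"
    then obtain q where q: "q \<in> E" "\<And>r. r > 0 \<Longrightarrow> \<not> ball q r \<subseteq> E"
      unfolding open_contains_ball by blast
    then have "q \<in> D" by (simp add: E_def)
    then obtain r' where r': "r' > 0" "cball q r' \<subseteq> D"
      using D(1) open_contains_cball by blast
    \<comment> \<open>Room for three steps: \<open>z0\<close> lies within \<open>r\<close> of
      \<open>q\<close>, the contact points considered within \<open>2 * r\<close>, and the small
      ball around \<open>q'\<close> within \<open>3 * r\<close>.\<close>
    define r where "r = r' / 3"
    have r: "r > 0" "cball q (3 * r) \<subseteq> D" using r' by (simp_all add: r_def)
    obtain z0 where z0: "dist q z0 < r" "z0 \<notin> E" using q(2)[OF r(1)] by (metis mem_ball subsetI)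
    define C where "C = {x \<in> cball q (2 * r). singular_sum F x = 1}"
    have "cball q (2 * r) \<subseteq> D" using r by (auto intro: order_trans[of _ "2 * r"])
    then have "closed C"
      unfolding C_def
      by (intro continuous_closed_preimage_constant continuous_on_subset[OF cont]) auto
    moreover have qC: "q \<in> C" using q(1) r(1) by (simp add: C_def E_def)
    ultimately obtain q' where q': "q' \<in> C" "\<And>y. y \<in> C \<Longrightarrow> dist z0 q' \<le> dist z0 y"
      using distance_attains_inf[of C z0] by blast
    define \<rho> where "\<rho> = dist z0 q' / 2"
    have q'D: "q' \<in> D" "singular_sum F q' = 1" "dist q q' \<le> 2 * r"
      using q'(1) \<open>cball q (2 * r) \<subseteq> D\<close> by (auto simp: C_def)
    have \<rho>r: "2 * \<rho> < r" using q'(2)[OF qC] z0(1) by (simp add: \<rho>_def dist_commute)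
    have "z0 \<noteq> q'" using z0(2) q'D by (auto simp: E_def)
    then have \<rho>: "\<rho> > 0" by (simp add: \<rho>_def)
    have inner: "singular_sum F y < 1" if "dist z0 y < 2 * \<rho>" for y
    proof -
      have "dist q y < 2 * r"
        using dist_triangle[of q y z0] z0(1) that \<rho>r by linarith
      then have "y \<in> cball q (2 * r)" by simp
      moreover have "y \<notin> C" using q'(2)[of y] that by (auto simp: \<rho>_def)
      ultimately show ?thesis
        using le[of y] \<open>cball q (2 * r) \<subseteq> D\<close> by (auto simp: C_def order_less_le)
    qed
    \<comment> \<open>The ball around \<open>z\<close> touches the contact set only at \<open>q'\<close>, unlike the one around \<open>z0\<close>.\<close>
    define z where "z = (1 / 2) *\<^sub>R (z0 + q')"
    define c where "c = (1 / 2) *\<^sub>R (q' - z0)"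
    have cz: "q' - z = c" "z - z0 = c"
      by (simp_all add: z_def c_def vec_eq_iff field_simps)
    have nc: "norm c = \<rho>" by (simp add: c_def \<rho>_def dist_norm norm_minus_commute)
    have touching: "singular_sum F y < 1" if "norm (y - z) \<le> \<rho>" "y \<noteq> q'" for y
    proof (rule inner)
      \<comment> \<open>Strict convexity: \<open>y - z0 = c + d\<close> with both lengths at most
        \<open>\<rho>\<close> and \<open>c \<noteq> d\<close>, so its length is less than
        \<open>2 * \<rho>\<close>.\<close>
      define d where "d = y - z"
      have "c - d \<noteq> 0" using that(2) cz(1) by (auto simp: d_def)
      then have "0 < (c - d) \<bullet> (c - d)" by simp
      then have "2 * (c \<bullet> d) < c \<bullet> c + d \<bullet> d"
        by (simp add: inner_diff_left inner_diff_right inner_commute)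
      moreover have "d \<bullet> d \<le> \<rho>\<^sup>2" "c \<bullet> c = \<rho>\<^sup>2"
        using that(1) nc power_mono[of "norm d" \<rho> 2] by (simp_all add: d_def power2_norm_eq_inner[symmetric])
      ultimately have "(c + d) \<bullet> (c + d) < (2 * \<rho>)\<^sup>2"
        by (simp add: inner_add_left inner_add_right inner_commute power2_eq_square)
      then have "norm (c + d) < 2 * \<rho>"
        using \<rho> by (metis norm_ge_zero power2_norm_eq_inner power_less_imp_less_base less_imp_le zero_less_mult_iff zero_less_numeral)
      moreover have "c + d = y - z0" by (simp add: d_def cz(2)[symmetric])
      ultimately show "dist z0 y < 2 * \<rho>" by (simp add: dist_norm norm_minus_commute)
    qed
    \<comment> \<open>Half of \<open>\<rho>\<close> keeps the small ball at distance at least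
      \<open>\<rho> / 2\<close> from \<open>z\<close>, where the second derivative of the barrier
      can dominate.\<close>
    define \<delta> where "\<delta> = \<rho> / 2"
    have VD: "cball q' \<delta> \<subseteq> D"
    proof
      fix y assume "y \<in> cball q' \<delta>"
      then have "dist q y \<le> 3 * r"
        using dist_triangle[of q y q'] q'D(3) \<rho>r \<rho> by (simp add: \<delta>_def)
      then show "y \<in> D" using r(2) by auto
    qed
    have ring: "\<rho> / 2 \<le> norm (y - z)" "norm (y - z) \<le> 2 * \<rho>" if "y \<in> cball q' \<delta>" for y
    proof -
      have le: "norm (y - q') \<le> \<rho> / 2"
        using that by (simp add: \<delta>_def dist_norm norm_minus_commute)
      have eq: "y - z = c + (y - q')" by (simp add: cz(1)[symmetric])
      show "\<rho> / 2 \<le> norm (y - z)" "norm (y - z) \<le> 2 * \<rho>"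
        using norm_triangle_ineq[of c "y - q'"] norm_diff_ineq[of c "y - q'"] nc \<rho> le
        unfolding eq by linarith+
    qed
    obtain \<Lambda> where \<Lambda>: "\<And>x u. x \<in> cball q' \<delta> \<Longrightarrow> norm u = 1 \<Longrightarrow> norm (dderiv u F x) \<le> \<Lambda>"
      using dderiv_bounded_on_compact[OF compact_cball VD sm] by blast
    obtain K where K: "\<And>x u v. x \<in> cball q' \<delta> \<Longrightarrow> norm u = 1 \<Longrightarrow> norm v = 1 \<Longrightarrow>
        norm (dderiv u (dderiv v F) x) \<le> K"
      using dderiv2_bounded_on_compact[OF compact_cball VD D(1) sm] by blast
    define A where "A = 2 * (\<rho> / 2)\<^sup>2 / (1 + \<Lambda>\<^sup>2)"
    have A: "A > 0" using \<rho> by (simp add: A_def add_pos_nonneg)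
    \<comment> \<open>Chosen to violate the conclusion of \<open>barrier_no_interior_max\<close> for
      the radii \<open>\<rho> / 2\<close> and \<open>2 * \<rho>\<close>.\<close>
    define \<alpha> where "\<alpha> = (\<bar>real CARD('n) * (1 + 2 * K * (2 * \<rho>))\<bar> + 1) / A"
    have \<alpha>: "\<alpha> > 0" using A by (simp add: \<alpha>_def)
    have \<alpha>A: "real CARD('n) * (1 + 2 * K * (2 * \<rho>)) < 2 * \<alpha> * (\<rho> / 2)\<^sup>2 / (1 + \<Lambda>\<^sup>2)"
    proof -
      have "\<alpha> * A = \<bar>real CARD('n) * (1 + 2 * K * (2 * \<rho>))\<bar> + 1" using A by (simp add: \<alpha>_def)
      then show ?thesis unfolding A_def by (simp add: mult.commute mult.left_commute)
    qed
    define g where "g y = exp (- \<alpha> * ((y - z) \<bullet> (y - z)))" for y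
    have g: "g y = exp (- \<alpha> * (norm (y - z))\<^sup>2)" for y by (simp add: g_def power2_norm_eq_inner)
    have gq: "g q' = exp (- \<alpha> * \<rho>\<^sup>2)" unfolding g cz nc ..
    \<comment> \<open>The part of the small sphere where the barrier may be larger than at
      \<open>q'\<close>. It is compact and avoids the contact set, so the singular sum stays below
      some \<open>m < 1\<close> there, and \<open>\<epsilon>\<close> may use up half of the
      gap.\<close>
    define B where "B = sphere q' \<delta> \<inter> cball z \<rho>"
    have "\<exists>m<1. \<forall>y\<in>B. singular_sum F y \<le> m"
    proof (cases "B = {}")
      case False
      have "compact B" unfolding B_def by (intro compact_Int_closed) auto
      moreover have "continuous_on B (singular_sum F)"
        using VD sphere_cball[of q' \<delta>] by (intro continuous_on_subset[OF cont]) (auto simp: B_def)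
      ultimately obtain y where y: "y \<in> B" "\<And>x. x \<in> B \<Longrightarrow> singular_sum F x \<le> singular_sum F y"
        using continuous_attains_sup[OF _ False] by blast
      have "norm (y - z) \<le> \<rho>" "y \<noteq> q'"
        using y(1) \<rho> by (auto simp: B_def \<delta>_def dist_norm norm_minus_commute)
      then show ?thesis using touching y(2) by blast
    qed (auto intro: exI[of _ 0])
    then obtain m where m: "m < 1" "\<And>y. y \<in> B \<Longrightarrow> singular_sum F y \<le> m" by blast
    define \<epsilon> where "\<epsilon> = (1 - m) / 2"
    have \<epsilon>: "\<epsilon> > 0" using m by (simp add: \<epsilon>_def)
    \<comment> \<open>On \<open>B\<close> the gap \<open>1 - m\<close> outweighs the barrier;
      elsewhere on the sphere the barrier is smaller than at \<open>q'\<close>. Hence the maximum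
      over the closed ball is attained inside.\<close>
    have bdry: "singular_sum F y + \<epsilon> * g y < 1 + \<epsilon> * g q'" if y: "y \<in> sphere q' \<delta>" for y
    proof (cases "norm (y - z) \<le> \<rho>")
      case True
      then have "singular_sum F y \<le> m"
        using y by (intro m(2)) (simp add: B_def dist_norm norm_minus_commute)
      moreover have "\<epsilon> * g y \<le> \<epsilon> * 1"
        using \<epsilon> \<alpha> by (intro mult_left_mono) (auto simp: g_def)
      moreover have "m + \<epsilon> < 1" using m(1) by (simp add: \<epsilon>_def field_simps)
      moreover have "0 < \<epsilon> * g q'" using \<epsilon> by (simp add: g_def)
      ultimately show ?thesis by linarith
    next
      case False
      then have "\<rho>\<^sup>2 < (norm (y - z))\<^sup>2" using \<rho> by (intro power_strict_mono) auto
      then have "g y < g q'" unfolding gq unfolding g using \<alpha> by simp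
      then have "\<epsilon> * g y < \<epsilon> * g q'" using \<epsilon> by simp
      moreover have "singular_sum F y \<le> 1" using VD y by (intro le) auto
      ultimately show ?thesis by linarith
    qed
    have "continuous_on (cball q' \<delta>) (\<lambda>y. singular_sum F y + \<epsilon> * g y)"
      unfolding g_def by (intro continuous_intros continuous_on_subset[OF cont VD])
    moreover have "cball q' \<delta> \<noteq> {}" using \<rho> by (simp add: \<delta>_def)
    ultimately obtain p where p: "p \<in> cball q' \<delta>"
      "\<And>y. y \<in> cball q' \<delta> \<Longrightarrow> singular_sum F y + \<epsilon> * g y \<le> singular_sum F p + \<epsilon> * g p"
      using continuous_attains_sup[OF compact_cball, of q' \<delta>] by blast
    have "q' \<in> cball q' \<delta>" using \<rho> by (simp add: \<delta>_def)
    then have "1 + \<epsilon> * g q' \<le> singular_sum F p + \<epsilon> * g p" using p(2) q'D(2) by metis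
    then have "p \<notin> sphere q' \<delta>" using bdry by fastforce
    then have pb: "p \<in> ball q' \<delta>" using p(1) by auto
    have "2 * \<alpha> * (\<rho> / 2)\<^sup>2 / (1 + \<Lambda>\<^sup>2) \<le> real CARD('n) * (1 + 2 * K * (2 * \<rho>))"
    proof (rule barrier_no_interior_max[OF D(1) _ sm min _ open_ball pb])
      show "p \<in> D" "singular_sum F p \<le> 1" using p(1) VD le by auto
      show "ball q' \<delta> \<subseteq> D" using VD by auto
      show "singular_sum F y + \<epsilon> * exp (- \<alpha> * ((y - z) \<bullet> (y - z))) \<le>
          singular_sum F p + \<epsilon> * exp (- \<alpha> * ((p - z) \<bullet> (p - z)))" if "y \<in> ball q' \<delta>" for y
        using p(2)[of y] that unfolding g_def by simp
    qed (use \<epsilon> \<alpha> K[OF p(1)] \<Lambda>[OF p(1)] ring[OF p(1)] \<rho> in auto)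
    then show False using \<alpha>A by linarith
  qed
  then have "openin (top_of_set D) E" by (simp add: E_def D(1) openin_open_eq subset_iff)
  moreover have "x0 \<in> E" using x0 by (simp add: E_def)
  ultimately have "E = D" using D(2) unfolding connected_clopen by blast
  then show ?thesis by (auto simp: E_def)
qed

section \<open>Rigidity\<close>

lemma jacobian_mult_dderiv:
  fixes F :: "real^'n \<Rightarrow> real^'m"
  shows "F differentiable (at x) \<Longrightarrow> jacobian F (at x) *v v = dderiv v F x"
  using jacobian_works[of F "at x"] dderiv_unique[of F "\<lambda>h. jacobian F (at x) *v h" x v] by simp

lemma dderiv_expansion:
  fixes F :: "real^'n \<Rightarrow> 'b::real_normed_vector"
  assumes "F differentiable (at x)"
  shows "dderiv v F x = (\<Sum>i\<in>UNIV. (v \<bullet> axis i 1) *\<^sub>R dderiv (axis i 1) F x)"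
  by (subst orthonormal_expansion[OF orthonormal_axis, of v])
    (simp add: linear_sum[OF linear_dderiv[OF assms]] linear_scale[OF linear_dderiv[OF assms]])

text \<open>On its row space \<open>W\<close> the matrix \<open>A\<close> stretches by at least some
  \<open>e > 0\<close>. A Jacobian that differs from \<open>A\<close> by less than \<open>e\<close>
  in operator norm is still injective on \<open>W\<close>, whose dimension is the rank of
  \<open>A\<close>.\<close>

lemma rank_jacobian_lower_semicontinuous:
  fixes F :: "real^'n \<Rightarrow> real^'m"
  assumes D: "open D" "x \<in> D" and sm: "smooth_on D F"
  shows "\<exists>r>0. ball x r \<subseteq> D \<and> (\<forall>y\<in>ball x r. rank (jacobian F (at x)) \<le> rank (jacobian F (at y)))"
proof -
  define A where "A = jacobian F (at x)"
  define W where "W = range ((*v) (transpose A))"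
  have W: "subspace W" unfolding W_def by (rule linear_subspace_image) auto
  have dimW: "dim W = rank A"
    unfolding W_def by (metis rank_dim_range rank_transpose)
  have inj: "v = 0" if v: "v \<in> W" "A *v v = 0" for v
  proof -
    obtain u where "v = transpose A *v u" using v(1) unfolding W_def by blast
    then have "v \<bullet> v = 0"
      using inner_matrix_vector_transpose[of A v u] v(2) by simp
    then show ?thesis by simp
  qed
  obtain e where e: "e > 0" "\<And>v. v \<in> W \<Longrightarrow> e * norm v \<le> norm (A *v v)"
    using injective_imp_isometric[OF closed_subspace[OF W] W, of "(*v) A"] inj
    by (auto simp: matrix_vector_mul_bounded_linear)
  define d where "d y = (\<Sum>i\<in>UNIV. norm (dderiv (axis i 1) F y - dderiv (axis i 1) F x))" for y
  have "isCont d x"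
    unfolding d_def using smooth_on_continuous[OF smooth_on_dderiv[OF sm]] D
    by (intro continuous_intros) (auto simp: continuous_on_eq_continuous_at)
  then obtain r0 where r0: "r0 > 0" "\<And>y. dist y x < r0 \<Longrightarrow> dist (d y) (d x) < e"
    using e(1) unfolding continuous_at_eps_delta by blast
  obtain r1 where r1: "r1 > 0" "ball x r1 \<subseteq> D" using D open_contains_ball by blast
  have "rank A \<le> rank (jacobian F (at y))" if y: "dist y x < r0" "y \<in> D" for y
  proof -
    define B where "B = jacobian F (at y)"
    have dy: "d y < e" using r0(2)[OF y(1)] by (simp add: dist_real_def d_def)
    have diff: "norm (A *v v - B *v v) \<le> norm v * d y" for v
    proof -
      have "A *v v - B *v v = (\<Sum>i\<in>UNIV. (v \<bullet> axis i 1) *\<^sub>R (dderiv (axis i 1) F x - dderiv (axis i 1) F y))"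
        unfolding A_def B_def using smooth_on_differentiable[OF sm] D(2) y(2)
        by (simp add: jacobian_mult_dderiv dderiv_expansion[of F _ v] sum_subtractf scaleR_diff_right)
      also have "norm \<dots> \<le> (\<Sum>i\<in>UNIV. norm v * norm (dderiv (axis i 1) F y - dderiv (axis i 1) F x))"
      proof (rule sum_norm_le)
        fix i
        show "norm ((v \<bullet> axis i 1) *\<^sub>R (dderiv (axis i 1) F x - dderiv (axis i 1) F y)) \<le>
            norm v * norm (dderiv (axis i 1) F y - dderiv (axis i 1) F x)"
          unfolding norm_scaleR norm_minus_commute[of "dderiv (axis i 1) F x"]
          using Cauchy_Schwarz_ineq2[of v "axis i 1"] by (intro mult_right_mono) auto
      qed
      finally show ?thesis by (simp add: d_def sum_distrib_left)
    qed
    have "v = 0" if v: "v \<in> W" "B *v v = 0" for v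
    proof (rule ccontr)
      assume "v \<noteq> 0"
      then have "norm v * d y < norm v * e" using dy by simp
      moreover have "e * norm v \<le> norm v * d y" using e(2)[OF v(1)] diff[of v] v(2) by simp
      ultimately show False by (simp add: mult.commute)
    qed
    then have "inj_on ((*v) B) W"
      by (intro inj_onI) (metis W eq_iff_diff_eq_0 matrix_vector_mult_diff_distrib subspace_diff)
    then have "inj_on ((*v) B) (span W)" using W by (metis span_eq_iff)
    then have "dim ((*v) B ` W) = dim W"
      by (intro dim_image_eq) auto
    then show ?thesis
      using dim_subset[of "(*v) B ` W" "range ((*v) B)"] unfolding B_def[symmetric] dimW rank_dim_range[of B] by auto
  qed
  then have "\<forall>y\<in>ball x (min r0 r1). rank A \<le> rank (jacobian F (at y))"
    using r1(2) by (auto simp: dist_commute subset_eq)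
  then show ?thesis
    using r0(1) r1 unfolding A_def by (intro exI[of _ "min r0 r1"]) auto
qed

text \<open>Each summand of the singular sum is strictly below \<open>1\<close>, so a single one
  cannot reach \<open>1\<close>.\<close>

lemma rank_jacobian_ge_2:
  fixes F :: "real^'n \<Rightarrow> real^'m"
  assumes S: "singular_sum F x = 1"
  shows "2 \<le> rank (jacobian F (at x))"
proof (rule ccontr)
  obtain a \<kappa> b where fr: "singular_frame (jacobian F (at x)) a \<kappa> b"
    using singular_frame_exists by blast
  assume "\<not> 2 \<le> rank (jacobian F (at x))"
  then have card: "card {i. 0 < \<kappa> i} \<le> 1" unfolding rank_singular_frame[OF fr] by simp
  have "(\<Sum>i\<in>UNIV. (\<kappa> i)\<^sup>2 / (1 + (\<kappa> i)\<^sup>2)) = (\<Sum>i | 0 < \<kappa> i. (\<kappa> i)\<^sup>2 / (1 + (\<kappa> i)\<^sup>2))"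
    using fr unfolding singular_frame_def
    by (intro sum.mono_neutral_right) (auto simp: order_le_less)
  moreover have "(\<Sum>i | 0 < \<kappa> i. (\<kappa> i)\<^sup>2 / (1 + (\<kappa> i)\<^sup>2)) < 1"
  proof (cases "{i. 0 < \<kappa> i} = {}")
    case False
    then have "card {i. 0 < \<kappa> i} \<noteq> 0" by simp
    then have "card {i. 0 < \<kappa> i} = 1" using card by linarith
    then obtain j where "{i. 0 < \<kappa> i} = {j}" using card_1_singletonE by blast
    then show ?thesis by (simp add: divide_less_eq add_pos_nonneg)
  qed simp
  ultimately show False using S singular_sum_frame[OF fr] by simp
qed

text \<open>A third positive summand makes any two others sum to less than \<open>1\<close>, so
  \<open>b l \<bullet> H i k = 0\<close> for \<open>l \<noteq> i\<close>. Symmetry of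
  \<open>H\<close> extends this to \<open>l = i \<noteq> k\<close>, and in the \<open>b i\<close>
  component of the minimal graph equation only \<open>b i \<bullet> H i i\<close> is left, which
  must vanish too.\<close>

lemma dderiv2_zero_if_rank_ge_3:
  fixes F :: "real^'n \<Rightarrow> real^'m"
  assumes D: "open D" "x \<in> D" and sm: "smooth_on D F" and min: "minimal_graph_on D F"
    and S: "\<And>y. y \<in> D \<Longrightarrow> singular_sum F y = 1" and rank: "3 \<le> rank (jacobian F (at x))"
  shows "dderiv u (dderiv v F) x = 0"
proof -
  obtain a \<kappa> b where fr: "singular_frame (jacobian F (at x)) a \<kappa> b"
    using singular_frame_exists by blast
  then have a: "orthonormal a" by (simp add: singular_frame_def)
  define w where "w i = 1 / (1 + (\<kappa> i)\<^sup>2)" for i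
  define H where "H i k = dderiv (a k) (dderiv (a i) F) x" for i k
  have Hsym: "H i k = H k i" for i k
    unfolding H_def by (rule dderiv_commute[OF D sm])
  have w01: "0 < w i" for i
    unfolding w_def by (simp add: add_pos_nonneg)
  note rigid = singular_sum_constant_rigidity[OF D sm min fr S, folded w_def H_def]
  have "w i + w l \<noteq> 1" if "l \<noteq> i" for i l
  proof -
    have "card {i, l} < card {j. 0 < \<kappa> j}"
      using rank that unfolding rank_singular_frame[OF fr] by simp
    then have "\<not> {j. 0 < \<kappa> j} \<subseteq> {i, l}" by (meson card_mono finite.emptyI finite_insert not_le)
    then obtain j where "j \<in> {j. 0 < \<kappa> j} - {i, l}" by blast
    then have j: "0 < \<kappa> j" "j \<noteq> i" "j \<noteq> l" by simp_all
    define s where "s k = (\<kappa> k)\<^sup>2 / (1 + (\<kappa> k)\<^sup>2)" for k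
    have "(\<Sum>k\<in>{i, l, j}. s k) \<le> (\<Sum>k\<in>UNIV. s k)"
      by (rule sum_mono2) (auto simp: s_def)
    then have "s i + s l + s j \<le> 1"
      using S[OF D(2)] j that unfolding singular_sum_frame[OF fr] s_def by simp
    moreover have "s j > 0" using j by (simp add: s_def add_pos_nonneg)
    moreover have "s k = 1 - w k" for k
      by (simp add: s_def w_def field_simps add_nonneg_eq_0_iff)
    ultimately show ?thesis by simp
  qed
  then have off: "b l \<bullet> H i k = 0" if "l \<noteq> i" for i k l
    using rigid(2)[of l i k] that by blast
  have "b i \<bullet> H i k = 0" for i k
  proof (cases "i = k")
    case False
    then show ?thesis using off[of i k i] Hsym[of i k] by simp
  next
    case True
    have "(\<Sum>k\<in>UNIV. w k *\<^sub>R H k k) = 0"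
      using minimal_graph_equation[OF D sm min a]
      unfolding frame_inverse_singular_frame(2)[OF smooth_on_differentiable[OF sm D(2)] fr] H_def w_def
      by (simp add: if_distrib[of "\<lambda>x. x *\<^sub>R _"] cong: if_cong)
    then have "(\<Sum>k\<in>UNIV. w k * (b i \<bullet> H k k)) = 0"
      by (metis (no_types, lifting) inner_scaleR_right inner_sum_right inner_zero_right sum.cong)
    moreover have "(\<Sum>k\<in>UNIV. w k * (b i \<bullet> H k k)) = w i * (b i \<bullet> H i i)"
      by (subst sum.remove[of _ i]) (auto intro!: sum.neutral off)
    ultimately show ?thesis using w01[of i] True by simp
  qed
  then have "b l \<bullet> H i k = 0" for i k l using off by (cases "l = i") auto
  then have "H i k = 0" for i k using rigid(1)[of i k] by simp
  then show ?thesis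
    unfolding H_def
    by (subst orthonormal_expansion[OF a, of u], subst orthonormal_expansion[OF a, of v],
        subst dderiv_dderiv_sum[OF D sm]) auto
qed

text \<open>What propagates is not the rank but the value of \<open>dF\<close>: where it equals that
  at \<open>x0\<close> the rank is at least \<open>3\<close>, also nearby, so the second derivatives
  vanish and \<open>dF\<close> is locally constant. Thus \<open>Z\<close> is open as well as closed
  in \<open>D\<close>.\<close>

lemma affine_if_rank_ge_3:
  fixes F :: "real^'n \<Rightarrow> real^'m"
  assumes D: "open D" "connected D" and sm: "smooth_on D F" and min: "minimal_graph_on D F"
    and S: "\<And>y. y \<in> D \<Longrightarrow> singular_sum F y = 1"
    and x0: "x0 \<in> D" "3 \<le> rank (jacobian F (at x0))"
  shows "affine_map_on D F"
proof -
  note dF = smooth_on_differentiable[OF sm]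
  define Z where "Z = (\<Inter>i\<in>UNIV. {x \<in> D. dderiv (axis i 1) F x = dderiv (axis i 1) F x0})"
  have jac: "dderiv v F x = dderiv v F x0" if "x \<in> Z" for x v
    using that x0 unfolding Z_def by (simp add: dderiv_expansion[OF dF, of _ v])
  have "closedin (top_of_set D) Z"
    unfolding Z_def
    by (intro closedin_Inter)
      (auto intro!: continuous_closedin_preimage_constant smooth_on_continuous smooth_on_dderiv sm)
  moreover have "open Z"
    unfolding open_contains_ball
  proof
    fix x assume x: "x \<in> Z"
    then have xD: "x \<in> D" by (simp add: Z_def)
    have "jacobian F (at x) *v v = jacobian F (at x0) *v v" for v
      using jac[OF x] xD x0(1) by (simp add: jacobian_mult_dderiv dF)
    then have rx: "3 \<le> rank (jacobian F (at x))" using x0(2) by (metis matrix_eq)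
    obtain r where r: "r > 0" "ball x r \<subseteq> D"
      "\<And>y. y \<in> ball x r \<Longrightarrow> rank (jacobian F (at x)) \<le> rank (jacobian F (at y))"
      using rank_jacobian_lower_semicontinuous[OF D(1) xD sm] by blast
    have "dderiv (axis i 1) F y = dderiv (axis i 1) F x" if "y \<in> ball x r" for y i
    proof (rule has_derivative_zero_unique_connected[OF open_ball connected_ball, where f = "dderiv (axis i 1) F"])
      fix z assume z: "z \<in> ball x r"
      then have "z \<in> D" "3 \<le> rank (jacobian F (at z))" using r rx by force+
      then have zero: "dderiv h (dderiv (axis i 1) F) z = 0" for h
        using dderiv2_zero_if_rank_ge_3[OF D(1) _ sm min S] by blast
      show "(dderiv (axis i 1) F has_derivative (\<lambda>h. 0)) (at z)"
        using has_derivative_dderiv[OF smooth_on_differentiable[OF smooth_on_dderiv[OF sm] \<open>z \<in> D\<close>], of "axis i 1"]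
        by (simp add: zero)
    qed (use that r in auto)
    then have "ball x r \<subseteq> Z" using x r(2) unfolding Z_def by auto
    then show "\<exists>e>0. ball x e \<subseteq> Z" using r(1) by blast
  qed
  then have "openin (top_of_set D) Z" by (auto simp: D(1) openin_open_eq Z_def)
  moreover have "x0 \<in> Z" using x0 by (simp add: Z_def)
  ultimately have ZD: "Z = D" using D(2) unfolding connected_clopen by blast
  define L where "L v = dderiv v F x0" for v
  have lin: "linear L" unfolding L_def by (rule linear_dderiv[OF dF[OF x0(1)]])
  have "F x - L x = F x0 - L x0" if "x \<in> D" for x
  proof (rule has_derivative_zero_unique_connected[OF D, where f = "\<lambda>x. F x - L x"])
    fix y assume "y \<in> D"
    then have FL: "(F has_derivative L) (at y)"
      using has_derivative_dderiv[OF dF] jac ZD by (simp add: L_def[abs_def])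
    have LL: "(L has_derivative L) (at y)"
      using lin by (simp add: linear_imp_has_derivative)
    show "((\<lambda>x. F x - L x) has_derivative (\<lambda>h. 0)) (at y)"
      using has_derivative_diff[OF FL LL] by simp
  qed (use that x0 in auto)
  then have "F x = L x + (F x0 - L x0)" if "x \<in> D" for x
    using that by (metis add.commute diff_add_cancel)
  then show ?thesis using lin unfolding affine_map_on_def by blast
qed

section \<open>The case of rank two\<close>

text \<open>Rank \<open>2\<close> and singular sum \<open>1\<close> force the two singular values to be reciprocal, so an upper
  bound on \<open>dF\<close> also bounds the inverse of \<open>dF\<close> on its image.\<close>

lemma dderiv2_normal_bound:
  fixes F :: "real^'n \<Rightarrow> real^'m"
  assumes D: "open D" "x \<in> D" and sm: "smooth_on D F" and min: "minimal_graph_on D F"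
    and S: "\<And>y. y \<in> D \<Longrightarrow> singular_sum F y = 1" and rank: "rank (jacobian F (at x)) = 2"
    and K: "norm (dderiv u (dderiv v F) x) \<le> K"
    and \<Lambda>: "\<And>u. norm u = 1 \<Longrightarrow> norm (dderiv u F x) \<le> \<Lambda>"
    and M: "\<And>u. norm u = 1 \<Longrightarrow> \<bar>dderiv u F x \<bullet> \<nu>\<bar> \<le> M"
  shows "\<bar>dderiv u (dderiv v F) x \<bullet> \<nu>\<bar> \<le> 2 * K * \<Lambda> * M"
proof -
  obtain a \<kappa> b where fr: "singular_frame (jacobian F (at x)) a \<kappa> b"
    using singular_frame_exists by blast
  note f = fr[unfolded singular_frame_def]
  have a: "orthonormal a" using f by blast
  note Fa = frame_inverse_singular_frame(1)[OF smooth_on_differentiable[OF sm D(2)] fr]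
  define H where "H i k = dderiv (a k) (dderiv (a i) F) x" for i k
  define h where "h = dderiv u (dderiv v F) x"
  have Hb: "H i k = (\<Sum>l\<in>UNIV. (b l \<bullet> H i k) *\<^sub>R b l)" for i k
    unfolding H_def by (rule singular_sum_constant_rigidity(1)[OF D sm min fr S])
  have "h = (\<Sum>k\<in>UNIV. \<Sum>i\<in>UNIV. ((u \<bullet> a k) * (v \<bullet> a i)) *\<^sub>R H i k)"
    unfolding h_def H_def
    by (subst orthonormal_expansion[OF a, of u], subst orthonormal_expansion[OF a, of v],
        subst dderiv_dderiv_sum[OF D sm]) auto
  then have "h \<in> span (range b)"
  proof -
    assume h: "h = (\<Sum>k\<in>UNIV. \<Sum>i\<in>UNIV. ((u \<bullet> a k) * (v \<bullet> a i)) *\<^sub>R H i k)"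
    have "H i k \<in> span (range b)" for i k
      by (subst Hb) (intro span_sum span_scale span_base, auto)
    then show ?thesis unfolding h by (intro span_sum span_scale)
  qed
  \<comment> \<open>The expansion in the vectors \<open>b l\<close> reproduces each
    \<open>b i\<close>, including the zero ones, and hence everything in their span.\<close>
  then have hb: "h = (\<Sum>l\<in>UNIV. (b l \<bullet> h) *\<^sub>R b l)"
  proof (induction rule: span_induct_alt)
    case base
    then show ?case by simp
  next
    case (step c y z)
    then obtain i where i: "y = b i" by blast
    have b0: "b i = 0" if "\<not> 0 < \<kappa> i"
      using f that by (metis inner_eq_zero_iff)
    have "(\<Sum>l\<in>UNIV. (b l \<bullet> b i) *\<^sub>R b l) = b i"
    proof -
      have "(b l \<bullet> b i) *\<^sub>R b l = (if l = i then b i else 0)" for l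
        using f b0 by (cases "0 < \<kappa> i") auto
      then show ?thesis by simp
    qed
    then have "(\<Sum>l\<in>UNIV. (b l \<bullet> (c *\<^sub>R y + z)) *\<^sub>R b l) = c *\<^sub>R y + (\<Sum>l\<in>UNIV. (b l \<bullet> z) *\<^sub>R b l)"
      unfolding i by (simp add: inner_add_right scaleR_left_distrib sum.distrib scaleR_sum_right[symmetric]
          scaleR_scaleR[symmetric] del: scaleR_scaleR)
    then show ?case using step by simp
  qed
  have "card {i. 0 < \<kappa> i} = 2" using rank unfolding rank_singular_frame[OF fr] .
  then obtain p q where pq: "{i. 0 < \<kappa> i} = {p, q}" "p \<noteq> q" by (meson card_2_iff)
  have \<kappa>pq: "0 < \<kappa> p" "0 < \<kappa> q" using pq(1) by auto
  have bz: "b l = 0" if "l \<notin> {p, q}" for l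
    using f that unfolding pq(1)[symmetric] by (metis inner_eq_zero_iff mem_Collect_eq)
  have prod: "\<kappa> p * \<kappa> q = 1"
  proof -
    have "(\<Sum>i\<in>UNIV. (\<kappa> i)\<^sup>2 / (1 + (\<kappa> i)\<^sup>2)) = (\<Sum>i | 0 < \<kappa> i. (\<kappa> i)\<^sup>2 / (1 + (\<kappa> i)\<^sup>2))"
      using f by (intro sum.mono_neutral_right) (auto simp: order_le_less)
    then have "(\<kappa> p)\<^sup>2 / (1 + (\<kappa> p)\<^sup>2) + (\<kappa> q)\<^sup>2 / (1 + (\<kappa> q)\<^sup>2) = 1"
      using S[OF D(2)] pq unfolding singular_sum_frame[OF fr] by simp
    then have "(\<kappa> p * \<kappa> q)\<^sup>2 = 1\<^sup>2"
      by (simp add: field_simps power_mult_distrib add_nonneg_eq_0_iff)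
    then show ?thesis using \<kappa>pq by (intro power2_eq_imp_eq[of _ 1]) auto
  qed
  have \<kappa>\<Lambda>: "\<kappa> i \<le> \<Lambda>" if "i \<in> {p, q}" for i
  proof -
    have "b i \<bullet> b i = 1" using f that \<kappa>pq by auto
    then have "norm (b i) = 1" by (simp add: norm_eq_sqrt_inner)
    then show ?thesis using \<Lambda>[OF orthonormal_norm[OF a], of i] f unfolding Fa by simp
  qed
  have M0: "0 \<le> M" using M[OF orthonormal_norm[OF a], of p] by linarith
  have K0: "0 \<le> K" using K by (meson norm_ge_zero order_trans)
  have b\<nu>: "\<bar>b i \<bullet> \<nu>\<bar> \<le> \<Lambda> * M" if ij: "(i, j) = (p, q) \<or> (i, j) = (q, p)" for i j
  proof -
    have "b i = \<kappa> j *\<^sub>R dderiv (a i) F x"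
      using ij prod by (auto simp: Fa mult.commute)
    then have "\<bar>b i \<bullet> \<nu>\<bar> = \<kappa> j * \<bar>dderiv (a i) F x \<bullet> \<nu>\<bar>"
      using ij \<kappa>pq by (auto simp: abs_mult)
    also have "\<dots> \<le> \<Lambda> * M"
      using ij \<kappa>\<Lambda>[of j] \<kappa>pq M[OF orthonormal_norm[OF a], of i] by (intro mult_mono) auto
    finally show ?thesis .
  qed
  have bh: "\<bar>b i \<bullet> h\<bar> \<le> K" for i
    using Cauchy_Schwarz_ineq2[of "b i" h] singular_frame_norm_le[OF fr, of i] K
      mult_mono[of "norm (b i)" 1 "norm h" K] by (simp add: h_def)
  have "h \<bullet> \<nu> = (\<Sum>l\<in>UNIV. (b l \<bullet> h) * (b l \<bullet> \<nu>))"
    by (subst hb) (simp add: inner_sum_left)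
  also have "\<dots> = (\<Sum>l\<in>{p, q}. (b l \<bullet> h) * (b l \<bullet> \<nu>))"
    using bz by (intro sum.mono_neutral_right) auto
  also have "\<dots> = (b p \<bullet> h) * (b p \<bullet> \<nu>) + (b q \<bullet> h) * (b q \<bullet> \<nu>)"
    using pq(2) by simp
  also have "\<bar>\<dots>\<bar> \<le> K * (\<Lambda> * M) + K * (\<Lambda> * M)"
    using bh b\<nu>[of p q] b\<nu>[of q p] K0
    by (intro order_trans[OF abs_triangle_ineq] add_mono) (auto simp: abs_mult intro!: mult_mono)
  finally show ?thesis by (simp add: h_def mult_ac)
qed

lemma gronwall_zero:
  fixes \<phi> :: "real \<Rightarrow> real"
  assumes "0 \<le> T" and \<phi>: "\<And>t. 0 \<le> t \<Longrightarrow> t \<le> T \<Longrightarrow> (\<phi> has_real_derivative \<phi>' t) (at t)"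
    and le: "\<And>t. 0 \<le> t \<Longrightarrow> t \<le> T \<Longrightarrow> \<phi>' t \<le> C * \<phi> t" and "\<phi> 0 = 0"
  shows "\<phi> T \<le> 0"
proof -
  have "\<phi> T * exp (- C * T) \<le> \<phi> 0 * exp (- C * 0)"
  proof (rule DERIV_nonpos_imp_nonincreasing[OF \<open>0 \<le> T\<close>, of "\<lambda>t. \<phi> t * exp (- C * t)"])
    fix t assume t: "0 \<le> t" "t \<le> T"
    have "((\<lambda>t. \<phi> t * exp (- C * t)) has_real_derivative (\<phi>' t - C * \<phi> t) * exp (- C * t)) (at t)"
      by (auto intro!: derivative_eq_intros \<phi> t simp: algebra_simps)
    moreover have "(\<phi>' t - C * \<phi> t) * exp (- C * t) \<le> 0"
      using le[OF t] by (simp add: mult_nonpos_nonneg)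
    ultimately show "\<exists>y. ((\<lambda>t. \<phi> t * exp (- C * t)) has_real_derivative y) (at t) \<and> y \<le> 0"
      by blast
  qed
  then show ?thesis using \<open>\<phi> 0 = 0\<close> by (simp add: mult_le_0_iff)
qed

text \<open>The function \<open>\<phi>\<close> measures how far \<open>\<nu>\<close> is from being
  normal to the image of \<open>dF\<close>. As \<open>dderiv2_normal_bound\<close> bounds its
  derivative along segments by a multiple of \<open>\<phi>\<close> itself, Gronwall makes the zero
  set open; it is also closed in the connected set \<open>D\<close>.\<close>

lemma normal_direction_constant:
  fixes F :: "real^'n \<Rightarrow> real^'m"
  assumes D: "open D" "connected D" and sm: "smooth_on D F" and min: "minimal_graph_on D F"
    and S: "\<And>y. y \<in> D \<Longrightarrow> singular_sum F y = 1"
    and rank: "\<And>y. y \<in> D \<Longrightarrow> rank (jacobian F (at y)) = 2"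
    and x0: "x0 \<in> D" "\<And>v. dderiv v F x0 \<bullet> \<nu> = 0" and y: "y \<in> D"
  shows "dderiv v F y \<bullet> \<nu> = 0"
proof -
  note dF = smooth_on_differentiable[OF sm]
  note dF2 = smooth_on_differentiable[OF smooth_on_dderiv[OF sm]]
  define Z where "Z = (\<Inter>i\<in>UNIV. {x \<in> D. dderiv (axis i 1) F x \<bullet> \<nu> = 0})"
  define \<phi> where "\<phi> x = (\<Sum>i\<in>UNIV. (dderiv (axis i 1) F x \<bullet> \<nu>)\<^sup>2)" for x
  have Z\<phi>: "x \<in> Z \<longleftrightarrow> x \<in> D \<and> \<phi> x = 0" for x
    unfolding Z_def \<phi>_def by (auto simp: sum_nonneg_eq_0_iff)
  have \<phi>0: "0 \<le> \<phi> x" for x unfolding \<phi>_def by (intro sum_nonneg) simp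
  have M: "\<bar>dderiv u F x \<bullet> \<nu>\<bar> \<le> sqrt (\<phi> x)" if "x \<in> D" "norm u = 1" for x u
  proof -
    have "dderiv u F x \<bullet> \<nu> = (\<Sum>i\<in>UNIV. (u \<bullet> axis i 1) * (dderiv (axis i 1) F x \<bullet> \<nu>))"
      by (subst dderiv_expansion[OF dF[OF that(1)]]) (simp add: inner_sum_left)
    then have "(dderiv u F x \<bullet> \<nu>)\<^sup>2 \<le> (\<Sum>i\<in>UNIV. (u \<bullet> axis i 1)\<^sup>2) * \<phi> x"
      unfolding \<phi>_def by (simp only: Cauchy_Schwarz_ineq_sum)
    also have "(\<Sum>i\<in>UNIV. (u \<bullet> axis i 1)\<^sup>2) = u \<bullet> u"
      using orthonormal_parseval[OF orthonormal_axis, of u u] by (simp add: power2_eq_square)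
    also have "u \<bullet> u = 1" using that(2) by (simp add: power2_norm_eq_inner[symmetric])
    finally show ?thesis by (simp add: real_le_rsqrt)
  qed
  have "closedin (top_of_set D) Z"
    unfolding Z_def
    by (intro closedin_Inter)
      (auto intro!: continuous_closedin_preimage_constant continuous_on_inner
        smooth_on_continuous[OF smooth_on_dderiv[OF sm]])
  moreover have "open Z"
    unfolding open_contains_ball
  proof
    fix x assume x: "x \<in> Z"
    then have xD: "x \<in> D" by (simp add: Z\<phi>)
    then obtain r where r: "r > 0" "cball x r \<subseteq> D" using D(1) open_contains_cball by blast
    obtain \<Lambda> where \<Lambda>: "\<And>x' u. x' \<in> cball x r \<Longrightarrow> norm u = 1 \<Longrightarrow> norm (dderiv u F x') \<le> \<Lambda>"
      using dderiv_bounded_on_compact[OF compact_cball r(2) sm] by blast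
    obtain K where K: "\<And>x' u v. x' \<in> cball x r \<Longrightarrow> norm u = 1 \<Longrightarrow> norm v = 1 \<Longrightarrow>
        norm (dderiv u (dderiv v F) x') \<le> K"
      using dderiv2_bounded_on_compact[OF compact_cball r(2) D(1) sm] by blast
    have "z \<in> Z" if z: "z \<in> ball x r" "z \<noteq> x" for z
    proof -
      define T where "T = norm (z - x)"
      define v where "v = (1 / T) *\<^sub>R (z - x)"
      have T: "0 < T" "T < r" using z by (auto simp: T_def dist_norm norm_minus_commute)
      have v: "norm v = 1" "x + T *\<^sub>R v = z" using T by (auto simp: v_def T_def)
      have mem: "x + t *\<^sub>R v \<in> cball x r" if "0 \<le> t" "t \<le> T" for t
        using that T v(1) by (simp add: dist_norm)
      define \<phi>' where "\<phi>' t = (\<Sum>i\<in>UNIV. 2 * (dderiv (axis i 1) F (x + t *\<^sub>R v) \<bullet> \<nu>) *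
        (dderiv v (dderiv (axis i 1) F) (x + t *\<^sub>R v) \<bullet> \<nu>))" for t
      have "\<phi> (x + T *\<^sub>R v) \<le> 0"
      \<comment> \<open>The constant collects one summand per coordinate, each at most
        \<open>2 * sqrt (\<phi> q)\<close> times the normal bound
        \<open>2 * K * \<Lambda> * sqrt (\<phi> q)\<close>.\<close>
      proof (rule gronwall_zero[where \<phi> = "\<lambda>t. \<phi> (x + t *\<^sub>R v)" and \<phi>' = \<phi>' and C = "4 * real CARD('n) * K * \<Lambda>"])
        fix t assume t: "0 \<le> t" "t \<le> T"
        define q where "q = x + t *\<^sub>R v"
        have q: "q \<in> cball x r" "q \<in> D" using mem[OF t] r(2) by (auto simp: q_def)
        have "((\<lambda>t. (dderiv (axis i 1) F (x + t *\<^sub>R v) \<bullet> \<nu>)\<^sup>2) has_real_derivative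
            2 * (dderiv (axis i 1) F (x + t *\<^sub>R v) \<bullet> \<nu>) * (dderiv v (dderiv (axis i 1) F) (x + t *\<^sub>R v) \<bullet> \<nu>)) (at t)" for i
        proof -
          have "((\<lambda>t. dderiv (axis i 1) F (x + t *\<^sub>R v) \<bullet> \<nu>) has_real_derivative
              dderiv v (dderiv (axis i 1) F) (x + t *\<^sub>R v) \<bullet> \<nu>) (at t)"
            using has_derivative_line[OF dF2[OF q(2)[unfolded q_def], of "axis i 1"]]
            unfolding has_real_derivative_iff_has_vector_derivative has_vector_derivative_def
            by (auto dest: has_derivative_inner_left)
          then show ?thesis by (auto intro!: derivative_eq_intros)
        qed
        then show "((\<lambda>t. \<phi> (x + t *\<^sub>R v)) has_real_derivative \<phi>' t) (at t)"
          unfolding \<phi>_def \<phi>'_def by (intro DERIV_sum)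
        have s: "\<bar>2 * (dderiv (axis i 1) F q \<bullet> \<nu>) * (dderiv v (dderiv (axis i 1) F) q \<bullet> \<nu>)\<bar> \<le> 4 * K * \<Lambda> * \<phi> q" for i
        proof -
          have "\<bar>dderiv v (dderiv (axis i 1) F) q \<bullet> \<nu>\<bar> \<le> 2 * K * \<Lambda> * sqrt (\<phi> q)"
            by (rule dderiv2_normal_bound[OF D(1) q(2) sm min S rank[OF q(2)]])
              (use K[OF q(1) v(1), of "axis i 1"] \<Lambda>[OF q(1)] M[OF q(2)] in auto)
          moreover have "\<bar>dderiv (axis i 1) F q \<bullet> \<nu>\<bar> \<le> sqrt (\<phi> q)"
            by (rule M[OF q(2)]) simp
          ultimately have "\<bar>dderiv (axis i 1) F q \<bullet> \<nu>\<bar> * \<bar>dderiv v (dderiv (axis i 1) F) q \<bullet> \<nu>\<bar> \<le>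
              sqrt (\<phi> q) * (2 * K * \<Lambda> * sqrt (\<phi> q))"
            using \<phi>0 by (intro mult_mono) auto
          also have "\<dots> = 2 * K * \<Lambda> * \<phi> q"
            using real_sqrt_pow2[OF \<phi>0[of q]] by (simp add: power2_eq_square)
          finally show ?thesis by (simp add: abs_mult)
        qed
        have "\<phi>' t \<le> (\<Sum>i\<in>(UNIV::'n set). 4 * K * \<Lambda> * \<phi> q)"
          unfolding \<phi>'_def q_def[symmetric] by (rule sum_mono) (rule order_trans[OF abs_ge_self s])
        then show "\<phi>' t \<le> 4 * real CARD('n) * K * \<Lambda> * \<phi> (x + t *\<^sub>R v)"
          by (simp add: q_def mult_ac)
      qed (use T x Z\<phi> in auto)
      then have "\<phi> z = 0" using \<phi>0[of z] by (simp add: v(2))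
      moreover have "z \<in> D" using z r(2) by auto
      ultimately show ?thesis by (simp add: Z\<phi>)
    qed
    then have "ball x r \<subseteq> Z" using x by blast
    then show "\<exists>e>0. ball x e \<subseteq> Z" using r(1) by blast
  qed
  then have "openin (top_of_set D) Z" by (auto simp: D(1) openin_open_eq Z\<phi>)
  moreover have "x0 \<in> Z" using x0 by (simp add: Z_def)
  ultimately have "Z = D" using D(2) unfolding connected_clopen by blast
  then have "dderiv (axis i 1) F y \<bullet> \<nu> = 0" for i using y unfolding Z_def by blast
  then show ?thesis
    by (subst dderiv_expansion[OF dF[OF y]]) (simp add: inner_sum_left)
qed

text \<open>The component \<open>z\<close> of \<open>F x - F x0\<close> orthogonal to the image
  \<open>V\<close> of \<open>dF\<close> at \<open>x0\<close> is orthogonal to the image of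
  \<open>dF\<close> everywhere. Hence \<open>F \<bullet> z\<close> is constant on \<open>D\<close>,
  which forces \<open>z \<bullet> z = 0\<close>; the plane is \<open>V\<close> translated by
  \<open>F x0\<close>.\<close>

lemma image_in_plane_if_rank_2:
  fixes F :: "real^'n \<Rightarrow> real^'m"
  assumes D: "open D" "connected D" "D \<noteq> {}" and sm: "smooth_on D F" and min: "minimal_graph_on D F"
    and S: "\<And>y. y \<in> D \<Longrightarrow> singular_sum F y = 1"
    and rank: "\<And>y. y \<in> D \<Longrightarrow> rank (jacobian F (at y)) = 2"
  shows "\<exists>P. affine P \<and> aff_dim P = 2 \<and> F ` D \<subseteq> P"
proof -
  note dF = smooth_on_differentiable[OF sm]
  obtain x0 where x0: "x0 \<in> D" using D(3) by blast
  define V where "V = range ((*v) (jacobian F (at x0)))"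
  have V: "subspace V" unfolding V_def by (rule linear_subspace_image) auto
  have dimV: "dim V = 2" using rank[OF x0] unfolding V_def rank_dim_range .
  have "F x - F x0 \<in> V" if x: "x \<in> D" for x
  proof -
    obtain y z where yz: "y \<in> span V" "\<And>t. t \<in> span V \<Longrightarrow> orthogonal z t" "F x - F x0 = y + z"
      using orthogonal_subspace_decomp_exists by blast
    have sp: "span V = V" using V by (simp add: span_eq_iff)
    have "dderiv v F x0 \<bullet> z = 0" for v
    proof -
      have "dderiv v F x0 \<in> V" unfolding V_def jacobian_mult_dderiv[OF dF[OF x0], symmetric] by blast
      then show ?thesis using yz(2)[of "dderiv v F x0"] by (simp add: sp orthogonal_def inner_commute)
    qed
    then have n: "dderiv v F y \<bullet> z = 0" if "y \<in> D" for v y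
      using normal_direction_constant[OF D(1,2) sm min S rank x0 _ that] by blast
    have "F x \<bullet> z = F x0 \<bullet> z"
    proof (rule has_derivative_zero_unique_connected[OF D(1,2), where f = "\<lambda>x. F x \<bullet> z"])
      fix y assume "y \<in> D"
      then show "((\<lambda>x. F x \<bullet> z) has_derivative (\<lambda>h. 0)) (at y)"
        using has_derivative_inner_left[OF has_derivative_dderiv[OF dF], of y z] n by simp
    qed (use x x0 in auto)
    then have "(y + z) \<bullet> z = 0" unfolding yz(3)[symmetric] by (simp add: inner_diff_left)
    moreover have "y \<bullet> z = 0" using yz(1,2) by (auto simp: orthogonal_def inner_commute)
    ultimately have "z = 0" by (simp add: inner_add_left)
    then show ?thesis using yz(1,3) sp by simp
  qed
  then have "F ` D \<subseteq> (+) (F x0) ` V"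
    by (auto intro!: image_eqI[where x = "F _ - F x0"])
  moreover have "affine ((+) (F x0) ` V)"
    using subspace_imp_affine[OF V] affine_translation by blast
  moreover have "aff_dim ((+) (F x0) ` V) = 2"
    using aff_dim_subspace[OF V] dimV by (simp add: aff_dim_translation_eq)
  ultimately show ?thesis by blast
qed

theorem theorem1p2:
  fixes D :: "(real^'n) set" and F :: "real^'n \<Rightarrow> real^'m"
  assumes "open D" and "connected D" and "D \<noteq> {}"
    and "smooth_on D F"
    and "minimal_graph_on D F"
    and "\<forall>x\<in>D. singular_sum F x \<le> 1"
  shows "((\<forall>x\<in>D. singular_sum F x < 1) \<or> (\<forall>x\<in>D. singular_sum F x = 1)) \<and>
    ((\<forall>x\<in>D. singular_sum F x = 1) \<longrightarrow>
       ((\<exists>x0\<in>D. rank (jacobian F (at x0)) \<ge> 3) \<and> affine_map_on D F) \<or>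
       ((\<forall>x\<in>D. rank (jacobian F (at x)) = 2) \<and>
        (\<exists>P. affine P \<and> aff_dim P = 2 \<and> F ` D \<subseteq> P)))"
proof (intro conjI impI)
  show "(\<forall>x\<in>D. singular_sum F x < 1) \<or> (\<forall>x\<in>D. singular_sum F x = 1)"
    using singular_sum_strong_maximum[OF assms(1,2,4,5)] assms(6) by (meson order_le_less)
next
  assume S: "\<forall>x\<in>D. singular_sum F x = 1"
  show "((\<exists>x0\<in>D. rank (jacobian F (at x0)) \<ge> 3) \<and> affine_map_on D F) \<or>
       ((\<forall>x\<in>D. rank (jacobian F (at x)) = 2) \<and>
        (\<exists>P. affine P \<and> aff_dim P = 2 \<and> F ` D \<subseteq> P))"
  proof (cases "\<exists>x0\<in>D. rank (jacobian F (at x0)) \<ge> 3")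
    case True
    then show ?thesis using affine_if_rank_ge_3[OF assms(1,2,4,5)] S by blast
  next
    case False
    have rank: "rank (jacobian F (at x)) = 2" if "x \<in> D" for x
      using rank_jacobian_ge_2[of F x] S False that by force
    then show ?thesis using image_in_plane_if_rank_2[OF assms(1-5)] S by blast
  qed
qed

end
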